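(* The variety of complex $3$-dimensional semi-alternative algebras has dimension $9$ and it has exactly $7$ irreducible components, namely $$\overline{\mathcal{O}(\mathrm{A}_{07})},\ \overline{\mathcal{O}(\mathrm{S}_{03})},\ \overline{\mathcal{O}(\mathrm{S}_{06})},\ \overline{\mathcal{O}(\mathrm{S}_{09})},\ \overline{\mathcal{O}(\mathrm{S}_{11})},\ \overline{\mathcal{O}(\mathrm{S}_{12})},\ \overline{\mathcal{O}(\mathrm{S}_{13})}.$$ In particular, there are exactly $7$ rigid algebras (up to isomorphism) in this variety.
   Context: Write $(x,y,z)=(xy)z-x(yz)$. An algebra is semi-alternative if $(x,y,z)=(y,z,x)$ for all $x,y,z$. Let $\mathbb{V}=\mathbb{C}^3$. The variety of complex $3$-dimensional semi-alternative algebras is the Zariski-closed subset of $\mathrm{Hom}(\mathbb{V}\otimes\mathbb{V},\mathbb{V})\cong\mathbb{C}^{27}$ (coordinates: structure constants) consisting of the semi-alternative multiplications. $\mathrm{GL}(\mathbb{V})$ acts by $(g*\mu)(x\otimes y)=g\mu(g^{-1}x\otimes g^{-1}y)$; $\mathcal{O}(\mathrm{A})$ is the orbit of a structure representing the algebra $\mathrm{A}$, and the bar denotes Zariski closure. An algebra is rigid in the variety if its orbit is an open subset of the variety. The algebras, in a basis $e_1,e_2,e_3$ (products not listed are zero): $\mathrm{A}_{07}$: $e_1e_1=e_1$, $e_2e_2=e_2$, $e_3e_3=e_3$; $\mathrm{S}_{03}$: $e_1e_1=2e_1+e_2+e_3$, $e_1e_2=2e_2$, $e_3e_1=2e_3$;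 $\mathrm{S}_{06}$: $e_1e_1=2e_1+e_2$, $e_2e_1=2e_2$, $e_3e_3=e_3$; $\mathrm{S}_{09}$: $e_1e_1=2e_1+e_2$, $e_1e_2=2e_2$, $e_3e_3=e_3$; $\mathrm{S}_{11}$: $e_1e_1=e_2+e_3$, $e_1e_2=e_2$, $e_2e_1=-e_2$, $e_1e_3=e_1$, $e_3e_1=e_1$, $e_2e_3=e_2$, $e_3e_2=e_2$, $e_3e_3=e_3$; $\mathrm{S}_{12}$: $e_1e_1=2e_1+e_2$, $e_1e_2=2e_2$, $e_1e_3=2e_3$; $\mathrm{S}_{13}$: $e_1e_1=2e_1+e_2$, $e_2e_1=2e_2$, $e_3e_1=2e_3$. *)

theory Defs
  imports "HOL-Analysis.Analysis" "HOL-Library.Extended_Nat"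
begin

section \<open>Irreducibility and dimension of topological spaces\<close>

definition irreducible_in :: "'a topology \<Rightarrow> 'a set \<Rightarrow> bool" where
  "irreducible_in X S \<longleftrightarrow> S \<subseteq> topspace X \<and> S \<noteq> {} \<and>
     (\<forall>A B. closedin X A \<and> closedin X B \<and> S \<subseteq> A \<union> B \<longrightarrow> S \<subseteq> A \<or> S \<subseteq> B)"

definition irreducible_components :: "'a topology \<Rightarrow> 'a set set" where
  "irreducible_components X =
     {S. irreducible_in X S \<and> (\<forall>T. irreducible_in X T \<and> S \<subseteq> T \<longrightarrow> T = S)}"

text \<open>Krull dimension: the supremum of the lengths \<open>n\<close> of strict chains
  \<open>Z 0 \<subset> \<dots> \<subset> Z n\<close> of irreducible closed subsets.\<close>

definition krull_dim :: "'a topology \<Rightarrow> enat" where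
  "krull_dim X = Sup {enat n | n. \<exists>Z :: nat \<Rightarrow> 'a set.
     (\<forall>i\<le>n. closedin X (Z i) \<and> irreducible_in X (Z i)) \<and> (\<forall>i<n. Z i \<subset> Z (Suc i))}"


section \<open>Three-dimensional algebras and the Zariski topology\<close>

text \<open>A bilinear multiplication on \<open>\<complex>\<^sup>3\<close> is given by its structure constants:
  \<open>\<mu> $ i $ j\<close> is the product \<open>e\<^sub>i e\<^sub>j\<close>, so \<open>\<mu> $ i $ j $ k\<close> is its coefficient at \<open>e\<^sub>k\<close>.\<close>

type_synonym alg3 = "complex^3^3^3"

definition mult :: "alg3 \<Rightarrow> complex^3 \<Rightarrow> complex^3 \<Rightarrow> complex^3" where
  "mult \<mu> x y = (\<Sum>i\<in>UNIV. \<Sum>j\<in>UNIV. (x $ i * y $ j) *s (\<mu> $ i $ j))"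

inductive polynomial_fun :: "(alg3 \<Rightarrow> complex) \<Rightarrow> bool" where
  const: "polynomial_fun (\<lambda>\<mu>. c)"
| coord: "polynomial_fun (\<lambda>\<mu>. \<mu> $ i $ j $ k)"
| add: "polynomial_fun f \<Longrightarrow> polynomial_fun g \<Longrightarrow> polynomial_fun (\<lambda>\<mu>. f \<mu> + g \<mu>)"
| mult: "polynomial_fun f \<Longrightarrow> polynomial_fun g \<Longrightarrow> polynomial_fun (\<lambda>\<mu>. f \<mu> * g \<mu>)"

definition zero_set :: "(alg3 \<Rightarrow> complex) set \<Rightarrow> alg3 set" where
  "zero_set P = {\<mu>. \<forall>p\<in>P. p \<mu> = 0}"

definition algebraic_set :: "alg3 set \<Rightarrow> bool" where
  "algebraic_set Z \<longleftrightarrow> (\<exists>P. (\<forall>p\<in>P. polynomial_fun p) \<and> Z = zero_set P)"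

definition zariski :: "alg3 topology" where
  "zariski = topology (\<lambda>U. algebraic_set (- U))"

lemma algebraic_set_Un:
  assumes "algebraic_set Y" "algebraic_set Z"
  shows "algebraic_set (Y \<union> Z)"
proof -
  obtain P Q where P: "\<forall>p\<in>P. polynomial_fun p" "Y = zero_set P"
    and Q: "\<forall>q\<in>Q. polynomial_fun q" "Z = zero_set Q"
    using assms unfolding algebraic_set_def by blast
  define R where "R = (\<lambda>(p, q) \<mu>. p \<mu> * q \<mu>) ` (P \<times> Q)"
  have "\<forall>r\<in>R. polynomial_fun r"
    using P(1) Q(1) by (auto simp: R_def intro: polynomial_fun.mult)
  moreover have "Y \<union> Z = zero_set R"
    unfolding P(2) Q(2) by (auto simp: zero_set_def R_def)
  ultimately show ?thesis
    unfolding algebraic_set_def by blast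
qed

lemma algebraic_set_INT:
  assumes "\<And>Z. Z \<in> \<Z> \<Longrightarrow> algebraic_set Z"
  shows "algebraic_set (\<Inter>\<Z>)"
proof -
  define P where "P = {p. polynomial_fun p \<and> (\<exists>Z\<in>\<Z>. \<forall>\<mu>\<in>Z. p \<mu> = 0)}"
  have "zero_set P \<subseteq> \<Inter>\<Z>"
  proof
    fix \<mu> assume \<mu>: "\<mu> \<in> zero_set P"
    show "\<mu> \<in> \<Inter>\<Z>"
    proof
      fix Z assume Z: "Z \<in> \<Z>"
      obtain Q where Q: "\<forall>q\<in>Q. polynomial_fun q" "Z = zero_set Q"
        using assms[OF Z] unfolding algebraic_set_def by blast
      have "\<forall>q\<in>Q. \<forall>\<nu>\<in>Z. q \<nu> = 0"
        using Q(2) by (auto simp: zero_set_def)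
      then have "Q \<subseteq> P"
        using Z Q(1) unfolding P_def by blast
      with \<mu> Q(2) show "\<mu> \<in> Z"
        by (auto simp: zero_set_def)
    qed
  qed
  moreover have "\<Inter>\<Z> \<subseteq> zero_set P"
    by (auto simp: P_def zero_set_def)
  ultimately have "\<Inter>\<Z> = zero_set P"
    by (rule subset_antisym[rotated])
  moreover have "\<forall>p\<in>P. polynomial_fun p"
    by (simp add: P_def)
  ultimately show ?thesis
    unfolding algebraic_set_def by blast
qed

lemma openin_zariski: "openin zariski U \<longleftrightarrow> algebraic_set (- U)"
proof -
  have "istopology (\<lambda>U. algebraic_set (- U))"
    unfolding istopology_def
  proof (intro conjI allI impI)
    fix S T assume "algebraic_set (- S)" "algebraic_set (- T)"
    then show "algebraic_set (- (S \<inter> T))"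
      by (simp add: algebraic_set_Un)
  next
    fix \<K> :: "alg3 set set" assume "\<forall>K\<in>\<K>. algebraic_set (- K)"
    then have "algebraic_set (\<Inter> (uminus ` \<K>))"
      by (intro algebraic_set_INT) auto
    then show "algebraic_set (- \<Union>\<K>)"
      by (simp add: uminus_Sup)
  qed
  then show ?thesis
    by (simp add: zariski_def topology_inverse')
qed

lemma topspace_zariski [simp]: "topspace zariski = UNIV"
proof -
  have "algebraic_set (- UNIV)"
    unfolding algebraic_set_def zero_set_def
    by (rule exI[of _ "{\<lambda>_. 1}"]) (auto intro: polynomial_fun.const)
  then show ?thesis
    using openin_subset[of zariski UNIV] by (auto simp: openin_zariski)
qed

lemma closedin_zariski: "closedin zariski Z \<longleftrightarrow> algebraic_set Z"
  by (simp add: closedin_def openin_zariski Diff_eq)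


section \<open>Semi-alternative algebras, orbits and rigidity\<close>

definition associator :: "alg3 \<Rightarrow> complex^3 \<Rightarrow> complex^3 \<Rightarrow> complex^3 \<Rightarrow> complex^3" where
  "associator \<mu> x y z = mult \<mu> (mult \<mu> x y) z - mult \<mu> x (mult \<mu> y z)"

definition semi_alternative :: "alg3 set" where
  "semi_alternative = {\<mu>. \<forall>x y z. associator \<mu> x y z = associator \<mu> y z x}"

lemma closedin_semi_alternative: "closedin zariski semi_alternative"
proof -
  define P where
    "P = range (\<lambda>(x, y, z, k) \<mu>. associator \<mu> x y z $ k + (-1) * associator \<mu> y z x $ k)"
  have mult_comp: "polynomial_fun (\<lambda>\<mu>. mult \<mu> (X \<mu>) (Y \<mu>) $ k)"
    if "\<And>i. polynomial_fun (\<lambda>\<mu>. X \<mu> $ i)" "\<And>i. polynomial_fun (\<lambda>\<mu>. Y \<mu> $ i)" for X Y k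
    unfolding mult_def sum_3 vector_add_component vector_smult_component
    by (intro polynomial_fun.add polynomial_fun.mult polynomial_fun.coord that)
  have assoc: "polynomial_fun (\<lambda>\<mu>. associator \<mu> x y z $ k)" for x y z k
  proof -
    have "polynomial_fun (\<lambda>\<mu>. mult \<mu> (mult \<mu> x y) z $ k + (-1) * mult \<mu> x (mult \<mu> y z) $ k)"
      by (intro polynomial_fun.add polynomial_fun.mult[OF polynomial_fun.const] mult_comp
          polynomial_fun.const)
    then show ?thesis
      by (simp add: associator_def)
  qed
  have "\<forall>p\<in>P. polynomial_fun p"
    using polynomial_fun.add[OF assoc polynomial_fun.mult[OF polynomial_fun.const assoc]]
    by (simp only: P_def ball_simps split_paired_All prod.case ball_UNIV) simp
  moreover have "semi_alternative = zero_set P"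
    by (simp add: semi_alternative_def zero_set_def P_def vec_eq_iff)
  ultimately show ?thesis
    unfolding closedin_zariski algebraic_set_def by blast
qed

abbreviation semi_alternative_variety :: "alg3 topology" where
  "semi_alternative_variety \<equiv> subtopology zariski semi_alternative"

abbreviation e :: "3 \<Rightarrow> complex^3" where
  "e i \<equiv> axis i 1"

definition gl_act :: "complex^3^3 \<Rightarrow> alg3 \<Rightarrow> alg3" where
  "gl_act g \<mu> = (\<chi> i j. g *v mult \<mu> (matrix_inv g *v e i) (matrix_inv g *v e j))"

definition orbit :: "alg3 \<Rightarrow> alg3 set" where
  "orbit \<mu> = {gl_act g \<mu> | g. invertible g}"

text \<open>The algebras in \<open>V\<close> whose orbit is open in \<open>V\<close>, for a set \<open>V\<close> of algebras.\<close>

definition rigid_algebras :: "alg3 set \<Rightarrow> alg3 set" where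
  "rigid_algebras V = {\<mu> \<in> V. openin (subtopology zariski V) (orbit \<mu>)}"

definition alg_iso :: "(alg3 \<times> alg3) set" where
  "alg_iso = {(\<mu>, \<nu>). \<exists>g :: complex^3^3. invertible g \<and>
     (\<forall>x y. g *v mult \<mu> x y = mult \<nu> (g *v x) (g *v y))}"


section \<open>The algebras, as multiplication tables\<close>

definition A07 :: alg3 where
  "A07 = vector [vector [e 1, 0,   0  ],
                 vector [0,   e 2, 0  ],
                 vector [0,   0,   e 3]]"

definition S03 :: alg3 where
  "S03 = vector [vector [2 *s e 1 + e 2 + e 3, 2 *s e 2, 0],
                 vector [0,                    0,        0],
                 vector [2 *s e 3,             0,        0]]"

definition S06 :: alg3 where
  "S06 = vector [vector [2 *s e 1 + e 2, 0, 0  ],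
                 vector [2 *s e 2,       0, 0  ],
                 vector [0,              0, e 3]]"

definition S09 :: alg3 where
  "S09 = vector [vector [2 *s e 1 + e 2, 2 *s e 2, 0  ],
                 vector [0,              0,        0  ],
                 vector [0,              0,        e 3]]"

definition S11 :: alg3 where
  "S11 = vector [vector [e 2 + e 3, e 2, e 1],
                 vector [- e 2,     0,   e 2],
                 vector [e 1,       e 2, e 3]]"

definition S12 :: alg3 where
  "S12 = vector [vector [2 *s e 1 + e 2, 2 *s e 2, 2 *s e 3],
                 vector [0,              0,        0       ],
                 vector [0,              0,        0       ]]"

definition S13 :: alg3 where
  "S13 = vector [vector [2 *s e 1 + e 2, 0, 0],
                 vector [2 *s e 2,       0, 0],
                 vector [2 *s e 3,       0, 0]]"

end

theory Submission
  imports Defs "HOL-Computational_Algebra.Fundamental_Theorem_Algebra"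
begin

text \<open>Orbits are irreducible, because any two of their points lie on a rational curve \<open>t \<mapsto> g\<^sub>t * \<mu>\<close>. Hence
  it suffices to show that the seven orbits are open in the variety and pairwise distinct, and that
  their closures cover it.

  For the covering, put \<open>n x = x x\<^sup>2 - x\<^sup>2 x\<close>. If \<open>x\<close>, \<open>x\<^sup>2\<close>, \<open>n x\<close> are independent for some \<open>x\<close>, then the
  multiplication table in this basis is determined by the left and right multiplication with \<open>x\<close>, and
  the identities leave three two-parameter families and one exceptional curve; their generic members
  lie in the orbits of \<open>S09\<close>, \<open>S06\<close>, \<open>S11\<close>, \<open>S03\<close>. If \<open>n\<close> is nonzero but these vectors are always
  dependent, then \<open>x\<close> generates a two-dimensional subalgebra and the algebra is \<open>S12\<close>, \<open>S13\<close> or a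
  degeneration of \<open>S03\<close>. If \<open>n\<close> vanishes, then either every \<open>x\<^sup>2\<close> is a multiple of \<open>x\<close>, or some
  \<open>x\<close>, \<open>x\<^sup>2\<close>, \<open>x\<^sup>3\<close> are independent and the algebra is a degeneration of \<open>A07\<close>, or the algebra is associative and
  is treated by comparing the traces of left and right multiplications. Every table that occurs
  belongs to a polynomial family whose generic member is one of the seven algebras.

  The dimension is at most nine since \<open>n\<close> functions that are algebraically independent on an orbit pull
  back to \<open>GL\<^sub>3\<close>, where monomials in them can be counted; a chain of length nine is obtained from the
  commutative algebras \<open>p(L) v \<cdot> q(L) v = p(L) L q(L) v\<close> by freeing the entries of \<open>L\<close> one by one.\<close>

subsection \<open>Polynomial functions and closures\<close>

text \<open>No list of all algebras is needed. The normal forms keep their parameters; at special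
  values, such as g = 0 or g = 1, the change of basis to a representative breaks down, and these
  values are absorbed by the fact that a polynomial family lies in a Zariski closed set as soon as
  its generic members do. The vanishing of n is the natural dividing line because linearization
  together with the cyclic symmetry then makes the associator alternating. Traces enter in the
  associative case because the eigenvalues p3 and q3 of x on a quotient line differ by the
  difference of the traces of left and right multiplication by x: if they differ, the commutator
  [x, y] is an eigenvector with square zero; if the traces agree for all elements, this equality is
  an extra equation. Openness needs no tangent spaces: each orbit gets one polynomial that is
  nonzero at the representative and, inside the variety, only at points of the orbit. For A07, S12
  and S13 it has a factor vanishing on the closures of competing orbits, so that openness there
  rests on the normal forms. Nine is the dimension of GL_3, attained because A07 has a finite
  automorphism group.\<close>

lemma polynomial_fun_uminus: "polynomial_fun f \<Longrightarrow> polynomial_fun (\<lambda>\<mu>. - f \<mu>)"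
  using polynomial_fun.mult[OF polynomial_fun.const[of "-1"]] by simp

lemma polynomial_fun_diff:
  "polynomial_fun f \<Longrightarrow> polynomial_fun g \<Longrightarrow> polynomial_fun (\<lambda>\<mu>. f \<mu> - g \<mu>)"
  using polynomial_fun.add[OF _ polynomial_fun_uminus] by fastforce

lemma polynomial_fun_power: "polynomial_fun f \<Longrightarrow> polynomial_fun (\<lambda>\<mu>. f \<mu> ^ n)"
  by (induction n) (auto intro: polynomial_fun.intros)

lemma polynomial_fun_mult_nth:
  "polynomial_fun (\<lambda>\<mu>. mult \<mu> (X \<mu>) (Y \<mu>) $ k)"
  if "\<And>i. polynomial_fun (\<lambda>\<mu>. X \<mu> $ i)" "\<And>i. polynomial_fun (\<lambda>\<mu>. Y \<mu> $ i)"
  unfolding mult_def sum_3 vector_add_component vector_smult_component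
  by (intro polynomial_fun.intros that)

lemma polynomial_fun_sum:
  "(\<And>i. i \<in> A \<Longrightarrow> polynomial_fun (f i)) \<Longrightarrow> polynomial_fun (\<lambda>\<mu>. \<Sum>i\<in>A. f i \<mu>)"
  by (induction A rule: infinite_finite_induct) (auto intro: polynomial_fun.intros)

lemmas polynomial_fun_intros = polynomial_fun_mult_nth polynomial_fun.intros
  polynomial_fun_diff polynomial_fun_uminus polynomial_fun_power

lemma closedin_zero_fun: "polynomial_fun f \<Longrightarrow> closedin zariski {\<mu>. f \<mu> = 0}"
  unfolding closedin_zariski algebraic_set_def zero_set_def by (intro exI[of _ "{f}"]) auto

lemma openin_nonzero_fun: "polynomial_fun f \<Longrightarrow> openin zariski {\<mu>. f \<mu> \<noteq> 0}"
  using closedin_zero_fun[of f] by (simp add: closedin_def Diff_eq Collect_neg_eq)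

lemma closedin_mem_iff:
  assumes "closedin zariski C"
  shows "\<mu> \<in> C \<longleftrightarrow> (\<forall>f. polynomial_fun f \<longrightarrow> (\<forall>\<nu>\<in>C. f \<nu> = 0) \<longrightarrow> f \<mu> = 0)"
  using assms unfolding closedin_zariski algebraic_set_def zero_set_def by fastforce

lemma closure_of_vanishing:
  assumes "polynomial_fun f" "\<forall>\<nu>\<in>S. f \<nu> = 0" "\<mu> \<in> zariski closure_of S"
  shows "f \<mu> = 0"
  using closure_of_minimal[OF _ closedin_zero_fun[OF assms(1)], of S] assms(2,3) by blast

section \<open>Polynomials in one variable and rational curves\<close>

definition pfun :: "(complex \<Rightarrow> complex) \<Rightarrow> bool" where
  "pfun f \<longleftrightarrow> (\<exists>p. \<forall>t. f t = poly p t)"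

lemma pfun_const: "pfun (\<lambda>t. c)"
  unfolding pfun_def by (rule exI[of _ "[:c:]"]) simp

lemma pfun_id: "pfun (\<lambda>t. t)"
  unfolding pfun_def by (rule exI[of _ "[:0,1:]"]) simp

lemma pfun_add: "pfun f \<Longrightarrow> pfun g \<Longrightarrow> pfun (\<lambda>t. f t + g t)"
  unfolding pfun_def by (metis poly_add)

lemma pfun_mult: "pfun f \<Longrightarrow> pfun g \<Longrightarrow> pfun (\<lambda>t. f t * g t)"
  unfolding pfun_def by (metis poly_mult)

lemma pfun_uminus: "pfun f \<Longrightarrow> pfun (\<lambda>t. - f t)"
  unfolding pfun_def by (metis poly_minus)

lemma pfun_diff: "pfun f \<Longrightarrow> pfun g \<Longrightarrow> pfun (\<lambda>t. f t - g t)"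
  unfolding pfun_def by (metis poly_diff)

lemma pfun_power: "pfun f \<Longrightarrow> pfun (\<lambda>t. f t ^ n)"
  unfolding pfun_def by (metis poly_power)

lemma pfun_sum: "(\<And>i. i \<in> A \<Longrightarrow> pfun (f i)) \<Longrightarrow> pfun (\<lambda>t. \<Sum>i\<in>A. f i t)"
  by (induction A rule: infinite_finite_induct) (auto intro: pfun_const pfun_add)

lemma pfun_if: "pfun f \<Longrightarrow> pfun g \<Longrightarrow> pfun (\<lambda>t. if P then f t else g t)"
  by (cases P) simp_all

lemmas pfun_intros = pfun_const pfun_id pfun_add pfun_mult pfun_uminus pfun_diff pfun_power pfun_sum

lemma pfun_mult_eq_zero:
  assumes "pfun f" "pfun g" "\<And>t. f t * g t = 0" "g u \<noteq> 0"
  shows "f t = 0"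
proof -
  obtain p q where p: "\<And>t. f t = poly p t" and q: "\<And>t. g t = poly q t"
    using assms(1,2) unfolding pfun_def by blast
  have "poly (p * q) = poly 0"
    using assms(3) p q by auto
  then have "p * q = 0"
    using poly_eq_poly_eq_iff by blast
  then show ?thesis
    using p q assms(4) by (metis no_zero_divisors poly_0)
qed

text \<open>\<open>q\<close> is a common denominator of the coordinates of the curve. Sums and
  products of functions multiply the powers of \<open>q\<close>, so only the existence of some
  exponent is claimed.\<close>

lemma polynomial_fun_on_curve:
  assumes "polynomial_fun f" "pfun q" "\<And>i j k. pfun (\<lambda>t. q t * \<gamma> t $ i $ j $ k)"
  shows "\<exists>n. pfun (\<lambda>t. q t ^ n * f (\<gamma> t))"
  using assms(1)
proof induction
  case (const c)
  show ?case by (rule exI[of _ 0]) (simp add: pfun_intros)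
next
  case (coord i j k)
  show ?case by (rule exI[of _ 1]) (simp add: assms)
next
  case (add f g)
  then obtain m n where "pfun (\<lambda>t. q t ^ m * f (\<gamma> t))" "pfun (\<lambda>t. q t ^ n * g (\<gamma> t))"
    by blast
  then have "pfun (\<lambda>t. q t ^ n * (q t ^ m * f (\<gamma> t)) + q t ^ m * (q t ^ n * g (\<gamma> t)))"
    using pfun_add[OF pfun_mult[OF pfun_power[OF assms(2)]] pfun_mult[OF pfun_power[OF assms(2)]]] by auto
  then show ?case by (intro exI[of _ "m + n"]) (simp add: algebra_simps power_add)
next
  case (mult f g)
  then obtain m n where "pfun (\<lambda>t. q t ^ m * f (\<gamma> t))" "pfun (\<lambda>t. q t ^ n * g (\<gamma> t))"
    by blast
  then have "pfun (\<lambda>t. (q t ^ m * f (\<gamma> t)) * (q t ^ n * g (\<gamma> t)))"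
    by (rule pfun_mult)
  then show ?case by (intro exI[of _ "m + n"]) (simp add: algebra_simps power_add)
qed

text \<open>A polynomial in t that vanishes wherever the nonzero polynomial \<open>q\<close> does
  not is zero. All degenerations below come from this: parameter values at which a change of basis
  breaks down are included for free.\<close>

lemma closed_contains_curve:
  assumes "closedin zariski C" "\<And>i j k. pfun (\<lambda>t. \<gamma> t $ i $ j $ k)" "pfun q" "q u \<noteq> 0"
    and "\<And>t. q t \<noteq> 0 \<Longrightarrow> \<gamma> t \<in> C"
  shows "\<gamma> t \<in> C"
  unfolding closedin_mem_iff[OF assms(1)]
proof (intro allI impI)
  fix f assume f: "polynomial_fun f" "\<forall>\<nu>\<in>C. f \<nu> = 0"
  have "pfun (\<lambda>t. f (\<gamma> t))"
    using polynomial_fun_on_curve[OF f(1), of "\<lambda>t. 1" \<gamma>] assms(2) by (auto simp: pfun_intros)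
  moreover have "f (\<gamma> t) * q t = 0" for t
    using f(2) assms(5) by (cases "q t = 0") auto
  ultimately show "f (\<gamma> t) = 0"
    using pfun_mult_eq_zero[where f = "\<lambda>t. f (\<gamma> t)" and g = q and u = u] assms(3,4) by blast
qed

text \<open>Restricted to a rational curve, polynomial functions have no zero divisors.\<close>

lemma irreducible_in_rational_curves:
  assumes "S \<noteq> {}"
    and "\<And>s t. s \<in> S \<Longrightarrow> t \<in> S \<Longrightarrow> \<exists>\<gamma> q. pfun q \<and> (\<forall>i j k. pfun (\<lambda>u. q u * \<gamma> u $ i $ j $ k)) \<and>
      (\<exists>u. q u \<noteq> 0 \<and> \<gamma> u = s) \<and> (\<exists>u. q u \<noteq> 0 \<and> \<gamma> u = t) \<and> (\<forall>u. q u \<noteq> 0 \<longrightarrow> \<gamma> u \<in> S)"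
  shows "irreducible_in zariski S"
  unfolding irreducible_in_def
proof (intro conjI allI impI)
  fix A B assume AB: "closedin zariski A \<and> closedin zariski B \<and> S \<subseteq> A \<union> B"
  show "S \<subseteq> A \<or> S \<subseteq> B"
  proof (rule ccontr)
    assume "\<not> (S \<subseteq> A \<or> S \<subseteq> B)"
    then obtain s t where st: "s \<in> S" "s \<notin> A" "t \<in> S" "t \<notin> B" by blast
    obtain f where f: "polynomial_fun f" "\<forall>\<nu>\<in>A. f \<nu> = 0" "f s \<noteq> 0"
      using AB closedin_mem_iff st(2) by blast
    obtain g where g: "polynomial_fun g" "\<forall>\<nu>\<in>B. g \<nu> = 0" "g t \<noteq> 0"
      using AB closedin_mem_iff st(4) by blast
    obtain \<gamma> q u v where c: "pfun q" "\<And>i j k. pfun (\<lambda>u. q u * \<gamma> u $ i $ j $ k)"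
      "q u \<noteq> 0" "\<gamma> u = s" "q v \<noteq> 0" "\<gamma> v = t" "\<And>u. q u \<noteq> 0 \<Longrightarrow> \<gamma> u \<in> S"
      using assms(2)[OF st(1,3)] by blast
    obtain m n where mn: "pfun (\<lambda>t. q t ^ m * f (\<gamma> t))" "pfun (\<lambda>t. q t ^ n * g (\<gamma> t))"
      using polynomial_fun_on_curve[OF f(1) c(1,2)] polynomial_fun_on_curve[OF g(1) c(1,2)] by blast
    \<comment> \<open>At a zero of \<open>q\<close> the point of the curve may lie outside S; the
      additional factor \<open>q t\<close> makes the product vanish there too.\<close>
    have "(q t * (q t ^ m * f (\<gamma> t))) * (q t ^ n * g (\<gamma> t)) = 0" for t
      using c(7)[of t] AB f(2) g(2) by (cases "q t = 0") auto
    then have "q u * (q u ^ m * f (\<gamma> u)) = 0"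
      using pfun_mult_eq_zero[OF pfun_mult[OF c(1) mn(1)] mn(2), of v u] c(5,6) g(3) by auto
    then show False using c(3,4) f(3) by simp
  qed
qed (use assms(1) in auto)

lemma irreducible_in_closure:
  assumes "irreducible_in zariski S"
  shows "irreducible_in zariski (zariski closure_of S)"
proof -
  have S: "S \<subseteq> zariski closure_of S" by (simp add: closure_of_subset)
  show ?thesis
    unfolding irreducible_in_def
  proof (intro conjI allI impI)
    show "zariski closure_of S \<noteq> {}" using assms S unfolding irreducible_in_def by blast
    fix A B assume AB: "closedin zariski A \<and> closedin zariski B \<and> zariski closure_of S \<subseteq> A \<union> B"
    then have "S \<subseteq> A \<or> S \<subseteq> B" using assms S unfolding irreducible_in_def by blast
    then show "zariski closure_of S \<subseteq> A \<or> zariski closure_of S \<subseteq> B"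
      using AB closure_of_minimal by blast
  qed simp
qed

subsection \<open>Change of basis\<close>

lemma e_nth: "e i $ j = (if i = j then 1 else 0)"
  by (simp add: axis_def)

lemma mult_nth: "mult \<mu> x y $ k = (\<Sum>i\<in>UNIV. \<Sum>j\<in>UNIV. x $ i * y $ j * \<mu> $ i $ j $ k)"
  by (simp add: mult_def)

lemma mult_add_left: "mult \<mu> (x + x') y = mult \<mu> x y + mult \<mu> x' y"
  by (simp add: vec_eq_iff mult_nth algebra_simps sum.distrib)

lemma mult_add_right: "mult \<mu> x (y + y') = mult \<mu> x y + mult \<mu> x y'"
  by (simp add: vec_eq_iff mult_nth algebra_simps sum.distrib)

lemma mult_smult_left: "mult \<mu> (c *s x) y = c *s mult \<mu> x y"
  by (simp add: vec_eq_iff mult_nth sum_distrib_left algebra_simps)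

lemma mult_smult_right: "mult \<mu> x (c *s y) = c *s mult \<mu> x y"
  by (simp add: vec_eq_iff mult_nth sum_distrib_left algebra_simps)

lemma mult_uminus_left: "mult \<mu> (- x) y = - mult \<mu> x y"
  by (simp add: vec_eq_iff mult_nth sum_negf)

lemma mult_uminus_right: "mult \<mu> x (- y) = - mult \<mu> x y"
  by (simp add: vec_eq_iff mult_nth sum_negf)

lemma mult_diff_left: "mult \<mu> (x - x') y = mult \<mu> x y - mult \<mu> x' y"
  by (simp add: vec_eq_iff mult_nth algebra_simps sum_subtractf)

lemma mult_diff_right: "mult \<mu> x (y - y') = mult \<mu> x y - mult \<mu> x y'"
  by (simp add: vec_eq_iff mult_nth algebra_simps sum_subtractf)

lemma mult_zero_left: "mult \<mu> 0 y = 0" and mult_zero_right: "mult \<mu> x 0 = 0"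
  by (simp_all add: vec_eq_iff mult_nth)

lemmas mult_simps = mult_add_left mult_add_right mult_smult_left mult_smult_right
  mult_uminus_left mult_uminus_right mult_diff_left mult_diff_right mult_zero_left mult_zero_right

lemma mult_e: "mult \<mu> (e i) (e j) = \<mu> $ i $ j"
  using exhaust_3[of i] exhaust_3[of j] by (auto simp: vec_eq_iff mult_nth e_nth sum_3)

lemma alg_eqI: "(\<And>x y. mult \<mu> x y = mult \<nu> x y) \<Longrightarrow> \<mu> = \<nu>"
  by (metis mult_e vec_eq_iff)

lemma vec_expand: "x = x $ 1 *s e 1 + x $ 2 *s e 2 + x $ 3 *s e 3"
  by (simp add: vec_eq_iff forall_3 e_nth)

lemma matrix_inv_both:
  assumes "invertible (g :: complex^3^3)"
  shows "g ** matrix_inv g = mat 1" "matrix_inv g ** g = mat 1"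
  using assms someI_ex[of "\<lambda>A'. g ** A' = mat 1 \<and> A' ** g = mat 1"]
  by (auto simp: invertible_def matrix_inv_def)

lemma matrix_inv_mult:
  assumes "invertible (g :: complex^3^3)"
  shows "g *v (matrix_inv g *v x) = x" "matrix_inv g *v (g *v x) = x"
  using assms by (simp_all add: matrix_vector_mul_assoc matrix_inv_both)

lemma mult_bilinear_ext:
  assumes "\<And>i j. f (e i) (e j) = h (e i) (e j)"
    "\<And>x x' y. f (x + x') y = f x y + f x' y" "\<And>x y y'. f x (y + y') = f x y + f x y'"
    "\<And>c x y. f (c *s x) y = c *s f x y" "\<And>c x y. f x (c *s y) = c *s f x y"
    "\<And>x x' y. h (x + x') y = h x y + h x' y" "\<And>x y y'. h x (y + y') = h x y + h x y'"
    "\<And>c x y. h (c *s x) y = c *s h x y" "\<And>c x y. h x (c *s y) = c *s h x y"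
  shows "f x y = (h x y :: complex^3)"
  by (subst (1 2) vec_expand[of x], subst (1 2) vec_expand[of y]) (simp add: assms)

lemma mult_gl_act:
  "mult (gl_act g \<mu>) x y = g *v mult \<mu> (matrix_inv g *v x) (matrix_inv g *v y)"
  by (rule mult_bilinear_ext[where f = "mult (gl_act g \<mu>)"
        and h = "\<lambda>x y. g *v mult \<mu> (matrix_inv g *v x) (matrix_inv g *v y)"])
    (simp_all add: mult_e gl_act_def mult_simps matrix_vector_right_distrib vec.scale)

lemma mult_gl_act_apply:
  assumes "invertible g"
  shows "mult (gl_act g \<mu>) (g *v x) (g *v y) = g *v mult \<mu> x y"
  by (simp add: mult_gl_act matrix_inv_mult[OF assms])

lemma gl_act_eqI:
  assumes "invertible g" "\<And>x y. g *v mult \<mu> x y = mult \<nu> (g *v x) (g *v y)"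
  shows "\<nu> = gl_act g \<mu>"
  by (rule alg_eqI) (metis assms matrix_inv_mult(1) mult_gl_act)

lemma invertible_matrix_inv:
  assumes "invertible (g :: complex^3^3)"
  shows "invertible (matrix_inv g)"
  using matrix_inv_both[OF assms] unfolding invertible_def by blast

lemma gl_act_inverse:
  assumes "invertible g"
  shows "gl_act (matrix_inv g) (gl_act g \<mu>) = \<mu>" "gl_act g (gl_act (matrix_inv g) \<mu>) = \<mu>"
proof -
  have i: "invertible (matrix_inv g)" using assms invertible_matrix_inv by blast
  show "gl_act (matrix_inv g) (gl_act g \<mu>) = \<mu>"
    by (rule gl_act_eqI[OF i, symmetric])
      (simp add: mult_gl_act matrix_inv_mult[OF assms])
  show "gl_act g (gl_act (matrix_inv g) \<mu>) = \<mu>"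
    by (rule gl_act_eqI[OF assms, symmetric])
      (metis assms i matrix_inv_mult(1,2) mult_gl_act_apply)
qed

lemma gl_act_compose:
  assumes "invertible g" "invertible h"
  shows "gl_act g (gl_act h \<mu>) = gl_act (g ** h) \<mu>"
  by (rule gl_act_eqI) (simp_all add: assms invertible_mult mult_gl_act_apply
      flip: matrix_vector_mul_assoc)

lemma invertible_mat_1: "invertible (mat 1 :: complex^3^3)"
  unfolding invertible_def by (rule exI[of _ "mat 1"]) simp

lemma gl_act_mat_1: "gl_act (mat 1) \<mu> = \<mu>"
  by (rule gl_act_eqI[OF invertible_mat_1, symmetric]) simp

lemma orbit_refl: "\<mu> \<in> orbit \<mu>"
  unfolding orbit_def using gl_act_mat_1[of \<mu>] invertible_mat_1 by force

lemma orbit_gl_act: "\<nu> \<in> orbit \<mu> \<Longrightarrow> invertible g \<Longrightarrow> gl_act g \<nu> \<in> orbit \<mu>"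
  unfolding orbit_def using gl_act_compose invertible_mult by blast

lemma orbit_sym: "\<nu> \<in> orbit \<mu> \<Longrightarrow> \<mu> \<in> orbit \<nu>"
proof -
  assume "\<nu> \<in> orbit \<mu>"
  then obtain g where "invertible g" "\<nu> = gl_act g \<mu>" unfolding orbit_def by blast
  then have "\<mu> = gl_act (matrix_inv g) \<nu>" "invertible (matrix_inv g)"
    by (simp_all add: gl_act_inverse invertible_matrix_inv)
  then show ?thesis unfolding orbit_def by blast
qed

lemma orbit_trans: "\<nu> \<in> orbit \<mu> \<Longrightarrow> \<kappa> \<in> orbit \<nu> \<Longrightarrow> \<kappa> \<in> orbit \<mu>"
  using orbit_gl_act unfolding orbit_def[of \<nu>] by blast

lemma orbit_eq: "\<nu> \<in> orbit \<mu> \<Longrightarrow> orbit \<nu> = orbit \<mu>"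
  using orbit_trans orbit_sym by blast

lemma associator_gl_act:
  assumes "invertible g"
  shows "associator (gl_act g \<mu>) (g *v x) (g *v y) (g *v z) = g *v associator \<mu> x y z"
  by (simp add: associator_def mult_gl_act_apply[OF assms] matrix_vector_mult_diff_distrib)

lemma semi_alternative_gl_act:
  assumes "invertible g" "\<mu> \<in> semi_alternative"
  shows "gl_act g \<mu> \<in> semi_alternative"
  unfolding semi_alternative_def
proof (intro CollectI allI)
  fix x y z
  have c: "associator \<mu> a b c = associator \<mu> b c a" for a b c
    using assms(2) unfolding semi_alternative_def by blast
  show "associator (gl_act g \<mu>) x y z = associator (gl_act g \<mu>) y z x"
    using associator_gl_act[OF assms(1), of \<mu> "matrix_inv g *v x" "matrix_inv g *v y" "matrix_inv g *v z"]
      associator_gl_act[OF assms(1), of \<mu> "matrix_inv g *v y" "matrix_inv g *v z" "matrix_inv g *v x"]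
      c[of "matrix_inv g *v x" "matrix_inv g *v y" "matrix_inv g *v z"]
    unfolding matrix_inv_mult(1)[OF assms(1)] by simp
qed

lemma matrix_inv_e:
  assumes "det (g :: complex^3^3) \<noteq> 0"
  shows "matrix_inv g *v e i = (\<chi> k. det (\<chi> a b. if b = k then e i $ a else g $ a $ b) / det g)"
  using cramer[OF assms, of "matrix_inv g *v e i" "e i"] assms
  by (simp add: matrix_inv_mult invertible_det_nz)

text \<open>Cramer's rule writes each of the two inverse matrices in \<open>gl_act\<close> with
  determinants over \<open>det g\<close>; the square clears both denominators, so the orbit map is
  rational in the entries of \<open>g\<close>.\<close>

lemma gl_act_nth:
  assumes "det g \<noteq> 0"
  shows "det g ^ 2 * gl_act g \<mu> $ i $ j $ k =
    (\<Sum>c\<in>UNIV. \<Sum>a\<in>UNIV. \<Sum>b\<in>UNIV. g $ k $ c * det (\<chi> r s. if s = a then e i $ r else g $ r $ s) *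
      det (\<chi> r s. if s = b then e j $ r else g $ r $ s) * \<mu> $ a $ b $ c)"
proof -
  have "gl_act g \<mu> $ i $ j $ k = (\<Sum>c\<in>UNIV. \<Sum>a\<in>UNIV. \<Sum>b\<in>UNIV. g $ k $ c *
      (det (\<chi> r s. if s = a then e i $ r else g $ r $ s) / det g) *
      (det (\<chi> r s. if s = b then e j $ r else g $ r $ s) / det g) * \<mu> $ a $ b $ c)"
    by (simp add: gl_act_def matrix_vector_mult_def[of g] matrix_inv_e[OF assms] mult_nth
        sum_distrib_left mult.assoc)
  then show ?thesis
    using assms by (simp add: sum_distrib_left power2_eq_square field_simps)
qed

lemma pfun_det:
  assumes "\<And>i j. pfun (\<lambda>t. (g t :: complex^3^3) $ i $ j)"
  shows "pfun (\<lambda>t. det (g t))"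
  unfolding det_3 by (intro pfun_intros assms)

lemma irreducible_in_orbit: "irreducible_in zariski (orbit \<mu>)"
proof (rule irreducible_in_rational_curves)
  show "orbit \<mu> \<noteq> {}" using orbit_refl by blast
  fix s t assume "s \<in> orbit \<mu>" "t \<in> orbit \<mu>"
  then obtain g h where g: "s = gl_act g \<mu>" "det g \<noteq> 0" and h: "t = gl_act h \<mu>" "det h \<noteq> 0"
    unfolding orbit_def invertible_det_nz by blast
  \<comment> \<open>The segment from \<open>g\<close> to \<open>h\<close> among all matrices; it
    leaves GL_3 only at zeros of the polynomial \<open>det (c u)\<close>.\<close>
  define c where "c u = (\<chi> i j. (1 - u) * g $ i $ j + u * h $ i $ j)" for u
  have c01: "c 0 = g" "c 1 = h" by (simp_all add: c_def vec_eq_iff)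
  have pc: "pfun (\<lambda>u. c u $ i $ j)" for i j unfolding c_def by (simp add: pfun_intros)
  define \<gamma> where "\<gamma> u = (if det (c u) = 0 then 0 else gl_act (c u) \<mu>)" for u
  \<comment> \<open>One more power than \<open>gl_act_nth\<close> needs: at a singular
    \<open>c u\<close>, where the curve is 0 by convention, the right side must vanish as
    well.\<close>
  have eq: "det (c u) ^ 3 * \<gamma> u $ i $ j $ k = det (c u) * (\<Sum>r\<in>UNIV. \<Sum>a\<in>UNIV. \<Sum>b\<in>UNIV. c u $ k $ r *
        det (\<chi> r s. if s = a then e i $ r else c u $ r $ s) *
      det (\<chi> r s. if s = b then e j $ r else c u $ r $ s) * \<mu> $ a $ b $ r)" for u i j k
  proof (cases "det (c u) = 0")
    case False
    then show ?thesis
      by (subst gl_act_nth[OF False, symmetric]) (simp add: \<gamma>_def power3_eq_cube power2_eq_square)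
  qed (simp add: \<gamma>_def)
  have "pfun (\<lambda>u. det (c u) ^ 3 * \<gamma> u $ i $ j $ k)" for i j k
    unfolding eq
    by (intro pfun_intros pfun_det pc) (simp_all add: pfun_if pfun_const pc)
  moreover have "pfun (\<lambda>u. det (c u) ^ 3)" by (intro pfun_intros pc pfun_det)
  moreover have "det (c u) ^ 3 \<noteq> 0 \<Longrightarrow> \<gamma> u \<in> orbit \<mu>" for u
    unfolding orbit_def invertible_det_nz \<gamma>_def by auto
  moreover have "\<gamma> 0 = s" "\<gamma> 1 = t" "det (c 0) ^ 3 \<noteq> 0" "det (c 1) ^ 3 \<noteq> 0"
    using g h by (simp_all add: \<gamma>_def c01)
  ultimately show "\<exists>\<gamma> q. pfun q \<and> (\<forall>i j k. pfun (\<lambda>u. q u * \<gamma> u $ i $ j $ k)) \<and>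
      (\<exists>u. q u \<noteq> 0 \<and> \<gamma> u = s) \<and> (\<exists>u. q u \<noteq> 0 \<and> \<gamma> u = t) \<and> (\<forall>u. q u \<noteq> 0 \<longrightarrow> \<gamma> u \<in> orbit \<mu>)"
    by (intro exI[of _ \<gamma>] exI[of _ "\<lambda>u. det (c u) ^ 3"]) blast
qed

lemma polynomial_fun_gl_act:
  assumes "polynomial_fun f"
  shows "polynomial_fun (\<lambda>\<mu>. f (gl_act g \<mu>))"
  using assms
proof induction
  case (coord i j k)
  show ?case unfolding gl_act_def by (simp add: matrix_vector_mult_def)
    (intro polynomial_fun_sum polynomial_fun.mult polynomial_fun_mult_nth polynomial_fun.const)
qed (auto intro: polynomial_fun.intros)

abbreviation orbit_closure :: "alg3 \<Rightarrow> alg3 set" where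
  "orbit_closure \<mu> \<equiv> zariski closure_of orbit \<mu>"

lemma orbit_subset_closure: "orbit \<mu> \<subseteq> orbit_closure \<mu>"
  by (simp add: closure_of_subset)

lemma orbit_closure_gl_act:
  assumes "\<nu> \<in> orbit_closure \<mu>" "invertible g"
  shows "gl_act g \<nu> \<in> orbit_closure \<mu>"
  unfolding closedin_mem_iff[OF closedin_closure_of]
proof (intro allI impI)
  fix f assume f: "polynomial_fun f" "\<forall>\<nu>\<in>orbit_closure \<mu>. f \<nu> = 0"
  show "f (gl_act g \<nu>) = 0"
    by (rule closure_of_vanishing[OF polynomial_fun_gl_act[OF f(1)] _ assms(1)])
      (use f(2) orbit_gl_act assms(2) orbit_subset_closure in blast)
qed

lemma orbit_closure_gl_act_iff:
  assumes "invertible g"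
  shows "gl_act g \<nu> \<in> orbit_closure \<mu> \<longleftrightarrow> \<nu> \<in> orbit_closure \<mu>"
  using orbit_closure_gl_act assms gl_act_inverse(1) invertible_matrix_inv by metis

lemma orbit_closure_subset: "\<nu> \<in> orbit_closure \<mu> \<Longrightarrow> orbit_closure \<nu> \<subseteq> orbit_closure \<mu>"
  by (rule closure_of_minimal) (auto simp: orbit_def[of \<nu>] orbit_closure_gl_act)

definition det3 :: "complex^3 \<Rightarrow> complex^3 \<Rightarrow> complex^3 \<Rightarrow> complex" where
  "det3 x y z = x$1 * (y$2 * z$3 - y$3 * z$2) - x$2 * (y$1 * z$3 - y$3 * z$1)
     + x$3 * (y$1 * z$2 - y$2 * z$1)"

lemma det3_matrix_vector: "det3 (g *v x) (g *v y) (g *v z) = det g * det3 x y z"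
  unfolding det3_def det_3 matrix_vector_mult_def by (simp add: sum_3) algebra

lemma basis_change:
  assumes "det3 a b c \<noteq> 0"
  obtains g where "invertible g" "g *v a = e 1" "g *v b = e 2" "g *v c = e 3"
proof -
  define h :: "complex^3^3" where "h = (\<chi> i. vector [a $ i, b $ i, c $ i])"
  have "det h = det3 a b c" by (simp add: h_def det_3 det3_def) algebra
  then have h: "invertible h" using assms by (simp add: invertible_det_nz)
  have "h *v e 1 = a" "h *v e 2 = b" "h *v e 3 = c"
    by (simp_all add: h_def vec_eq_iff matrix_vector_mult_def sum_3 e_nth)
  then have "matrix_inv h *v a = e 1" "matrix_inv h *v b = e 2" "matrix_inv h *v c = e 3"
    using matrix_inv_mult(2)[OF h] by metis+
  then show ?thesis using that invertible_matrix_inv[OF h] by blast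
qed

lemma matrix_vector_e: "(h :: complex^3^3) *v e i = column i h"
  using exhaust_3[of i] by (auto simp: vec_eq_iff matrix_vector_mult_def column_def sum_3 e_nth)

text \<open>The columns of \<open>h\<close> are a basis of \<mu> in which the structure constants
  are those of \<nu>. Each matrix given below is such a basis, written by rows.\<close>

lemma orbitI:
  assumes "det h \<noteq> 0"
    and "\<forall>i j. mult \<mu> (column i h) (column j h) = h *v (\<nu> $ i $ j)"
  shows "\<nu> \<in> orbit \<mu>"
proof -
  have h: "invertible h" using assms(1) by (simp add: invertible_det_nz)
  have "h *v mult \<nu> x y = mult \<mu> (h *v x) (h *v y)" for x y
    by (rule mult_bilinear_ext[where f = "\<lambda>x y. h *v mult \<nu> x y"
          and h = "\<lambda>x y. mult \<mu> (h *v x) (h *v y)"])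
      (simp_all add: mult_e assms(2) matrix_vector_e mult_simps
        matrix_vector_right_distrib vec.scale)
  then have "\<mu> = gl_act h \<nu>" by (rule gl_act_eqI[OF h])
  then show ?thesis using h orbit_sym unfolding orbit_def by blast
qed

lemmas table_simps = vec_eq_iff forall_3 sum_3 mult_nth matrix_vector_mult_def column_def e_nth
  vector_3 det_3

section \<open>Polynomial families in a closed set\<close>

lemma closed_family1:
  assumes "closedin zariski C" "\<forall>i j k. pfun (\<lambda>t. F t $ i $ j $ k)" "pfun D" "D a0 \<noteq> 0"
    and "\<And>a. D a \<noteq> 0 \<Longrightarrow> F a \<in> C"
  shows "F a \<in> C"
  using closed_contains_curve[OF assms(1), of F D] assms by blast

text \<open>The line joining the given parameters to the good point \<open>(a0, b0)\<close> reduces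
  the claim to one variable.\<close>

lemma closed_family2:
  assumes "closedin zariski C"
    and "\<And>a b a' b'. \<forall>i j k. pfun (\<lambda>t. F (a + t * a') (b + t * b') $ i $ j $ k)"
    and "\<And>a b a' b'. pfun (\<lambda>t. D (a + t * a') (b + t * b'))"
    and "D a0 b0 \<noteq> 0" "\<And>a b. D a b \<noteq> 0 \<Longrightarrow> F a b \<in> C"
  shows "F a b \<in> C"
proof -
  have "F (a + 0 * (a0 - a)) (b + 0 * (b0 - b)) \<in> C"
    by (rule closed_contains_curve[OF assms(1), where q = "\<lambda>t. D (a + t * (a0 - a)) (b + t * (b0 - b))"
          and \<gamma> = "\<lambda>t. F (a + t * (a0 - a)) (b + t * (b0 - b))" and u = 1])
      (use assms in auto)
  then show ?thesis by simp
qed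

lemma closed_family3:
  assumes "closedin zariski C"
    and "\<And>a b c a' b' c'. \<forall>i j k. pfun (\<lambda>t. F (a + t * a') (b + t * b') (c + t * c') $ i $ j $ k)"
    and "\<And>a b c a' b' c'. pfun (\<lambda>t. D (a + t * a') (b + t * b') (c + t * c'))"
    and "D a0 b0 c0 \<noteq> 0" "\<And>a b c. D a b c \<noteq> 0 \<Longrightarrow> F a b c \<in> C"
  shows "F a b c \<in> C"
proof -
  have "F (a + 0 * (a0 - a)) (b + 0 * (b0 - b)) (c + 0 * (c0 - c)) \<in> C"
    by (rule closed_contains_curve[OF assms(1),
          where q = "\<lambda>t. D (a + t * (a0 - a)) (b + t * (b0 - b)) (c + t * (c0 - c))"
          and \<gamma> = "\<lambda>t. F (a + t * (a0 - a)) (b + t * (b0 - b)) (c + t * (c0 - c))" and u = 1])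
      (use assms in auto)
  then show ?thesis by simp
qed

subsection \<open>Opposite algebras\<close>

text \<open>Reversing products preserves the variety, exchanges S09 with S06 and S12 with S13, and
  fixes the orbits of S03 and S11; one-sided cases are therefore treated only once.\<close>

definition opp :: "alg3 \<Rightarrow> alg3" where
  "opp \<mu> = (\<chi> i j. \<mu> $ j $ i)"

lemma opp_nth [simp]: "opp \<mu> $ i $ j = \<mu> $ j $ i"
  by (simp add: opp_def)

lemma opp_opp [simp]: "opp (opp \<mu>) = \<mu>"
  by (simp add: opp_def vec_eq_iff)

lemma mult_opp: "mult (opp \<mu>) x y = mult \<mu> y x"
  unfolding mult_def by (subst sum.swap) (simp add: mult.commute)

lemma opp_gl_act: "opp (gl_act g \<mu>) = gl_act g (opp \<mu>)"
  by (rule alg_eqI) (simp add: mult_opp mult_gl_act)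

lemma opp_orbit: "\<nu> \<in> orbit \<mu> \<Longrightarrow> opp \<nu> \<in> orbit (opp \<mu>)"
  unfolding orbit_def using opp_gl_act by blast

lemma polynomial_fun_opp: "polynomial_fun f \<Longrightarrow> polynomial_fun (\<lambda>\<mu>. f (opp \<mu>))"
  by (induction rule: polynomial_fun.induct) (simp_all add: polynomial_fun.intros)

lemma opp_orbit_closure:
  assumes "\<nu> \<in> orbit_closure \<mu>"
  shows "opp \<nu> \<in> orbit_closure (opp \<mu>)"
  unfolding closedin_mem_iff[OF closedin_closure_of]
proof (intro allI impI)
  fix f assume f: "polynomial_fun f" "\<forall>\<nu>\<in>orbit_closure (opp \<mu>). f \<nu> = 0"
  show "f (opp \<nu>) = 0"
    by (rule closure_of_vanishing[OF polynomial_fun_opp[OF f(1)] _ assms])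
      (use f(2) opp_orbit orbit_subset_closure in blast)
qed

lemma opp_semi_alternative: "opp \<mu> \<in> semi_alternative \<longleftrightarrow> \<mu> \<in> semi_alternative"
proof -
  have *: "opp \<mu> \<in> semi_alternative" if "\<mu> \<in> semi_alternative" for \<mu>
  proof -
    have c: "associator \<mu> x y z = associator \<mu> y z x" for x y z
      using that unfolding semi_alternative_def by blast
    have "associator (opp \<mu>) x y z = - associator \<mu> z y x" for x y z
      by (simp add: associator_def mult_opp)
    then show ?thesis using c unfolding semi_alternative_def by simp
  qed
  show ?thesis using *[of \<mu>] *[of "opp \<mu>"] by auto
qed

lemma opp_S09: "opp S09 = S06" and opp_S12: "opp S12 = S13"
  by (simp_all add: S06_def S09_def S12_def S13_def table_simps)

lemma orbit_opp_S03: "orbit (opp S03) = orbit S03"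
  by (rule orbit_eq, rule orbitI[of "vector [vector [1,0,0], vector [0,0,1], vector [0,1,0]]"])
    (simp_all add: S03_def table_simps)

text \<open>A sign change of \<open>e 1\<close> exchanges its left eigenvalue 1 and its right
  eigenvalue -1 on \<open>e 2\<close>.\<close>

lemma orbit_opp_S11: "orbit (opp S11) = orbit S11"
  by (rule orbit_eq, rule orbitI[of "vector [vector [-1,0,0], vector [0,1,0], vector [0,0,1]]"])
    (simp_all add: S11_def table_simps)

lemma orbit_closure_opp:
  "opp \<mu> \<in> orbit_closure S06 \<longleftrightarrow> \<mu> \<in> orbit_closure S09"
  "opp \<mu> \<in> orbit_closure S13 \<longleftrightarrow> \<mu> \<in> orbit_closure S12"
  "opp \<mu> \<in> orbit_closure S09 \<longleftrightarrow> \<mu> \<in> orbit_closure S06"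
  "opp \<mu> \<in> orbit_closure S12 \<longleftrightarrow> \<mu> \<in> orbit_closure S13"
  "opp \<mu> \<in> orbit_closure S03 \<longleftrightarrow> \<mu> \<in> orbit_closure S03"
  "opp \<mu> \<in> orbit_closure S11 \<longleftrightarrow> \<mu> \<in> orbit_closure S11"
  using opp_orbit_closure[of \<mu>] opp_orbit_closure[of "opp \<mu>"]
  by (metis opp_opp opp_S09 opp_S12 orbit_opp_S03 orbit_opp_S11)+

subsection \<open>Families inside the orbit closures\<close>

text \<open>In \<open>F12\<close>, \<open>F03\<close> and \<open>F09\<close> the vector
  \<open>e 1\<close> of the representative is halved, so that it acts with eigenvalues 0 and 1, and
  the coefficients of the square of \<open>e 1\<close> outside \<open>e 1\<close> become parameters;
  their value 0 gives degenerations needed later.\<close>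

definition F12 :: "complex \<Rightarrow> alg3" where
  "F12 c = vector [vector [vector [1,c,0], vector [0,1,0], vector [0,0,1]],
                 vector [0, 0, 0], vector [0, 0, 0]]"

definition F03 :: "complex \<Rightarrow> complex \<Rightarrow> alg3" where
  "F03 c d = vector [vector [vector [1,c,d], vector [0,1,0], 0],
                 vector [0, 0, 0], vector [vector [0,0,1], 0, 0]]"

definition F09 :: "complex \<Rightarrow> alg3" where
  "F09 c = vector [vector [vector [1,c,0], vector [0,1,0], 0],
                 vector [0, 0, 0], vector [0, 0, vector [0,0,1]]]"

definition F11 :: "complex \<Rightarrow> alg3" where
  "F11 c = vector [vector [vector [0,c,1], vector [0,1,0], vector [1,0,0]],
                 vector [vector [0,-1,0], 0, vector [0,1,0]],
                 vector [vector [1,0,0], vector [0,1,0], vector [0,0,1]]]"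

lemma F12_orbit: "c \<noteq> 0 \<Longrightarrow> F12 c \<in> orbit S12"
  by (rule orbitI[of "vector [vector [1/2,0,0], vector [0,1/(4*c),0], vector [0,0,1]]"])
    (simp_all add: F12_def S12_def table_simps)

lemma F03_orbit: "c \<noteq> 0 \<Longrightarrow> d \<noteq> 0 \<Longrightarrow> F03 c d \<in> orbit S03"
  by (rule orbitI[of "vector [vector [1/2,0,0], vector [0,1/(4*c),0], vector [0,0,1/(4*d)]]"])
    (simp_all add: F03_def S03_def table_simps)

lemma F09_orbit: "c \<noteq> 0 \<Longrightarrow> F09 c \<in> orbit S09"
  by (rule orbitI[of "vector [vector [1/2,0,0], vector [0,1/(4*c),0], vector [0,0,1]]"])
    (simp_all add: F09_def S09_def table_simps)

lemma F11_orbit: "c \<noteq> 0 \<Longrightarrow> F11 c \<in> orbit S11"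
  by (rule orbitI[of "vector [vector [1,0,0], vector [0,1/c,0], vector [0,0,1]]"])
    (simp_all add: F11_def S11_def table_simps)

lemma F12_closure: "F12 c \<in> orbit_closure S12"
  by (rule closed_family1[where F = F12 and D = "\<lambda>c. c" and ?a0.0 = 1])
    (use F12_orbit orbit_subset_closure in \<open>auto simp: F12_def forall_3 intro!: pfun_intros\<close>)

lemma F09_closure: "F09 c \<in> orbit_closure S09"
  by (rule closed_family1[where F = F09 and D = "\<lambda>c. c" and ?a0.0 = 1])
    (use F09_orbit orbit_subset_closure in \<open>auto simp: F09_def forall_3 intro!: pfun_intros\<close>)

lemma F11_closure: "F11 c \<in> orbit_closure S11"
  by (rule closed_family1[where F = F11 and D = "\<lambda>c. c" and ?a0.0 = 1])
    (use F11_orbit orbit_subset_closure in \<open>auto simp: F11_def forall_3 intro!: pfun_intros\<close>)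

lemma F03_closure: "F03 c d \<in> orbit_closure S03"
  by (rule closed_family2[where F = F03 and D = "\<lambda>c d. c * d" and ?a0.0 = 1 and ?b0.0 = 1])
    (use F03_orbit orbit_subset_closure in \<open>auto simp: F03_def forall_3 intro!: pfun_intros\<close>)

text \<open>The families \<open>T09\<close>, \<open>T11\<close>, \<open>T03\<close> are the multiplication tables of an element \<open>x\<close> of
  \<open>F09 1\<close>, \<open>F11 1\<close>, \<open>F03 1 1\<close> in the basis \<open>x\<close>, \<open>x\<^sup>2\<close>, \<open>x x\<^sup>2 - x\<^sup>2 x\<close>.\<close>

definition T09 :: "complex \<Rightarrow> complex \<Rightarrow> alg3" where
  "T09 a g = vector [vector [vector [0, 1, 0], vector [a ^ 2*g - (a ^ 2), -(a*g) + 2*a, g], vector [0, 0, a]],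
    vector [vector [a ^ 2*g - (a ^ 2), -(a*g) + 2*a, g - 1], vector [-(a ^ 3*g ^ 2) + 3*a ^ 3*g - 2*a ^ 3, a ^ 2*g ^ 2 - 3*a ^ 2*g + 3*a ^ 2, -(a*g ^ 2) + 3*a*g - (a)], vector [0, 0, a ^ 2]],
    vector [0, 0, 0]]"

definition T06 :: "complex \<Rightarrow> complex \<Rightarrow> alg3" where
  "T06 a g = vector [vector [vector [0, 1, 0], vector [-(a ^ 2*g), a*g + a, g], 0],
    vector [vector [-(a ^ 2*g), a*g + a, g - 1], vector [-(a ^ 3*g ^ 2) - (a ^ 3*g), a ^ 2*g ^ 2 + a ^ 2*g + a ^ 2, a*g ^ 2 + a*g - (a)], 0],
    vector [vector [0, 0, a], vector [0, 0, a ^ 2], 0]]"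

definition T11 :: "complex \<Rightarrow> complex \<Rightarrow> alg3" where
  "T11 t g = vector [vector [vector [0, 1, 0], vector [-(g ^ 2*t ^ 2) + g*t ^ 2, 2*g*t - (t), g], vector [0, 0, g*t]],
    vector [vector [-(g ^ 2*t ^ 2) + g*t ^ 2, 2*g*t - (t), g - 1], vector [-2*g ^ 3*t ^ 3 + 3*g ^ 2*t ^ 3 - (g*t ^ 3), 3*g ^ 2*t ^ 2 - 3*g*t ^ 2 + t ^ 2, 3*g ^ 2*t - 3*g*t + t], vector [0, 0, g ^ 2*t ^ 2]],
    vector [vector [0, 0, g*t - (t)], vector [0, 0, g ^ 2*t ^ 2 - 2*g*t ^ 2 + t ^ 2], 0]]"

definition T03 :: "complex \<Rightarrow> alg3" where
  "T03 t = vector [vector [vector [0, 1, 0], vector [-2*t ^ 2, 3*t, 1/2], vector [-4*t ^ 3, 2*t ^ 2, t]],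
    vector [vector [-2*t ^ 2, 3*t, -1/2], vector [-8*t ^ 3, 8*t ^ 2, 0], vector [-8*t ^ 4, 4*t ^ 3, 2*t ^ 2]],
    vector [vector [4*t ^ 3, -2*t ^ 2, t], vector [8*t ^ 4, -4*t ^ 3, 2*t ^ 2], 0]]"

text \<open>Associative tables in a basis x, x^2, u, where a and b are the nonzero roots of the
  cubic relation of x and u is an eigenvector with u^2 = 0: left and right eigenvalues are a, 0 here
  and a, b in \<open>K11\<close>.\<close>

definition K09 :: "complex \<Rightarrow> complex \<Rightarrow> alg3" where
  "K09 a b = vector [vector [vector [0, 1, 0], vector [- a * b, a + b, 0], vector [0, 0, a]],
    vector [vector [- a * b, a + b, 0], vector [- a * b * (a + b), (a + b) ^ 2 - a * b, 0], vector [0, 0, a ^ 2]],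
    vector [0, 0, 0]]"

definition K11 :: "complex \<Rightarrow> complex \<Rightarrow> alg3" where
  "K11 a b = vector [vector [vector [0, 1, 0], vector [- a * b, a + b, 0], vector [0, 0, a]],
    vector [vector [- a * b, a + b, 0], vector [- a * b * (a + b), (a + b) ^ 2 - a * b, 0], vector [0, 0, a ^ 2]],
    vector [vector [0, 0, b], vector [0, 0, b ^ 2], 0]]"

text \<open>The ideal generated by X in C[X]/(X^4 - p X^3 - q X^2 - r X), in the basis X, X^2,
  X^3.\<close>

definition Tc :: "complex \<Rightarrow> complex \<Rightarrow> complex \<Rightarrow> alg3" where
  "Tc p q r = vector [vector [vector [0, 1, 0], vector [0, 0, 1], vector [r, q, p]],
    vector [vector [0, 0, 1], vector [r, q, p], vector [p * r, p * q + r, p ^ 2 + q]],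
    vector [vector [r, q, p], vector [p * r, p * q + r, p ^ 2 + q],
      vector [(p ^ 2 + q) * r, (p ^ 2 + q) * q + p * r, p ^ 3 + 2 * p * q + r]]]"

text \<open>A bilinear form with rows (b, p), (q, r) on the span of \<open>e 1\<close> and
  \<open>e 2\<close>, with values in the annihilator \<open>e 3\<close>.\<close>

definition Nil :: "complex \<Rightarrow> complex \<Rightarrow> complex \<Rightarrow> complex \<Rightarrow> alg3" where
  "Nil b p q r = vector [vector [vector [0, 0, b], vector [0, 0, p], 0],
    vector [vector [0, 0, q], vector [0, 0, r], 0], vector [0, 0, 0]]"

text \<open>The table of \<open>F11 1\<close> in the basis s e1, (s / k) e2 + s e3, s^2 e3. It stays
  polynomial at s = 0, where all products become multiples of e3; nilpotent algebras are reached in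
  this way.\<close>

definition G11 :: "complex \<Rightarrow> complex \<Rightarrow> alg3" where
  "G11 s k = vector [vector [vector [0, s * k, 1 - k], vector [s, s, -1], vector [s ^ 2, 0, 0]],
    vector [vector [s, -s, 1], vector [0, 2 * s, -1], vector [0, s ^ 2, 0]],
    vector [vector [s ^ 2, 0, 0], vector [0, s ^ 2, 0], vector [0, 0, s ^ 2]]]"

lemma pfun_family_T09: "\<forall>i j k. pfun (\<lambda>t. T09 (a + t * a') (g + t * g') $ i $ j $ k)"
  by (simp add: T09_def forall_3; intro conjI pfun_intros)

lemma pfun_family_T06: "\<forall>i j k. pfun (\<lambda>t. T06 (a + t * a') (g + t * g') $ i $ j $ k)"
  by (simp add: T06_def forall_3; intro conjI pfun_intros)

lemma pfun_family_T11: "\<forall>i j k. pfun (\<lambda>t. T11 (a + t * a') (g + t * g') $ i $ j $ k)"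
  by (simp add: T11_def forall_3; intro conjI pfun_intros)

lemma T09_orbit:
  assumes "a * g * (1 - g) \<noteq> 0"
  shows "T09 a g \<in> orbit S09"
proof (rule orbit_trans[OF F09_orbit[of 1]])
  \<comment> \<open>The basis is x = a e1 + (1 - g) a e3 with its x^2 and n.\<close>
  show "T09 a g \<in> orbit (F09 1)"
    by (rule orbitI[of "vector [vector [a, a^2, 0], vector [0, a^2, a^3], vector [(1-g)*a, ((1-g)*a)^2, 0]]"])
      (use assms in \<open>auto simp: T09_def F09_def table_simps algebra_simps power_numeral_reduce\<close>)
qed simp

lemma T11_orbit:
  assumes "t * g * (1 - g) \<noteq> 0"
  shows "T11 t g \<in> orbit S11"
proof (rule orbit_trans[OF F11_orbit[of 1]])
  \<comment> \<open>For x = p e1 + (2 g - 1) p e3 the left and right eigenvalues of x on e2 are g t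
    and (g - 1) t.\<close>
  define p where "p = t / 2"
  have t: "t = 2 * p" by (simp add: p_def)
  show "T11 t g \<in> orbit (F11 1)"
    by (rule orbitI[of "vector [vector [p, 2*p*((2*g-1)*p), 0], vector [0, p^2, 2*p^3],
          vector [(2*g-1)*p, p^2 + ((2*g-1)*p)^2, 0]]"])
      (use assms in \<open>auto simp: t T11_def F11_def table_simps algebra_simps power_numeral_reduce\<close>)
qed simp

lemma T03_orbit:
  assumes "t \<noteq> 0"
  shows "T03 t \<in> orbit S03"
proof (rule orbit_trans[OF F03_orbit[of 1 1]])
  show "T03 t \<in> orbit (F03 1 1)"
    by (rule orbitI[of "vector [vector [2*t, (2*t)^2, 0], vector [0, (2*t)^2, (2*t)^3], vector [0, (2*t)^2, -((2*t)^3)]]"])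
      (use assms in \<open>auto simp: T03_def F03_def table_simps algebra_simps power_numeral_reduce\<close>)
qed simp_all

text \<open>In the opposite algebra n changes sign, and the coefficient g of n in x x^2 becomes 1 -
  g.\<close>

lemma T06_orbit_opp: "T06 a g \<in> orbit (opp (T09 a (1 - g)))"
  by (rule orbitI[of "vector [vector [1,0,0], vector [0,1,0], vector [0,0,-1]]"])
    (auto simp: T06_def T09_def table_simps algebra_simps power_numeral_reduce)

lemma T06_orbit:
  assumes "a * g * (1 - g) \<noteq> 0"
  shows "T06 a g \<in> orbit S06"
  using orbit_trans[OF opp_orbit[OF T09_orbit[of a "1 - g"]] T06_orbit_opp] assms
  by (simp add: opp_S09)

lemma T09_closure: "T09 a g \<in> orbit_closure S09"
  by (rule closed_family2[where F = T09 and D = "\<lambda>a g. a * g * (1 - g)" and ?a0.0 = 1 and ?b0.0 = 2])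
    (use T09_orbit orbit_subset_closure in \<open>auto simp: pfun_family_T09 intro!: pfun_intros\<close>)

lemma T06_closure: "T06 a g \<in> orbit_closure S06"
  by (rule closed_family2[where F = T06 and D = "\<lambda>a g. a * g * (1 - g)" and ?a0.0 = 1 and ?b0.0 = 2])
    (use T06_orbit orbit_subset_closure in \<open>auto simp: pfun_family_T06 intro!: pfun_intros\<close>)

lemma T11_closure: "T11 a g \<in> orbit_closure S11"
  by (rule closed_family2[where F = T11 and D = "\<lambda>a g. a * g * (1 - g)" and ?a0.0 = 1 and ?b0.0 = 2])
    (use T11_orbit orbit_subset_closure in \<open>auto simp: pfun_family_T11 intro!: pfun_intros\<close>)

lemma K09_closure: "K09 a b \<in> orbit_closure S09"
proof (rule closed_family2[where F = K09 and D = "\<lambda>a b. a * b * (a - b)" and ?a0.0 = 1 and ?b0.0 = 2])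
  fix a b :: complex assume ab: "a * b * (a - b) \<noteq> 0"
  \<comment> \<open>Here x = a e1 + b e3 and u = e2; x, x^2, u are independent for distinct nonzero
    a and b.\<close>
  have "K09 a b \<in> orbit (F09 0)"
    by (rule orbitI[of "vector [vector [a, a^2, 0], vector [0, 0, 1], vector [b, b^2, 0]]"])
      (use ab in \<open>auto simp: K09_def F09_def table_simps algebra_simps power_numeral_reduce\<close>)
  then show "K09 a b \<in> orbit_closure S09"
    using orbit_closure_subset[OF F09_closure[of 0]] orbit_subset_closure by blast
qed (auto simp: K09_def forall_3 intro!: pfun_intros)

lemma K11_closure: "K11 a b \<in> orbit_closure S11"
proof (rule closed_family2[where F = K11 and D = "\<lambda>a b. a * b * (a - b)" and ?a0.0 = 1 and ?b0.0 = 2])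
  fix a b :: complex assume ab: "a * b * (a - b) \<noteq> 0"
  \<comment> \<open>In \<open>F11 0\<close> the element x = c e1 + d e3 acts on u = e2 from the left
    by d + c = a and from the right by d - c = b.\<close>
  define c d where "c = (a - b) / 2" and "d = (a + b) / 2"
  have e: "a = c + d" "b = d - c" by (simp_all add: c_def d_def field_simps)
  have "K11 a b \<in> orbit (F11 0)"
    by (rule orbitI[of "vector [vector [c, 2*c*d, 0], vector [0, 0, 1], vector [d, c^2 + d^2, 0]]"])
      (use ab in \<open>auto simp: e K11_def F11_def table_simps algebra_simps power_numeral_reduce\<close>)
  then show "K11 a b \<in> orbit_closure S11"
    using orbit_closure_subset[OF F11_closure[of 0]] orbit_subset_closure by blast
qed (auto simp: K11_def forall_3 intro!: pfun_intros)

text \<open>The powers x, x^2, x^3 of x = (a, b, c) in C^3 form a basis by Vandermonde, and x^4 is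
  expressed through the elementary symmetric functions of a, b, c.\<close>

lemma Tc_orbit:
  assumes "a * b * c * (a - b) * (b - c) * (a - c) \<noteq> 0"
  shows "Tc (a + b + c) (- (a * b + b * c + a * c)) (a * b * c) \<in> orbit A07"
  by (rule orbitI[of "vector [vector [a, a^2, a^3], vector [b, b^2, b^3], vector [c, c^2, c^3]]"];
      use assms in \<open>simp add: Tc_def A07_def table_simps\<close>; algebra)

lemma pfun_family_Tc:
  assumes "pfun p" "pfun q" "pfun r"
  shows "\<forall>i j k. pfun (\<lambda>t. Tc (p t) (q t) (r t) $ i $ j $ k)"
  unfolding Tc_def forall_3 vector_3 zero_index by (intro conjI pfun_intros assms)

lemma Tc_closure: "Tc (a + b + c) (- (a * b + b * c + a * c)) (a * b * c) \<in> orbit_closure A07"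
proof (rule closed_family3[where F = "\<lambda>a b c. Tc (a + b + c) (- (a * b + b * c + a * c)) (a * b * c)"
        and D = "\<lambda>a b c. a * b * c * (a - b) * (b - c) * (a - c)" and ?a0.0 = 1 and ?b0.0 = 2 and ?c0.0 = 3])
  fix a b c :: complex assume "a * b * c * (a - b) * (b - c) * (a - c) \<noteq> 0"
  from Tc_orbit[OF this] show "Tc (a + b + c) (- (a * b + b * c + a * c)) (a * b * c) \<in> orbit_closure A07"
    using orbit_subset_closure by blast
qed (auto intro!: pfun_intros pfun_family_Tc[rule_format])

lemma G11_closure: "G11 s k \<in> orbit_closure S11"
proof (rule closed_family2[where F = G11 and D = "\<lambda>s k. s * k" and ?a0.0 = 1 and ?b0.0 = 1])
  fix s k :: complex assume sk: "s * k \<noteq> 0"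
  have "G11 s k \<in> orbit (F11 1)"
    by (rule orbitI[of "vector [vector [s, 0, 0], vector [0, s / k, 0], vector [0, s, s^2]]"])
      (use sk in \<open>auto simp: G11_def F11_def table_simps field_simps power_numeral_reduce\<close>)
  then show "G11 s k \<in> orbit_closure S11"
    using orbit_trans[OF F11_orbit[of 1]] orbit_subset_closure by force
qed (auto simp: G11_def forall_3 intro!: pfun_intros)

lemma Nil_1_closure: "Nil 1 p q r \<in> orbit_closure S11"
proof (rule closed_family3[where F = "Nil 1" and D = "\<lambda>p q r. p - q" and ?a0.0 = 1 and ?b0.0 = 0 and ?c0.0 = 0])
  fix p q r :: complex assume pq: "p - q \<noteq> 0"
  \<comment> \<open>\<open>m\<close> and \<open>d\<close> are the symmetric and skew parts of the
    off-diagonal entries, and \<open>k\<close> is solved from r. The form of \<open>G11 0 k\<close>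
    has nonzero skew part, so d = 0 is reached only as a limit.\<close>
  define d where "d = (p - q) / 2"
  define m where "m = (p + q) / 2"
  define k where "k = 1 + (r - m^2) / d^2"
  have d: "d \<noteq> 0" and e: "p = m + d" "q = m - d" using pq by (simp_all add: d_def m_def field_simps)
  have r: "r = m^2 + d^2 * (k - 1)" using d by (simp add: k_def)
  have "Nil 1 p q r \<in> orbit (G11 0 k)"
    by (rule orbitI[of "vector [vector [0, -d, 0], vector [1, m, 0], vector [0, 0, -1]]"])
      (use d in \<open>auto simp: e r G11_def Nil_def table_simps algebra_simps power_numeral_reduce\<close>)
  then show "Nil 1 p q r \<in> orbit_closure S11"
    using orbit_closure_subset[OF G11_closure] orbit_subset_closure by blast
qed (auto simp: Nil_def forall_3 intro!: pfun_intros)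

lemma Nil_closure: "Nil b p q r \<in> orbit_closure S11"
proof (rule closed_family1[where F = "\<lambda>b. Nil b p q r" and D = "\<lambda>b. b" and ?a0.0 = 1])
  fix b :: complex assume b: "b \<noteq> 0"
  have "Nil b p q r \<in> orbit (Nil 1 (p / b) (q / b) (r / b))"
    by (rule orbitI[of "vector [vector [1, 0, 0], vector [0, 1, 0], vector [0, 0, 1 / b]]"])
      (use b in \<open>auto simp: Nil_def table_simps field_simps\<close>)
  then show "Nil b p q r \<in> orbit_closure S11"
    using orbit_closure_subset[OF Nil_1_closure] orbit_subset_closure by blast
qed (auto simp: Nil_def forall_3 intro!: pfun_intros)

subsection \<open>Normal forms of tables\<close>

text \<open>Coordinate c of the cyclic identity on basis vectors. Each instance used in the table
  computations is one polynomial equation between structure constants.\<close>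

lemma semi_alternative_nth:
  assumes "\<mu> \<in> semi_alternative"
  shows "(\<Sum>a\<in>UNIV. \<mu>$i$j$a * \<mu>$a$k$c) - (\<Sum>a\<in>UNIV. \<mu>$j$k$a * \<mu>$i$a$c)
    = (\<Sum>a\<in>UNIV. \<mu>$j$k$a * \<mu>$a$i$c) - (\<Sum>a\<in>UNIV. \<mu>$k$i$a * \<mu>$j$a$c)"
proof -
  have m: "mult \<mu> x (e k) $ c = (\<Sum>a\<in>UNIV. x $ a * \<mu>$a$k$c)"
    "mult \<mu> (e k) x $ c = (\<Sum>a\<in>UNIV. x $ a * \<mu>$k$a$c)" for x k
    using exhaust_3[of k] by (auto simp: mult_nth sum_3 e_nth)
  have "associator \<mu> x y z = associator \<mu> y z x" for x y z
    using assms unfolding semi_alternative_def by blast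
  then have "associator \<mu> (e i) (e j) (e k) $ c = associator \<mu> (e j) (e k) (e i) $ c"
    by (rule arg_cong)
  then show ?thesis by (simp add: associator_def mult_e m)
qed

lemmas sa_nth = semi_alternative_nth[unfolded sum_3]

lemma table_eqI:
  "(\<mu> = \<nu>) \<longleftrightarrow> (\<forall>i j k. \<mu> $ i $ j $ k = (\<nu> :: alg3) $ i $ j $ k)"
  by (auto simp: vec_eq_iff)

text \<open>In the basis \<open>x\<close>, \<open>x\<^sup>2\<close>, \<open>x x\<^sup>2 - x\<^sup>2 x\<close> the semi-alternative identities express the whole table
  by the left and right multiplications with \<open>x\<close>.\<close>

lemma generic_tables:
  assumes V: "\<mu> \<in> semi_alternative" and x2: "\<mu>$1$1 = e 2" and n: "\<mu>$1$2 - \<mu>$2$1 = e 3"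
  shows "(\<exists>a g. \<mu> = T09 a g) \<or> (\<exists>a g. \<mu> = T06 a g) \<or> (\<exists>t g. \<mu> = T11 t g) \<or> (\<exists>t. t \<noteq> 0 \<and> \<mu> = T03 t)"
proof -
  \<comment> \<open>In the basis x, x^2, n: x x^2 = A x + B x^2 + g n, and x^2 x is n less. The l's
    and m's are the coordinates of x n and n x.\<close>
  define A B g where "A = \<mu>$1$2$1" and "B = \<mu>$1$2$2" and "g = \<mu>$1$2$3"
  define l1 l2 l3 where "l1 = \<mu>$1$3$1" and "l2 = \<mu>$1$3$2" and "l3 = \<mu>$1$3$3"
  define m1 m2 m3 where "m1 = \<mu>$3$1$1" and "m2 = \<mu>$3$1$2" and "m3 = \<mu>$3$1$3"
  have K0: "\<mu>$1$1$1 = 0" "\<mu>$1$1$2 = 1" "\<mu>$1$1$3 = 0"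
    "\<mu>$1$2$1 = A" "\<mu>$1$2$2 = B" "\<mu>$1$2$3 = g"
    "\<mu>$2$1$1 = A" "\<mu>$2$1$2 = B" "\<mu>$2$1$3 = g - 1"
    "\<mu>$1$3$1 = l1" "\<mu>$1$3$2 = l2" "\<mu>$1$3$3 = l3"
    "\<mu>$3$1$1 = m1" "\<mu>$3$1$2 = m2" "\<mu>$3$1$3 = m3"
    using x2 n by (simp_all add: algebra_simps A_def B_def g_def l1_def l2_def l3_def m1_def m2_def m3_def
        vec_eq_iff forall_3 e_nth)
  \<comment> \<open>The identities for (x, x, x^2), (x, x, n) and (n, x, x) can be solved, without
    division, for x^2 x^2, x^2 n and n x^2.\<close>
  have K22_1: "\<mu>$2$2$1 = A*B + g*m1 + l1"
    using sa_nth[OF V, of 1 1 2 1]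
    unfolding K0 by algebra
  have K22_2: "\<mu>$2$2$2 = B ^ 2 + g*m2 + l2 + A"
    using sa_nth[OF V, of 1 1 2 2]
    unfolding K0 by algebra
  have K22_3: "\<mu>$2$2$3 = g*m3 + B*g + l3 - (B)"
    using sa_nth[OF V, of 1 1 2 3]
    unfolding K0 by algebra
  note K22_ = K22_1 K22_2 K22_3
  have K23_1: "\<mu>$2$3$1 = l1*l3 + l3*m1 - (l1*m3) + 2*A*l2 - (A*m2)"
    using sa_nth[OF V, of 1 1 3 1]
    unfolding K0 by algebra
  have K23_2: "\<mu>$2$3$2 = l2*l3 + l3*m2 - (l2*m3) + 2*B*l2 - (B*m2) + 2*l1 - (m1)"
    using sa_nth[OF V, of 1 1 3 2]
    unfolding K0 by algebra
  have K23_3: "\<mu>$2$3$3 = l3 ^ 2 + 2*g*l2 - (g*m2) - (l2)"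
    using sa_nth[OF V, of 1 1 3 3]
    unfolding K0 by algebra
  note K23_ = K23_1 K23_2 K23_3
  have K32_1: "\<mu>$3$2$1 = -(l3*m1) + l1*m3 + m1*m3 - (A*l2) + 2*A*m2"
    using sa_nth[OF V, of 3 1 1 1]
    unfolding K0 K22_ K23_ by algebra
  have K32_2: "\<mu>$3$2$2 = -(l3*m2) + l2*m3 + m2*m3 - (B*l2) + 2*B*m2 - (l1) + 2*m1"
    using sa_nth[OF V, of 3 1 1 2]
    unfolding K0 K22_ K23_ by algebra
  have K32_3: "\<mu>$3$2$3 = m3 ^ 2 - (g*l2) + 2*g*m2 + l2 - (m2)"
    using sa_nth[OF V, of 3 1 1 3]
    unfolding K0 K22_ K23_ by algebra
  note K32_ = K32_1 K32_2 K32_3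
  note K1 = K0 K22_ K23_ K32_
  \<comment> \<open>The product n n has factor g in the identity for (x, x^2, n) and g - 1 in that
    for (x^2, x, n); the difference avoids dividing by either, since each may vanish.\<close>
  have a1: "g * \<mu>$3$3$1 = l1*l3 ^ 2 + l3 ^ 2*m1 - (l1*l3*m3) - (l3*m1*m3) + l1*m3 ^ 2 + 2*A*l2*l3 + 2*A*l3*m2 - 4*A*l2*m3 + A*m2*m3 - (B*l1*l3) - (B*l3*m1) + B*l1*m3 + 2*A*B*l2 - 2*A*B*m2 + 2*g*l1*l2 + 2*g*l2*m1 - (g*l1*m2) - 2*g*m1*m2 - (l1*l2) - (l2*m1) - (l1*m2) + 3*A*l1 - 3*A*m1"
    using sa_nth[OF V, of 1 2 3 1] unfolding K1 by algebra
  have b1: "(g - 1) * \<mu>$3$3$1 = l1*l3 ^ 2 + l3*m1*m3 - (l1*m3 ^ 2) + A*l2*l3 + 2*A*l3*m2 - (A*l2*m3) - (A*m2*m3) - (B*l1*l3) - (B*l3*m1) + B*l1*m3 + A*B*l2 - (A*B*m2) + g*l1*l2 + 2*g*l2*m1 - 2*g*l1*m2 + l1*l2 + l1*m2 + 2*A*l1 - 2*A*m1"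
    using sa_nth[OF V, of 2 1 3 1] unfolding K1 by algebra
  have "\<mu>$3$3$1 = g * \<mu>$3$3$1 - (g - 1) * \<mu>$3$3$1" by algebra
  also have "\<dots> = l3 ^ 2*m1 - (l1*l3*m3) - 2*l3*m1*m3 + 2*l1*m3 ^ 2 + A*l2*l3 - 3*A*l2*m3 + 2*A*m2*m3 + A*B*l2 - (A*B*m2) + g*l1*l2 + g*l1*m2 - 2*g*m1*m2 - 2*l1*l2 - (l2*m1) - 2*l1*m2 + A*l1 - (A*m1)" unfolding a1 b1 by algebra
  finally have K33_1: "\<mu>$3$3$1 = l3 ^ 2*m1 - (l1*l3*m3) - 2*l3*m1*m3 + 2*l1*m3 ^ 2 + A*l2*l3 - 3*A*l2*m3 + 2*A*m2*m3 + A*B*l2 - (A*B*m2) + g*l1*l2 + g*l1*m2 - 2*g*m1*m2 - 2*l1*l2 - (l2*m1) - 2*l1*m2 + A*l1 - (A*m1)" .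
  have a2: "g * \<mu>$3$3$2 = l2*l3 ^ 2 + l3 ^ 2*m2 - (l2*l3*m3) - (l3*m2*m3) + l2*m3 ^ 2 + B*l2*l3 + B*l3*m2 - 3*B*l2*m3 + B*m2*m3 + 2*B ^ 2*l2 - 2*B ^ 2*m2 + 2*g*l2 ^ 2 + g*l2*m2 - 2*g*m2 ^ 2 - (l2 ^ 2) + 2*l1*l3 + 2*l3*m1 - 2*l2*m2 - 4*l1*m3 + m1*m3 + 3*A*l2 - 3*A*m2 + 2*B*l1 - 2*B*m1"
    using sa_nth[OF V, of 1 2 3 2] unfolding K1 by algebra
  have b2: "(g - 1) * \<mu>$3$3$2 = l2*l3 ^ 2 + l3*m2*m3 - (l2*m3 ^ 2) + B*l3*m2 - (B*m2*m3) + B ^ 2*l2 - (B ^ 2*m2) + g*l2 ^ 2 + l2 ^ 2 + l1*l3 + 2*l3*m1 + l2*m2 - (l1*m3) - (m1*m3) + 2*A*l2 - 2*A*m2 + B*l1 - (B*m1)"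
    using sa_nth[OF V, of 2 1 3 2] unfolding K1 by algebra
  have "\<mu>$3$3$2 = g * \<mu>$3$3$2 - (g - 1) * \<mu>$3$3$2" by algebra
  also have "\<dots> = l3 ^ 2*m2 - (l2*l3*m3) - 2*l3*m2*m3 + 2*l2*m3 ^ 2 + B*l2*l3 - 3*B*l2*m3 + 2*B*m2*m3 + B ^ 2*l2 - (B ^ 2*m2) + g*l2 ^ 2 + g*l2*m2 - 2*g*m2 ^ 2 - 2*l2 ^ 2 + l1*l3 - 3*l2*m2 - 3*l1*m3 + 2*m1*m3 + A*l2 - (A*m2) + B*l1 - (B*m1)" unfolding a2 b2 by algebra
  finally have K33_2: "\<mu>$3$3$2 = l3 ^ 2*m2 - (l2*l3*m3) - 2*l3*m2*m3 + 2*l2*m3 ^ 2 + B*l2*l3 - 3*B*l2*m3 + 2*B*m2*m3 + B ^ 2*l2 - (B ^ 2*m2) + g*l2 ^ 2 + g*l2*m2 - 2*g*m2 ^ 2 - 2*l2 ^ 2 + l1*l3 - 3*l2*m2 - 3*l1*m3 + 2*m1*m3 + A*l2 - (A*m2) + B*l1 - (B*m1)" .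
  have a3: "g * \<mu>$3$3$3 = l3 ^ 3 - (B*l3 ^ 2) + 4*g*l2*l3 + g*l3*m2 - 2*g*l2*m3 - (g*m2*m3) + 2*B*g*l2 - 2*B*g*m2 - 2*l2*l3 - 2*l3*m2 + l2*m3 - (A*l3) - (B*l2) + 2*B*m2 + 4*g*l1 - 3*g*m1 - 2*l1 + 2*m1"
    using sa_nth[OF V, of 1 2 3 3] unfolding K1 by algebra
  have b3: "(g - 1) * \<mu>$3$3$3 = l3 ^ 3 - (B*l3 ^ 2) + 2*g*l2*l3 + g*l2*m3 - (g*m2*m3) + B*g*l2 - (B*g*m2) + l2*l3 - (A*l3) - (B*l2) + 3*g*l1 - 2*g*m1 - (l1)"
    using sa_nth[OF V, of 2 1 3 3] unfolding K1 by algebra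
  have "\<mu>$3$3$3 = g * \<mu>$3$3$3 - (g - 1) * \<mu>$3$3$3" by algebra
  also have "\<dots> = 2*g*l2*l3 + g*l3*m2 - 3*g*l2*m3 + B*g*l2 - (B*g*m2) - 3*l2*l3 - 2*l3*m2 + l2*m3 + 2*B*m2 + g*l1 - (g*m1) - (l1) + 2*m1" unfolding a3 b3 by algebra
  finally have K33_3: "\<mu>$3$3$3 = 2*g*l2*l3 + g*l3*m2 - 3*g*l2*m3 + B*g*l2 - (B*g*m2) - 3*l2*l3 - 2*l3*m2 + l2*m3 + 2*B*m2 + g*l1 - (g*m1) - (l1) + 2*m1" .
  note K33_ = K33_1 K33_2 K33_3
  note K = K1 K33_
  \<comment> \<open>What remains are equations between A, B, g, the l's and the m's; the digits of a
    label are the triple and the coordinate.\<close>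
  have E1211: "-(g*l1) + g*m1 + 2*l1 + m1 = 0"
    using sa_nth[OF V, of 1 2 1 1] unfolding K by algebra
  have E1212: "-(g*l2) + g*m2 + 2*l2 + m2 = 0"
    using sa_nth[OF V, of 1 2 1 2] unfolding K by algebra
  have E1213: "-(g*l3) + g*m3 + 2*l3 + m3 - (B) = 0"
    using sa_nth[OF V, of 1 2 1 3] unfolding K by algebra
  have E1222: "g*l2*l3 - (g*l2*m3) - 2*l2*l3 - 2*l3*m2 + l2*m3 - (B*l2) + 2*B*m2 + g*l1 - (g*m1) - 4*l1 + m1 = 0"
    using sa_nth[OF V, of 1 2 2 2] unfolding K by algebra
  have E1223: "g*l3 ^ 2 - (g*l3*m3) - (B*g*l3) + B*g*m3 + g ^ 2*l2 - (g ^ 2*m2) - 2*l3 ^ 2 - (l3*m3) + 3*B*l3 + B*m3 - (B ^ 2) - 4*g*l2 + g*m2 + 2*l2 = 0"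
    using sa_nth[OF V, of 1 2 2 3] unfolding K by algebra
  have E2212: "g*l3*m2 - (g*l2*m3) + B*g*l2 - (B*g*m2) + l2*l3 + l3*m2 + m2*m3 + B*l2 + g*l1 - (g*m1) + 2*l1 + m1 = 0"
    using sa_nth[OF V, of 2 2 1 2] unfolding K by algebra
  have E2213: "g ^ 2*l2 - (g ^ 2*m2) + l3 ^ 2 + l3*m3 + m3 ^ 2 - (B*l3) - (B*m3) + g*l2 + g*m2 - (l2) - (m2) - (A) = 0"
    using sa_nth[OF V, of 2 2 1 3] unfolding K by algebra
  have E1221: "g*l1*l3 - (g*l1*m3) + A*g*l2 - (A*g*m2) - (B*g*l1) + B*g*m1 - 2*l1*l3 - 2*l3*m1 + l1*m3 - 4*A*l2 + A*m2 + 3*B*l1 + B*m1 = 0"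
    using sa_nth[OF V, of 1 2 2 1] unfolding K by algebra
  have E2122: "-(g*l2*l3) - (g*l3*m2) + 2*g*l2*m3 - (B*g*l2) + B*g*m2 + l2*l3 + l3*m2 - (l2*m3) - (m2*m3) - 2*B*m2 - 2*g*l1 + 2*g*m1 + 2*l1 - 2*m1 = 0"
    using sa_nth[OF V, of 2 1 2 2] unfolding K by algebra
  have E1323: "2*g ^ 2*l2*l3 + g ^ 2*l3*m2 - 3*g ^ 2*l2*m3 + B*g ^ 2*l2 - (B*g ^ 2*m2) - (m3 ^ 3) + B*m3 ^ 2 - 5*g*l2*l3 - (g*l3*m2) + 4*g*l2*m3 - 4*g*m2*m3 + B*g*l2 + B*g*m2 + g ^ 2*l1 - (g ^ 2*m1) + 4*l2*l3 + l3*m2 - (l2*m3) + 2*m2*m3 + A*m3 - (B*l2) - (B*m2) + g*l1 - (g*m1) = 0"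
    using sa_nth[OF V, of 1 3 2 3] unfolding K by algebra
  have l2: "l2 = - m2" using E1212 E1213 E1223 by algebra
  have l1: "l1 = - m1" using E1211 E1212 E1213 E1222 E1223 by algebra
  note M = table_eqI T09_def T06_def T11_def T03_def forall_3 vector_3 zero_index K l1 l2
  show ?thesis
  proof (cases "m2 = 0")
    \<comment> \<open>A nonzero m2 forces g = 1/2 and leaves m3 as the only parameter: the
      exceptional curve.\<close>
    case False
    have "(2 * g - 1) * m2 = 0" using E1212 l2 by algebra
    then have g: "g = 1 / 2" using False by (simp add: field_simps)
    have B: "2 * B = 3 * (l3 + m3)" using E1213 unfolding g by algebra
    have 1: "- l3 * m2 - m2 * m3 + 6 * B * m2 + 8 * m1 = 0" using E1222 unfolding g l1 l2 by algebra
    have 2: "l3 * m2 + 3 * m2 * m3 - 4 * B * m2 - 4 * m1 = 0" using E2212 unfolding g l1 l2 by algebra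
    have 3: "- m2 * m3 - B * m2 - 2 * m1 = 0" using E2122 unfolding g l1 l2 by algebra
    have "m2 * (l3 - m3) = 0" using 1 2 3 B by algebra
    then have l3: "l3 = m3" using False by simp
    have B: "B = 3 * m3" using B l3 by algebra
    have m1: "m1 = - 2 * m3 * m2" using 3 B by algebra
    have "m2 * (A + 2 * m3 ^ 2) = 0" using E1221 unfolding g l1 l2 l3 B m1 by algebra
    then have A: "A = - 2 * m3 ^ 2" using False by algebra
    have m2: "m2 = - 2 * m3 ^ 2" using E2213 unfolding g l1 l2 l3 B A by algebra
    have "\<mu> = T03 m3"
      unfolding M g l3 B m1 A m2 by (intro conjI; simp add: algebra_simps power_numeral_reduce)
    moreover have "m3 \<noteq> 0" using False m2 by auto
    ultimately show ?thesis by blast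
  next
    case m2: True
    have "4 * m1 = 0" using E1211 E1222 unfolding l1 l2 m2 by algebra
    then have m1: "m1 = 0" by simp
    \<comment> \<open>Now n is an eigenvector of left and right multiplication by x with eigenvalues
      l3 and m3; whether these vanish separates the three families.\<close>
    have e1: "(2 - g) * l3 + (1 + g) * m3 = B" using E1213 by algebra
    have e2: "l3 ^ 2 + l3 * m3 + m3 ^ 2 - B * (l3 + m3) = A" using E2213 unfolding l1 l2 m1 m2 by algebra
    have e3: "m3 * (m3 ^ 2 - B * m3 - A) = 0" using E1323 e1 e2 unfolding l1 l2 m1 m2 by algebra
    show ?thesis
    proof (cases "m3 = 0")
      case m3: True
      have B: "B = (2 - g) * l3" using e1 m3 by simp
      have A: "A = (g - 1) * l3 ^ 2" unfolding e2[symmetric] m3 B by (simp add: algebra_simps power2_eq_square)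
      have "\<mu> = T09 l3 g"
        unfolding M m1 m2 m3 A B by (intro conjI; simp add: algebra_simps power_numeral_reduce)
      then show ?thesis by blast
    next
      case False
      then have A: "A = m3 ^ 2 - B * m3" using e3 by simp
      have "l3 * (l3 + m3 - B) = (l3 ^ 2 + l3 * m3 + m3 ^ 2 - B * (l3 + m3)) - (m3 ^ 2 - B * m3)"
        by algebra
      also have "\<dots> = 0" by (simp only: e2 A diff_self)
      finally have e4: "l3 * (l3 + m3 - B) = 0" .
      show ?thesis
      proof (cases "l3 = 0")
        case l3: True
        have B: "B = (1 + g) * m3" using e1 l3 by simp
        have "\<mu> = T06 m3 g"
          unfolding M m1 m2 l3 A B by (intro conjI; simp add: algebra_simps power_numeral_reduce)
        then show ?thesis by blast
      next
        case l3: False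
        then have "l3 + m3 - B = 0" using e4 by simp
        then have B: "B = l3 + m3" by (simp add: algebra_simps)
        have e5: "(2 - g) * l3 + (1 + g) * m3 = l3 + m3" using e1 B by simp
        define t where "t = l3 - m3"
        have l: "l3 = g * t" using e5 unfolding t_def by algebra
        have m: "m3 = (g - 1) * t" using e5 unfolding t_def by algebra
        have "\<mu> = T11 t g"
          unfolding M m1 m2 A B l m by (intro conjI; simp add: algebra_simps power_numeral_reduce)
        then show ?thesis by blast
      qed
    qed
  qed
qed

text \<open>From x x^2 = x^2 x the identities for (x, x, x^2) and (x^2, x, x) give x^3 x = x x^3 =
  x^2 x^2; the remaining products are those of polynomials in x.\<close>

lemma cyclic_table:
  assumes V: "\<mu> \<in> semi_alternative" and x2: "\<mu>$1$1 = e 2" and x3: "\<mu>$1$2 = e 3" "\<mu>$2$1 = e 3"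
  shows "\<mu> = Tc (\<mu>$1$3$3) (\<mu>$1$3$2) (\<mu>$1$3$1)"
proof -
  define p q r where "p = \<mu>$1$3$3" and "q = \<mu>$1$3$2" and "r = \<mu>$1$3$1"
  have K0: "\<mu>$1$1$1 = 0" "\<mu>$1$1$2 = 1" "\<mu>$1$1$3 = 0"
    "\<mu>$1$2$1 = 0" "\<mu>$1$2$2 = 0" "\<mu>$1$2$3 = 1"
    "\<mu>$2$1$1 = 0" "\<mu>$2$1$2 = 0" "\<mu>$2$1$3 = 1"
    "\<mu>$1$3$1 = r" "\<mu>$1$3$2 = q" "\<mu>$1$3$3 = p"
    using x2 x3 by (simp_all add: p_def q_def r_def e_nth)
  have K31_1: "\<mu>$3$1$1 = r"
    using sa_nth[OF V, of 1 1 2 1]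
      sa_nth[OF V, of 2 1 1 1]
    unfolding K0 by algebra
  have K31_2: "\<mu>$3$1$2 = q"
    using sa_nth[OF V, of 1 1 2 2]
      sa_nth[OF V, of 2 1 1 2]
    unfolding K0 by algebra
  have K31_3: "\<mu>$3$1$3 = p"
    using sa_nth[OF V, of 1 1 2 3]
      sa_nth[OF V, of 2 1 1 3]
    unfolding K0 by algebra
  note K31_ = K31_1 K31_2 K31_3
  have K22_1: "\<mu>$2$2$1 = r"
    using sa_nth[OF V, of 1 1 2 1]
      sa_nth[OF V, of 2 1 1 1]
    unfolding K0 by algebra
  have K22_2: "\<mu>$2$2$2 = q"
    using sa_nth[OF V, of 1 1 2 2]
      sa_nth[OF V, of 2 1 1 2]
    unfolding K0 by algebra
  have K22_3: "\<mu>$2$2$3 = p"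
    using sa_nth[OF V, of 1 1 2 3]
      sa_nth[OF V, of 2 1 1 3]
    unfolding K0 by algebra
  note K22_ = K22_1 K22_2 K22_3
  note K1 = K0 K31_ K22_
  have K23_1: "\<mu>$2$3$1 = p*r"
    using sa_nth[OF V, of 1 1 3 1]
    unfolding K1 by algebra
  have K23_2: "\<mu>$2$3$2 = p*q + r"
    using sa_nth[OF V, of 1 1 3 2]
    unfolding K1 by algebra
  have K23_3: "\<mu>$2$3$3 = p ^ 2 + q"
    using sa_nth[OF V, of 1 1 3 3]
    unfolding K1 by algebra
  note K23_ = K23_1 K23_2 K23_3
  have K32_1: "\<mu>$3$2$1 = p*r"
    using sa_nth[OF V, of 3 1 1 1]
    unfolding K1 K23_ by algebra
  have K32_2: "\<mu>$3$2$2 = p*q + r"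
    using sa_nth[OF V, of 3 1 1 2]
    unfolding K1 K23_ by algebra
  have K32_3: "\<mu>$3$2$3 = p ^ 2 + q"
    using sa_nth[OF V, of 3 1 1 3]
    unfolding K1 K23_ by algebra
  note K32_ = K32_1 K32_2 K32_3
  note K2 = K1 K23_ K32_
  have K33_1: "\<mu>$3$3$1 = p ^ 2*r + q*r"
    using sa_nth[OF V, of 1 2 3 1]
    unfolding K2 by algebra
  have K33_2: "\<mu>$3$3$2 = p ^ 2*q + q ^ 2 + p*r"
    using sa_nth[OF V, of 1 2 3 2]
    unfolding K2 by algebra
  have K33_3: "\<mu>$3$3$3 = p ^ 3 + 2*p*q + r"
    using sa_nth[OF V, of 1 2 3 3]
    unfolding K2 by algebra
  note K33_ = K33_1 K33_2 K33_3
  show ?thesis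
    unfolding table_eqI Tc_def forall_3 vector_3 zero_index K2 K33_
    by (intro conjI; simp add: algebra_simps power_numeral_reduce)
qed

text \<open>Here n = a x + b x^2, while x, x^2, x x^2 are independent. Elimination of the other
  unknowns leaves a^2 = b^2 = 0.\<close>

lemma degenerate_dependent:
  assumes V: "\<mu> \<in> semi_alternative" and x2: "\<mu>$1$1 = e 2" and x3: "\<mu>$1$2 = e 3"
    and n: "\<mu>$2$1 = e 3 - a *s e 1 - b *s e 2"
  shows "a = 0 \<and> b = 0"
proof -
  define l1 l2 l3 where "l1 = \<mu>$1$3$1" and "l2 = \<mu>$1$3$2" and "l3 = \<mu>$1$3$3"
  define m1 m2 m3 where "m1 = \<mu>$3$1$1" and "m2 = \<mu>$3$1$2" and "m3 = \<mu>$3$1$3"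
  have K0: "\<mu>$1$1$1 = 0" "\<mu>$1$1$2 = 1" "\<mu>$1$1$3 = 0"
    "\<mu>$1$2$1 = 0" "\<mu>$1$2$2 = 0" "\<mu>$1$2$3 = 1"
    "\<mu>$2$1$1 = -a" "\<mu>$2$1$2 = -b" "\<mu>$2$1$3 = 1"
    "\<mu>$1$3$1 = l1" "\<mu>$1$3$2 = l2" "\<mu>$1$3$3 = l3"
    "\<mu>$3$1$1 = m1" "\<mu>$3$1$2 = m2" "\<mu>$3$1$3 = m3"
    using x2 x3 n by (simp_all add: l1_def l2_def l3_def m1_def m2_def m3_def e_nth)
  have K22_1: "\<mu>$2$2$1 = m1"
    using sa_nth[OF V, of 1 1 2 1]
    unfolding K0 by algebra
  have K22_2: "\<mu>$2$2$2 = m2 + a"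
    using sa_nth[OF V, of 1 1 2 2]
    unfolding K0 by algebra
  have K22_3: "\<mu>$2$2$3 = m3 + b"
    using sa_nth[OF V, of 1 1 2 3]
    unfolding K0 by algebra
  note K22_ = K22_1 K22_2 K22_3
  have K23_1: "\<mu>$2$3$1 = l1*l3 + l3*m1 - (l1*m3) - (a*l2)"
    using sa_nth[OF V, of 1 1 3 1]
    unfolding K0 by algebra
  have K23_2: "\<mu>$2$3$2 = l2*l3 + l3*m2 - (l2*m3) - (b*l2) + 2*l1 - (m1)"
    using sa_nth[OF V, of 1 1 3 2]
    unfolding K0 by algebra
  have K23_3: "\<mu>$2$3$3 = l3 ^ 2 + 2*l2 - (m2)"
    using sa_nth[OF V, of 1 1 3 3]
    unfolding K0 by algebra
  note K23_ = K23_1 K23_2 K23_3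
  have K32_1: "\<mu>$3$2$1 = -(l3*m1) + l1*m3 + m1*m3 + a*l2 - (a*m2)"
    using sa_nth[OF V, of 3 1 1 1]
    unfolding K0 K22_ K23_ by algebra
  have K32_2: "\<mu>$3$2$2 = -(l3*m2) + l2*m3 + m2*m3 + b*l2 - (b*m2) - (l1) + 2*m1"
    using sa_nth[OF V, of 3 1 1 2]
    unfolding K0 K22_ K23_ by algebra
  have K32_3: "\<mu>$3$2$3 = m3 ^ 2 - (l2) + 2*m2"
    using sa_nth[OF V, of 3 1 1 3]
    unfolding K0 K22_ K23_ by algebra
  note K32_ = K32_1 K32_2 K32_3
  note K = K0 K22_ K23_ K32_
  have E1211: "-(a*b) - (l1) + m1 = 0"
    using sa_nth[OF V, of 1 2 1 1] unfolding K by algebra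
  have E1212: "-(b ^ 2) - (l2) + m2 + 3*a = 0"
    using sa_nth[OF V, of 1 2 1 2] unfolding K by algebra
  have E1213: "-(l3) + m3 + 3*b = 0"
    using sa_nth[OF V, of 1 2 1 3] unfolding K by algebra
  have E2213: "3*b*m3 + 2*b ^ 2 + l2 - (m2) + 3*a = 0"
    using sa_nth[OF V, of 2 2 1 3] unfolding K by algebra
  have E2123: "-(l3 ^ 2) + l3*m3 + b*l3 - (b*m3) - (b ^ 2) - 2*l2 + 2*m2 = 0"
    using sa_nth[OF V, of 2 1 2 3] unfolding K by algebra
  have E1221: "l1*l3 - (l1*m3) + 2*a ^ 2 - (b*l1) - 2*b*m1 = 0"
    using sa_nth[OF V, of 1 2 2 1] unfolding K by algebra
  have E1222: "l2*l3 - (l2*m3) - (b*l2) - 2*b*m2 + a*b + l1 - (m1) = 0"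
    using sa_nth[OF V, of 1 2 2 2] unfolding K by algebra
  have "b ^ 2 = 0" using E1213 E1212 E2213 E2123 by algebra
  moreover have "a ^ 2 = 0" using E1211 E1213 E1212 E1221 E2213 E1222 by algebra
  ultimately show ?thesis by simp
qed

text \<open>Modulo the subalgebra spanned by \<open>e 1\<close> and \<open>e 2\<close>, left and
  right multiplication by \<open>e 1\<close> are scalars with sum 1; an identity makes them 0 and 1,
  and their order decides between \<open>F03\<close> and \<open>F12\<close>.\<close>

lemma F03_F12_tables:
  assumes V: "\<mu> \<in> semi_alternative" and xx: "\<mu>$1$1 = e 1 + e 2" and xv: "\<mu>$1$2 = e 2" "\<mu>$2$1 = 0"
    and s: "\<mu>$1$3$3 + \<mu>$3$1$3 = 1"
  shows "F03 1 0 \<in> orbit \<mu> \<or> F12 1 \<in> orbit \<mu>"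
proof -
  define p1 p2 p3 where "p1 = \<mu>$1$3$1" and "p2 = \<mu>$1$3$2" and "p3 = \<mu>$1$3$3"
  define q1 q2 where "q1 = \<mu>$3$1$1" and "q2 = \<mu>$3$1$2"
  define r1 r2 r3 where "r1 = \<mu>$3$3$1" and "r2 = \<mu>$3$3$2" and "r3 = \<mu>$3$3$3"
  have K0: "\<mu>$1$1$1 = 1" "\<mu>$1$1$2 = 1" "\<mu>$1$1$3 = 0"
    "\<mu>$1$2$1 = 0" "\<mu>$1$2$2 = 1" "\<mu>$1$2$3 = 0"
    "\<mu>$2$1$1 = 0" "\<mu>$2$1$2 = 0" "\<mu>$2$1$3 = 0"
    "\<mu>$1$3$1 = p1" "\<mu>$1$3$2 = p2" "\<mu>$1$3$3 = p3"
    "\<mu>$3$1$1 = q1" "\<mu>$3$1$2 = q2" "\<mu>$3$1$3 = 1 - p3"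
    "\<mu>$3$3$1 = r1" "\<mu>$3$3$2 = r2" "\<mu>$3$3$3 = r3"
    using xx xv s by (simp_all add: p1_def p2_def p3_def q1_def q2_def r1_def r2_def r3_def e_nth
        algebra_simps)
  have K22_1: "\<mu>$2$2$1 = 0"
    using sa_nth[OF V, of 1 1 2 1]
      sa_nth[OF V, of 1 2 1 1]
    unfolding K0 by algebra
  have K22_2: "\<mu>$2$2$2 = 0"
    using sa_nth[OF V, of 1 1 2 2]
      sa_nth[OF V, of 1 2 1 2]
    unfolding K0 by algebra
  have K22_3: "\<mu>$2$2$3 = 0"
    using sa_nth[OF V, of 1 1 2 3]
      sa_nth[OF V, of 1 2 1 3]
    unfolding K0 by algebra
  note K22_ = K22_1 K22_2 K22_3
  have K23_1: "\<mu>$2$3$1 = 2*p1*p3 + p3*q1 - (q1)"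
    using sa_nth[OF V, of 1 1 3 1]
    unfolding K0 by algebra
  have K23_2: "\<mu>$2$3$2 = 2*p2*p3 + p3*q2 + 2*p1 - (p2) - (q1) - (q2)"
    using sa_nth[OF V, of 1 1 3 2]
    unfolding K0 by algebra
  have K23_3: "\<mu>$2$3$3 = p3 ^ 2 - (p3)"
    using sa_nth[OF V, of 1 1 3 3]
    unfolding K0 by algebra
  note K23_ = K23_1 K23_2 K23_3
  have K32_1: "\<mu>$3$2$1 = -(p1*p3) - 2*p3*q1 + 2*q1"
    using sa_nth[OF V, of 3 1 1 1]
    unfolding K0 K22_ K23_ by algebra
  have K32_2: "\<mu>$3$2$2 = -(p2*p3) - 2*p3*q2 - (p1) + p2 + 2*q1 + q2"
    using sa_nth[OF V, of 3 1 1 2]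
    unfolding K0 K22_ K23_ by algebra
  have K32_3: "\<mu>$3$2$3 = p3 ^ 2 - (p3)"
    using sa_nth[OF V, of 3 1 1 3]
    unfolding K0 K22_ K23_ by algebra
  note K32_ = K32_1 K32_2 K32_3
  note K = K0 K22_ K23_ K32_
  have E3123: "-(p3 ^ 2) + p3 = 0"
    using sa_nth[OF V, of 3 1 2 3] unfolding K by algebra
  have "p3 = 0 \<or> p3 = 1" using E3123 by algebra
  then show ?thesis
  proof
    assume p3: "p3 = 0"
    have E1321: "-2*p1*p3 ^ 2 - 3*p3 ^ 2*q1 + 3*p1*p3 + 7*p3*q1 - 4*q1 = 0"
      using sa_nth[OF V, of 1 3 2 1] unfolding K by algebra
    have E1232: "-3*p2*p3 ^ 2 - 2*p3 ^ 2*q2 - 6*p1*p3 + 4*p2*p3 - (p3*q1) + 3*p3*q2 + 2*p1 - (p2) + q1 - (q2) = 0"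
      using sa_nth[OF V, of 1 2 3 2] unfolding K by algebra
    have E3131: "-(p1*p2*p3) + p2*p3*q1 + 2*p1*p3*q2 + p3*q1*q2 + p1*r3 - (p1 ^ 2) - (p2*q1) - (q1*q2) - 3*p3*r1 + 2*r1 = 0"
      using sa_nth[OF V, of 3 1 3 1] unfolding K by algebra
    have E3132: "-(p2 ^ 2*p3) + 3*p2*p3*q2 + p3*q2 ^ 2 + p2*r3 - 2*p1*p2 + p1*q2 - (p2*q2) - (q1*q2) - (q2 ^ 2) - 3*p3*r2 + r1 + 2*r2 = 0"
      using sa_nth[OF V, of 3 1 3 2] unfolding K by algebra
    have E3133: "-2*p2*p3 ^ 2 + p3 ^ 2*q2 - 2*p3*r3 + 2*p2*p3 + p3*q1 - (p3*q2) + r3 - (p1) = 0"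
      using sa_nth[OF V, of 3 1 3 3] unfolding K by algebra
    have q1: "q1 = 0" using E1321 p3 by algebra
    have q2: "q2 = 2 * p1 - p2" using E1232 q1 p3 by algebra
    have r3: "r3 = p1" using E3133 p3 by algebra
    have r1: "r1 = 0" using E3131 q1 r3 p3 by algebra
    have r2: "r2 = p1 ^ 2" using E3132 q1 r3 r1 q2 p3 by algebra
    \<comment> \<open>The third vector is \<open>e 3\<close> corrected within the span of
      \<open>e 1\<close> and \<open>e 2\<close> so that \<open>e 1\<close> annihilates it from the
      left.\<close>
    have "F03 1 0 \<in> orbit \<mu>"
      by (rule orbitI[of "vector [vector [1, 0, -p1], vector [0, 1, p1 - p2], vector [0, 0, 1]]"])
        (simp_all add: F03_def table_simps K p3 q1 q2 r1 r2 r3 algebra_simps power_numeral_reduce)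
    then show ?thesis ..
  next
    assume p3: "p3 = 1"
    have E1231: "-3*p1*p3 ^ 2 - 2*p3 ^ 2*q1 + p1*p3 + 2*p3*q1 = 0"
      using sa_nth[OF V, of 1 2 3 1] unfolding K by algebra
    have E2312: "p2*p3 ^ 2 + 3*p1*p3 - 2*p2*p3 + 2*p3*q1 - 2*p3*q2 - 2*p1 + p2 - (q1) + q2 = 0"
      using sa_nth[OF V, of 2 3 1 2] unfolding K by algebra
    have E2132: "p3 ^ 2*q2 - 2*p1*p3 - 2*p2*p3 - 3*p3*q1 - 2*p3*q2 - 2*p1 + p2 + 4*q1 + q2 = 0"
      using sa_nth[OF V, of 2 1 3 2] unfolding K by algebra
    have E3131: "-(p1*p2*p3) + p2*p3*q1 + 2*p1*p3*q2 + p3*q1*q2 + p1*r3 - (p1 ^ 2) - (p2*q1) - (q1*q2) - 3*p3*r1 + 2*r1 = 0"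
      using sa_nth[OF V, of 3 1 3 1] unfolding K by algebra
    have E3132: "-(p2 ^ 2*p3) + 3*p2*p3*q2 + p3*q2 ^ 2 + p2*r3 - 2*p1*p2 + p1*q2 - (p2*q2) - (q1*q2) - (q2 ^ 2) - 3*p3*r2 + r1 + 2*r2 = 0"
      using sa_nth[OF V, of 3 1 3 2] unfolding K by algebra
    have E3313: "p2*p3 ^ 2 - 2*p3 ^ 2*q2 + 2*p3*r3 - (p1*p3) - (p2*p3) + 2*p3*q2 - (r3) + p1 - (q1) = 0"
      using sa_nth[OF V, of 3 3 1 3] unfolding K by algebra
    have p1: "p1 = 0" using E1231 p3 by algebra
    have q2: "q2 = q1" using E2312 p1 p3 by algebra
    have p2: "p2 = q1" using E2132 p1 p3 by algebra
    have r3: "r3 = q1" using E3313 p3 by algebra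
    have r1: "r1 = 0" using E3131 p1 p2 q2 p3 by algebra
    have r2: "r2 = q1 ^ 2" using E3132 p1 p2 q2 r3 r1 p3 by algebra
    have "F12 1 \<in> orbit \<mu>"
      by (rule orbitI[of "vector [vector [1, 0, -q1], vector [0, 1, 0], vector [0, 0, 1]]"])
        (simp_all add: F12_def table_simps K p1 p2 p3 q2 r1 r2 r3 algebra_simps power_numeral_reduce)
    then show ?thesis ..
  qed
qed

subsection \<open>Algebras with a nonzero cube associator\<close>

abbreviation sq :: "alg3 \<Rightarrow> complex^3 \<Rightarrow> complex^3" where
  "sq \<mu> x \<equiv> mult \<mu> x x"

text \<open>\<open>nn \<mu> x\<close> is \<open>- (x, x, x)\<close>; it measures how far \<open>x\<close> is from being power-associative.\<close>

definition nn :: "alg3 \<Rightarrow> complex^3 \<Rightarrow> complex^3" where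
  "nn \<mu> x = mult \<mu> x (sq \<mu> x) - mult \<mu> (sq \<mu> x) x"

lemma nn_gl_act: "invertible g \<Longrightarrow> nn (gl_act g \<mu>) (g *v x) = g *v nn \<mu> x"
  by (simp add: nn_def mult_gl_act_apply matrix_vector_mult_diff_distrib)

lemma nn_opp: "nn (opp \<mu>) x = - nn \<mu> x"
  by (simp add: nn_def mult_opp)

lemma gl_act_nth_products:
  assumes "invertible g" "g *v u = e i" "g *v v = e j"
  shows "gl_act g \<mu> $ i $ j = g *v mult \<mu> u v"
  using mult_gl_act_apply[OF assms(1), of \<mu> u v] assms(2,3) by (simp add: mult_e)

lemma det3_eq_0_all:
  assumes "\<And>w. det3 a b w = 0"
  shows "a = 0 \<or> (\<exists>k. b = k *s a)"
proof (rule disjCI)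
  assume "\<not> (\<exists>k. b = k *s a)"
  have c: "a$1 * b$2 = a$2 * b$1" "a$1 * b$3 = a$3 * b$1" "a$2 * b$3 = a$3 * b$2"
    using assms[of "e 3"] assms[of "e 2"] assms[of "e 1"] by (simp_all add: det3_def e_nth algebra_simps)
  have "\<exists>k. b = k *s a" if "a $ i \<noteq> 0" for i
    by (rule exI[of _ "b $ i / a $ i"])
      (use c that exhaust_3[of i] in \<open>auto simp: vec_eq_iff forall_3 field_simps\<close>)
  then show "a = 0"
    using \<open>\<not> (\<exists>k. b = k *s a)\<close> by (metis vec_eq_iff zero_index)
qed

lemma det3_eq_0_span:
  assumes "det3 a b w \<noteq> 0" "det3 a b c = 0"
  obtains k l where "c = k *s a + l *s b"
proof -
  obtain g where g: "invertible g" "g *v a = e 1" "g *v b = e 2" "g *v w = e 3"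
    using basis_change[OF assms(1)] by blast
  have "det3 (g *v a) (g *v b) (g *v c) = 0"
    unfolding det3_matrix_vector assms(2) by simp
  then have "(g *v c) $ 3 = 0" unfolding g by (simp add: det3_def e_nth)
  then have "g *v c = g *v ((g *v c) $ 1 *s a + (g *v c) $ 2 *s b)"
    by (simp add: matrix_vector_right_distrib vec.scale g vec_eq_iff forall_3 e_nth)
  then have "c = (g *v c) $ 1 *s a + (g *v c) $ 2 *s b"
    using matrix_inv_mult(2)[OF g(1)] by metis
  then show ?thesis by (rule that)
qed

lemma det3_eq_0_all':
  assumes "x \<noteq> 0" "\<And>k. y \<noteq> k *s x"
  obtains w where "det3 x y w \<noteq> 0"
  using det3_eq_0_all[of x y] assms by blast

text \<open>The identities inside the span of x and x^2 imply a c (a - c) = 0. The first two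
  alternatives are opposite to each other; the third says n = 0.\<close>

lemma two_dim_relations:
  assumes V: "\<mu> \<in> semi_alternative" and x2: "\<mu>$1$1 = e 2" and p: "\<mu>$1$2 = a *s e 1 + b *s e 2"
    and q: "\<mu>$2$1 = c *s e 1 + d *s e 2"
  shows "(c = 0 \<and> b = 2 * d \<and> a = - (d^2)) \<or> (a = 0 \<and> d = 2 * b \<and> c = - (b^2)) \<or> (a = c \<and> b = d)"
proof -
  have K0: "\<mu>$1$1$1 = 0" "\<mu>$1$1$2 = 1" "\<mu>$1$1$3 = 0"
    "\<mu>$1$2$1 = a" "\<mu>$1$2$2 = b" "\<mu>$1$2$3 = 0"
    "\<mu>$2$1$1 = c" "\<mu>$2$1$2 = d" "\<mu>$2$1$3 = 0"
    using x2 p q by (simp_all add: e_nth)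
  have K1: "\<mu>$2$2$1 = a * b + b * c - a * d"
    using sa_nth[OF V, of 1 1 2 1] unfolding K0 by algebra
  have K2: "\<mu>$2$2$2 = b^2 + 2 * a - c"
    using sa_nth[OF V, of 1 1 2 2] unfolding K0 by algebra
  have K3: "\<mu>$2$2$3 = 0"
    using sa_nth[OF V, of 1 1 2 3] unfolding K0 by algebra
  note K = K0 K1 K2 K3
  have R1: "a*b + 2*b*c - 2*a*d - c*d = 0"
    using sa_nth[OF V, of 1 2 1 1] unfolding K by algebra
  have R2: "(b - d) * (b + d) + 3*a - 3*c = 0"
    using sa_nth[OF V, of 1 2 1 2] unfolding K by algebra
  have R3: "- (b^3) + b^2*d - 2*a*b + 3*b*c - c*d = 0"
    using sa_nth[OF V, of 2 1 2 2] unfolding K by algebra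
  have "a * c * (a - c) = 0" using R1 R2 R3 by algebra
  then consider "a = c" | "a \<noteq> c" "c = 0" | "a \<noteq> c" "a = 0" by auto
  then show ?thesis
  proof cases
    case 1
    have "b = d"
    proof (rule ccontr)
      assume "b \<noteq> d"
      then have d: "d = - b" using R2 1 by (simp add: eq_neg_iff_add_eq_0 add.commute)
      have "c * b = 0" using R1 unfolding 1 d by algebra
      moreover have "b * b * b = c * b" using R3 unfolding 1 d by algebra
      ultimately have "b = 0" by auto
      then show False using d \<open>b \<noteq> d\<close> by simp
    qed
    then show ?thesis using 1 by simp
  next
    case 2
    have "a * (b - 2 * d) = 0" using R1 2 by (simp add: algebra_simps)
    then have b: "b = 2 * d" using 2 by simp
    have "3 * (a + d^2) = 0" using R2 unfolding b 2 by (simp add: algebra_simps power2_eq_square)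
    then have "a + d^2 = 0" unfolding mult_eq_0_iff by simp
    then have "a = - (d^2)" by (simp add: eq_neg_iff_add_eq_0)
    then show ?thesis using b 2 by simp
  next
    case 3
    have "c * (2 * b - d) = 0" using R1 3 by (simp add: algebra_simps)
    then have d: "d = 2 * b" using 3 by simp
    have "3 * (c + b^2) = 0" using R2 unfolding d 3 by (auto simp: algebra_simps power2_eq_square)
    then have "c + b^2 = 0" unfolding mult_eq_0_iff by simp
    then have "c = - (b^2)" by (simp add: eq_neg_iff_add_eq_0)
    then show ?thesis using d 3 by simp
  qed
qed

text \<open>The derivative of the determinant at t = 0 sees only the linear terms. It turns a
  dependence that holds for all elements into a linear condition at one of them.\<close>

lemma det3_derivative_zero:
  assumes "\<And>t. det3 (a0 + t *s a1) (b0 + t *s b1 + t^2 *s b2) (c0 + t *s c1 + t^2 *s c2 + t^3 *s c3) = 0"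
  shows "det3 a1 b0 c0 + det3 a0 b1 c0 + det3 a0 b0 c1 = 0"
proof -
  have 1: "((\<lambda>t. u + t * v + t^2 * w + t^3 * r) has_field_derivative v) (at 0)" for u v w r :: complex
    by (rule derivative_eq_intros refl | simp)+
  have 2: "((\<lambda>t. f t * (g t * h t - k t * l t)) has_field_derivative
      f' * (g 0 * h 0 - k 0 * l 0) + f 0 * (g' * h 0 + g 0 * h' - k' * l 0 - k 0 * l')) (at 0)"
    if "(f has_field_derivative f') (at 0)" "(g has_field_derivative g') (at 0)"
      "(h has_field_derivative h') (at 0)" "(k has_field_derivative k') (at 0)"
      "(l has_field_derivative l') (at 0)" for f g h k l :: "complex \<Rightarrow> complex" and f' g' h' k' l'
    by (rule DERIV_cong[OF DERIV_mult[OF that(1) DERIV_diff[OF DERIV_mult[OF that(2,3)] DERIV_mult[OF that(4,5)]]]])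
      (simp add: algebra_simps)
  have 3: "((\<lambda>t. det3 (a0 + t *s a1 + t^2 *s 0 + t^3 *s 0) (b0 + t *s b1 + t^2 *s b2 + t^3 *s 0)
      (c0 + t *s c1 + t^2 *s c2 + t^3 *s c3))
    has_field_derivative (det3 a1 b0 c0 + det3 a0 b1 c0 + det3 a0 b0 c1)) (at 0)"
    unfolding det3_def vector_add_component vector_smult_component
    by (rule DERIV_cong[OF DERIV_add[OF DERIV_diff[OF 2[OF 1 1 1 1 1] 2[OF 1 1 1 1 1]] 2[OF 1 1 1 1 1]]])
      (simp add: algebra_simps)
  have "((\<lambda>t. det3 (a0 + t *s a1) (b0 + t *s b1 + t^2 *s b2) (c0 + t *s c1 + t^2 *s c2 + t^3 *s c3))
    has_field_derivative (det3 a1 b0 c0 + det3 a0 b1 c0 + det3 a0 b0 c1)) (at 0)"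
    using 3 by simp
  then have "((\<lambda>t. 0) has_field_derivative (det3 a1 b0 c0 + det3 a0 b1 c0 + det3 a0 b0 c1)) (at 0)"
    unfolding assms .
  then show ?thesis using DERIV_unique DERIV_const by blast
qed

section \<open>Algebras in which x, x^2 and n are always dependent\<close>

definition line_degenerate :: "alg3 \<Rightarrow> bool" where
  "line_degenerate \<mu> \<longleftrightarrow> (\<forall>z. det3 z (sq \<mu> z) (nn \<mu> z) = 0)"

lemma line_degenerate_gl_act:
  assumes "invertible g" "line_degenerate \<mu>"
  shows "line_degenerate (gl_act g \<mu>)"
  unfolding line_degenerate_def
proof
  fix z
  have "det3 (g *v x) (sq (gl_act g \<mu>) (g *v x)) (nn (gl_act g \<mu>) (g *v x)) = 0" for x
    using assms(2) unfolding nn_gl_act[OF assms(1)] mult_gl_act_apply[OF assms(1)] det3_matrix_vector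
      line_degenerate_def by simp
  from this[of "matrix_inv g *v z"]
  show "det3 z (sq (gl_act g \<mu>) z) (nn (gl_act g \<mu>) z) = 0"
    by (simp add: matrix_inv_mult[OF assms(1)])
qed

lemma line_degenerate_opp: "line_degenerate \<mu> \<Longrightarrow> line_degenerate (opp \<mu>)"
  unfolding line_degenerate_def nn_opp mult_opp by (simp add: det3_def algebra_simps)

text \<open>The first-order part of the dependence at \<open>e 1\<close> in direction
  \<open>e 3\<close>. The linear term of n has no \<open>e 3\<close> component, because modulo
  \<open>e 1\<close> and \<open>e 2\<close> the products of \<open>e 2\<close> and
  \<open>e 3\<close> are determined by those of \<open>e 1\<close> and \<open>e 3\<close>.\<close>

lemma line_degenerate_trace:
  assumes V: "\<mu> \<in> semi_alternative" and xx: "\<mu>$1$1 = e 1 + e 2" and xv: "\<mu>$1$2 = e 2" "\<mu>$2$1 = 0"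
    and D: "line_degenerate \<mu>"
  shows "\<mu>$1$3$3 + \<mu>$3$1$3 = 1"
proof -
  let ?u = "\<mu>$1$3 + \<mu>$3$1"
  let ?x2 = "e 1 + e 2"
  let ?n1 = "mult \<mu> (e 3) ?x2 - mult \<mu> ?x2 (e 3) + (mult \<mu> (e 1) ?u - mult \<mu> ?u (e 1))"
  let ?n2 = "mult \<mu> (e 3) ?u - mult \<mu> ?u (e 3) + (mult \<mu> (e 1) (\<mu>$3$3) - mult \<mu> (\<mu>$3$3) (e 1))"
  let ?n3 = "mult \<mu> (e 3) (\<mu>$3$3) - mult \<mu> (\<mu>$3$3) (e 3)"
  have s: "sq \<mu> (e 1 + t *s e 3) = ?x2 + t *s ?u + t^2 *s \<mu>$3$3" for t
    by (simp add: mult_simps mult_e xx vec_eq_iff algebra_simps power2_eq_square)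
  have "nn \<mu> (e 1 + t *s e 3) = e 2 + t *s ?n1 + t^2 *s ?n2 + t^3 *s ?n3" for t
    unfolding nn_def s
    by (simp add: mult_simps mult_e xx xv vec_eq_iff algebra_simps power2_eq_square power3_eq_cube)
  then have "det3 (e 1 + t *s e 3) (?x2 + t *s ?u + t^2 *s \<mu>$3$3) (e 2 + t *s ?n1 + t^2 *s ?n2 + t^3 *s ?n3) = 0" for t
    using D s unfolding line_degenerate_def by metis
  from det3_derivative_zero[OF this]
  have d: "1 - ?u $ 3 + ?n1 $ 3 = 0" by (simp add: det3_def e_nth algebra_simps)
  have K0: "\<mu>$1$1$1 = 1" "\<mu>$1$1$2 = 1" "\<mu>$1$1$3 = 0"
    "\<mu>$1$2$1 = 0" "\<mu>$1$2$2 = 1" "\<mu>$1$2$3 = 0"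
    "\<mu>$2$1$1 = 0" "\<mu>$2$1$2 = 0" "\<mu>$2$1$3 = 0"
    using xx xv by (simp_all add: e_nth)
  have K1: "\<mu>$2$3$3 = \<mu>$1$3$3 ^ 2 - \<mu>$1$3$3"
    using sa_nth[OF V, of 1 1 3 3] unfolding K0 by algebra
  have K2: "\<mu>$3$2$3 = \<mu>$3$1$3 ^ 2 - \<mu>$3$1$3"
    using sa_nth[OF V, of 3 1 1 3] unfolding K0 K1 by algebra
  have "?n1 $ 3 = 0"
    by (simp add: mult_nth sum_3 e_nth K0 K1 K2 algebra_simps power2_eq_square)
  then show ?thesis using d by (simp add: algebra_simps)
qed

lemma line_degenerate_left:
  assumes V: "\<mu> \<in> semi_alternative" and D: "line_degenerate \<mu>"
    and w: "det3 x (sq \<mu> x) w \<noteq> 0" and d: "d \<noteq> 0"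
    and p: "mult \<mu> x (sq \<mu> x) = - (d^2) *s x + (2 * d) *s sq \<mu> x" and q: "mult \<mu> (sq \<mu> x) x = d *s sq \<mu> x"
  shows "\<mu> \<in> orbit S12 \<or> \<mu> \<in> orbit_closure S03"
proof -
  \<comment> \<open>Scaling makes d equal to 1; then x' v = v and v x' = 0, which is the
    two-dimensional subalgebra common to \<open>F12 1\<close> and \<open>F03 1 0\<close>.\<close>
  define x' where "x' = (1 / d) *s x"
  define v where "v = sq \<mu> x' - x'"
  have v: "v = (1 / d^2) *s sq \<mu> x - (1 / d) *s x"
    by (simp add: v_def x'_def mult_simps vec_eq_iff power2_eq_square)
  have "det3 x' v w = det3 x (sq \<mu> x) w / d^3"
    using d unfolding v x'_def by (simp add: det3_def field_simps power2_eq_square power3_eq_cube)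
  then have "det3 x' v w \<noteq> 0" using w d by simp
  then obtain g where g: "invertible g" "g *v x' = e 1" "g *v v = e 2" "g *v w = e 3"
    by (rule basis_change)
  let ?\<nu> = "gl_act g \<mu>"
  have V': "?\<nu> \<in> semi_alternative" by (rule semi_alternative_gl_act[OF g(1) V])
  have 1: "?\<nu>$1$1 = e 1 + e 2"
    unfolding gl_act_nth_products[OF g(1) g(2) g(2)] g(2)[symmetric] g(3)[symmetric]
      matrix_vector_right_distrib[symmetric] by (simp add: v_def)
  have "mult \<mu> x' v = v"
    using d unfolding v x'_def
    by (simp add: mult_simps p vec_eq_iff field_simps power2_eq_square)
  then have 2: "?\<nu>$1$2 = e 2" unfolding gl_act_nth_products[OF g(1) g(2) g(3)] by (simp add: g)
  have "mult \<mu> v x' = 0"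
    using d unfolding v x'_def
    by (simp add: mult_simps q vec_eq_iff field_simps power2_eq_square)
  then have 3: "?\<nu>$2$1 = 0" unfolding gl_act_nth_products[OF g(1) g(3) g(2)] by simp
  have "?\<nu>$1$3$3 + ?\<nu>$3$1$3 = 1"
    by (rule line_degenerate_trace[OF V' 1 2 3 line_degenerate_gl_act[OF g(1) D]])
  from F03_F12_tables[OF V' 1 2 3 this] show ?thesis
  proof
    assume "F03 1 0 \<in> orbit ?\<nu>"
    then have "?\<nu> \<in> orbit_closure S03"
      using orbit_closure_subset[OF F03_closure] orbit_sym orbit_subset_closure by blast
    then show ?thesis using orbit_closure_gl_act_iff[OF g(1)] by blast
  next
    assume F: "F12 1 \<in> orbit ?\<nu>"
    have "?\<nu> \<in> orbit \<mu>" using g(1) unfolding orbit_def by blast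
    then have "\<mu> \<in> orbit S12"
      using F F12_orbit[of 1] orbit_trans orbit_sym by (metis zero_neq_one)
    then show ?thesis ..
  qed
qed

text \<open>\<open>S12\<close> and \<open>S13\<close> enter with their orbits instead of closures:
  the proof that these orbits are open depends on it.\<close>

lemma nonzero_cube_associator:
  assumes V: "\<mu> \<in> semi_alternative" and n: "nn \<mu> x \<noteq> 0"
  shows "\<mu> \<in> orbit_closure S03 \<union> orbit_closure S06 \<union> orbit_closure S09 \<union> orbit_closure S11
    \<union> orbit S12 \<union> orbit S13"
proof (cases "line_degenerate \<mu>")
  case False
  then obtain z where z: "det3 z (sq \<mu> z) (nn \<mu> z) \<noteq> 0" unfolding line_degenerate_def by blast
  then obtain g where g: "invertible g" "g *v z = e 1" "g *v sq \<mu> z = e 2" "g *v nn \<mu> z = e 3"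
    by (rule basis_change)
  let ?\<nu> = "gl_act g \<mu>"
  have V': "?\<nu> \<in> semi_alternative" by (rule semi_alternative_gl_act[OF g(1) V])
  have 1: "?\<nu>$1$1 = e 2" unfolding gl_act_nth_products[OF g(1) g(2) g(2)] by (simp add: g)
  have 2: "?\<nu>$1$2 - ?\<nu>$2$1 = e 3"
    unfolding gl_act_nth_products[OF g(1) g(2) g(3)] gl_act_nth_products[OF g(1) g(3) g(2)]
    using g(4) by (simp add: nn_def matrix_vector_mult_diff_distrib)
  have "?\<nu> \<in> orbit_closure S03 \<union> orbit_closure S06 \<union> orbit_closure S09 \<union> orbit_closure S11"
    using generic_tables[OF V' 1 2]
  proof (elim disjE exE conjE)
    fix t assume "t \<noteq> 0" "?\<nu> = T03 t"
    then show ?thesis using T03_orbit[of t] orbit_subset_closure[of S03] by auto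
  qed (simp_all add: T09_closure T06_closure T11_closure)
  then show ?thesis using orbit_closure_gl_act_iff[OF g(1)] by blast
next
  case D: True
  have x: "x \<noteq> 0" using n by (auto simp: nn_def mult_simps)
  have k: "sq \<mu> x \<noteq> k *s x" for k
    using n by (auto simp: nn_def mult_simps)
  obtain w where w: "det3 x (sq \<mu> x) w \<noteq> 0"
    using det3_eq_0_all'[OF x k] by blast
  have "det3 x (sq \<mu> x) (nn \<mu> x) = 0" using D unfolding line_degenerate_def by blast
  then obtain \<alpha> \<beta> where nab: "nn \<mu> x = \<alpha> *s x + \<beta> *s sq \<mu> x"
    using det3_eq_0_span[OF w] by blast
  then have x2x: "mult \<mu> (sq \<mu> x) x = mult \<mu> x (sq \<mu> x) - \<alpha> *s x - \<beta> *s sq \<mu> x"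
    by (simp add: nn_def algebra_simps)
  \<comment> \<open>Otherwise x, x^2, x x^2 would be a basis and \<open>degenerate_dependent\<close>
    would give n = 0.\<close>
  have dep: "det3 x (sq \<mu> x) (mult \<mu> x (sq \<mu> x)) = 0"
  proof (rule ccontr)
    assume "det3 x (sq \<mu> x) (mult \<mu> x (sq \<mu> x)) \<noteq> 0"
    then obtain g where g: "invertible g" "g *v x = e 1" "g *v sq \<mu> x = e 2" "g *v mult \<mu> x (sq \<mu> x) = e 3"
      by (rule basis_change)
    let ?\<nu> = "gl_act g \<mu>"
    have V': "?\<nu> \<in> semi_alternative" by (rule semi_alternative_gl_act[OF g(1) V])
    have 1: "?\<nu>$1$1 = e 2" unfolding gl_act_nth_products[OF g(1) g(2) g(2)] by (simp add: g)
    have 2: "?\<nu>$1$2 = e 3" unfolding gl_act_nth_products[OF g(1) g(2) g(3)] by (simp add: g)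
    have 3: "?\<nu>$2$1 = e 3 - \<alpha> *s e 1 - \<beta> *s e 2"
      unfolding gl_act_nth_products[OF g(1) g(3) g(2)] x2x
      by (simp add: matrix_vector_mult_diff_distrib vec.scale g)
    from degenerate_dependent[OF V' 1 2 3] nab n show False by simp
  qed
  obtain a b where ab: "mult \<mu> x (sq \<mu> x) = a *s x + b *s sq \<mu> x"
    using det3_eq_0_span[OF w dep] by blast
  define c d where "c = a - \<alpha>" and "d = b - \<beta>"
  have cd: "mult \<mu> (sq \<mu> x) x = c *s x + d *s sq \<mu> x"
    unfolding x2x ab c_def d_def by (simp add: vec_eq_iff algebra_simps)
  obtain g where g: "invertible g" "g *v x = e 1" "g *v sq \<mu> x = e 2" "g *v w = e 3"
    using w by (rule basis_change)
  let ?\<nu> = "gl_act g \<mu>"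
  have V': "?\<nu> \<in> semi_alternative" by (rule semi_alternative_gl_act[OF g(1) V])
  have 1: "?\<nu>$1$1 = e 2" unfolding gl_act_nth_products[OF g(1) g(2) g(2)] by (simp add: g)
  have 2: "?\<nu>$1$2 = a *s e 1 + b *s e 2"
    unfolding gl_act_nth_products[OF g(1) g(2) g(3)] ab
    by (simp add: matrix_vector_right_distrib vec.scale g)
  have 3: "?\<nu>$2$1 = c *s e 1 + d *s e 2"
    unfolding gl_act_nth_products[OF g(1) g(3) g(2)] cd
    by (simp add: matrix_vector_right_distrib vec.scale g)
  have ne: "\<not> (a = c \<and> b = d)" using n nab unfolding c_def d_def by auto
  from two_dim_relations[OF V' 1 2 3] ne
  consider "c = 0" "b = 2 * d" "a = - (d^2)" "d \<noteq> 0" | "a = 0" "d = 2 * b" "c = - (b^2)" "b \<noteq> 0" by force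
  then show ?thesis
  proof cases
    case 1
    show ?thesis
      using line_degenerate_left[OF V D w, of d] ab cd 1 by auto
  next
    case 2
    have "opp \<mu> \<in> orbit S12 \<or> opp \<mu> \<in> orbit_closure S03"
      by (rule line_degenerate_left[of _ x w b])
        (use V D w ab cd 2 in \<open>simp_all add: mult_opp opp_semi_alternative line_degenerate_opp\<close>)
    then show ?thesis
      using opp_orbit[of "opp \<mu>" S12] orbit_closure_opp(5)[of \<mu>] by (auto simp: opp_S12)
  qed
qed

subsection \<open>Commutative cyclic algebras and algebras with proportional squares\<close>

lemma basis_orbit:
  assumes d: "det3 b1 b2 b3 \<noteq> 0"
    and "mult \<mu> b1 b1 = \<nu>$1$1$1 *s b1 + \<nu>$1$1$2 *s b2 + \<nu>$1$1$3 *s b3"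
    and "mult \<mu> b1 b2 = \<nu>$1$2$1 *s b1 + \<nu>$1$2$2 *s b2 + \<nu>$1$2$3 *s b3"
    and "mult \<mu> b1 b3 = \<nu>$1$3$1 *s b1 + \<nu>$1$3$2 *s b2 + \<nu>$1$3$3 *s b3"
    and "mult \<mu> b2 b1 = \<nu>$2$1$1 *s b1 + \<nu>$2$1$2 *s b2 + \<nu>$2$1$3 *s b3"
    and "mult \<mu> b2 b2 = \<nu>$2$2$1 *s b1 + \<nu>$2$2$2 *s b2 + \<nu>$2$2$3 *s b3"
    and "mult \<mu> b2 b3 = \<nu>$2$3$1 *s b1 + \<nu>$2$3$2 *s b2 + \<nu>$2$3$3 *s b3"
    and "mult \<mu> b3 b1 = \<nu>$3$1$1 *s b1 + \<nu>$3$1$2 *s b2 + \<nu>$3$1$3 *s b3"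
    and "mult \<mu> b3 b2 = \<nu>$3$2$1 *s b1 + \<nu>$3$2$2 *s b2 + \<nu>$3$2$3 *s b3"
    and "mult \<mu> b3 b3 = \<nu>$3$3$1 *s b1 + \<nu>$3$3$2 *s b2 + \<nu>$3$3$3 *s b3"
  shows "\<nu> \<in> orbit \<mu>"
proof -
  obtain g where g: "invertible g" "g *v b1 = e 1" "g *v b2 = e 2" "g *v b3 = e 3"
    using d by (rule basis_change)
  note p = gl_act_nth_products[OF g(1)]
  have "gl_act g \<mu> = \<nu>"
    unfolding vec_eq_iff[of "gl_act g \<mu>"] vec_eq_iff[of "gl_act g \<mu> $ _"] forall_3
    unfolding p[OF g(2) g(2)] p[OF g(2) g(3)] p[OF g(2) g(4)] p[OF g(3) g(2)] p[OF g(3) g(3)]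
      p[OF g(3) g(4)] p[OF g(4) g(2)] p[OF g(4) g(3)] p[OF g(4) g(4)] assms(2-)
      matrix_vector_right_distrib vec.scale g
    by (simp add: vec_eq_iff forall_3 e_nth)
  then show ?thesis using g(1) unfolding orbit_def by blast
qed

lemma basis_orbit_closure:
  assumes "\<nu> \<in> orbit \<mu>" "\<nu> \<in> orbit_closure \<kappa>"
  shows "\<mu> \<in> orbit_closure \<kappa>"
  using orbit_closure_subset[OF assms(2)] orbit_sym[OF assms(1)] orbit_subset_closure by blast

lemma cubic_roots:
  fixes p q r :: complex
  obtains a b c where "p = a + b + c" "q = - (a * b + b * c + a * c)" "r = a * b * c"
proof -
  have "\<not> constant (poly [:- r, - q, - p, 1:])"
    by (subst constant_degree) simp
  then obtain a where a: "poly [:- r, - q, - p, 1:] a = 0"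
    using fundamental_theorem_of_algebra by blast
  define s m where "s = p - a" and "m = - q - a * s"
  define b c where "b = (s + csqrt (s^2 - 4 * m)) / 2" and "c = (s - csqrt (s^2 - 4 * m)) / 2"
  have bc: "b + c = s" by (simp add: b_def c_def field_simps)
  have "b * c = (s^2 - (csqrt (s^2 - 4 * m))^2) / 4"
    by (simp add: b_def c_def power2_eq_square algebra_simps)
  then have m: "b * c = m" by simp
  have "a * m = r" using a unfolding m_def s_def by (simp add: algebra_simps)
  then have "r = a * b * c" unfolding m[symmetric] by (simp add: mult.assoc)
  moreover have "p = a + b + c" using bc s_def by (simp add: algebra_simps)
  moreover have "q = - (a * b + b * c + a * c)"
  proof -
    have "q = - (b * c) - a * (b + c)" unfolding m bc by (simp add: m_def)
    also have "\<dots> = - (a * b + b * c + a * c)" by (simp add: algebra_simps)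
    finally show ?thesis .
  qed
  ultimately show ?thesis using that by blast
qed

lemma quadratic_roots:
  fixes s m :: complex
  obtains b c where "b + c = s" "b * c = m"
\<comment> \<open>The cubic has constant term 0, so one root is 0 and the other two are the wanted
  pair.\<close>
proof (rule cubic_roots[of s "- m" 0])
  fix a b c assume "s = a + b + c" "- m = - (a * b + b * c + a * c)" "0 = a * b * c"
  then show thesis using that[of b c] that[of a c] that[of a b] by auto
qed

lemma cyclic_orbit_closure:
  assumes V: "\<mu> \<in> semi_alternative" and n: "nn \<mu> x = 0"
    and d: "det3 x (sq \<mu> x) (mult \<mu> x (sq \<mu> x)) \<noteq> 0"
  shows "\<mu> \<in> orbit_closure A07"
proof -
  obtain g where g: "invertible g" "g *v x = e 1" "g *v sq \<mu> x = e 2" "g *v mult \<mu> x (sq \<mu> x) = e 3"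
    using d by (rule basis_change)
  let ?\<nu> = "gl_act g \<mu>"
  have V': "?\<nu> \<in> semi_alternative" by (rule semi_alternative_gl_act[OF g(1) V])
  have 1: "?\<nu>$1$1 = e 2" unfolding gl_act_nth_products[OF g(1) g(2) g(2)] by (simp add: g)
  have 2: "?\<nu>$1$2 = e 3" unfolding gl_act_nth_products[OF g(1) g(2) g(3)] by (simp add: g)
  have 3: "?\<nu>$2$1 = e 3" unfolding gl_act_nth_products[OF g(1) g(3) g(2)]
    using n g(4) by (simp add: nn_def)
  obtain a b c where "?\<nu>$1$3$3 = a + b + c" "?\<nu>$1$3$2 = - (a * b + b * c + a * c)" "?\<nu>$1$3$1 = a * b * c"
    by (rule cubic_roots)
  then have "?\<nu> \<in> orbit_closure A07"
    using cyclic_table[OF V' 1 2 3] Tc_closure[of a b c] by simp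
  then show ?thesis using orbit_closure_gl_act_iff[OF g(1)] by blast
qed

lemma semi_alternativeD: "\<mu> \<in> semi_alternative \<Longrightarrow> associator \<mu> x y z = associator \<mu> y z x"
  unfolding semi_alternative_def by blast

lemma det3_lincomb:
  "det3 (a1 *s x + a2 *s y + a3 *s z) (b1 *s x + b2 *s y + b3 *s z) (c1 *s x + c2 *s y + c3 *s z)
    = (a1 * (b2 * c3 - b3 * c2) - a2 * (b1 * c3 - b3 * c1) + a3 * (b1 * c2 - b2 * c1)) * det3 x y z"
  unfolding det3_def vector_add_component vector_smult_component by algebra

text \<open>Polarization gives anticommutativity, and the cyclic identity then gives 2 x (x y) = 0.
  A nonzero product z = x y is therefore annihilated by x and y and independent of them: the
  Heisenberg Lie algebra.\<close>

lemma square_zero_algebra: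
  assumes V: "\<mu> \<in> semi_alternative" and s: "\<And>x. sq \<mu> x = 0"
  shows "\<mu> \<in> orbit_closure S11"
proof -
  have ac: "mult \<mu> y x = - mult \<mu> x y" for x y
    using s[of "x + y"] by (simp add: mult_simps s add_eq_0_iff)
  have xxy: "mult \<mu> x (mult \<mu> x y) = 0" for x y
  proof -
    have "associator \<mu> y x x = associator \<mu> x x y"
      by (rule semi_alternativeD[OF V])
    moreover have "associator \<mu> x x y = - mult \<mu> x (mult \<mu> x y)"
      by (simp add: associator_def s mult_simps)
    moreover have "associator \<mu> y x x = mult \<mu> x (mult \<mu> x y)"
      unfolding associator_def ac[of y x] s mult_uminus_left ac[of "mult \<mu> x y" x] mult_zero_right by simp
    ultimately have "mult \<mu> x (mult \<mu> x y) = - mult \<mu> x (mult \<mu> x y)" by simp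
    then show ?thesis by (simp add: vec_eq_iff)
  qed
  show ?thesis
  proof (cases "\<forall>x y. mult \<mu> x y = 0")
    case True
    have "\<mu> = Nil 0 0 0 0"
      by (rule alg_eqI) (simp add: True vec_eq_iff mult_nth sum_3 Nil_def forall_3)
    then show ?thesis using Nil_closure by metis
  next
    case False
    then obtain x y where xy: "mult \<mu> x y \<noteq> 0" by blast
    define z where "z = mult \<mu> x y"
    have xz: "mult \<mu> x z = 0" unfolding z_def by (rule xxy)
    have yz: "mult \<mu> y z = 0" unfolding z_def ac[of x y] mult_uminus_right xxy by simp
    have zx: "mult \<mu> z x = 0" "mult \<mu> z y = 0" unfolding ac[of z x] ac[of z y] xz yz by simp_all
    have "x \<noteq> 0" "y \<noteq> k *s x" for k using xy s by (auto simp: mult_simps)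
    then obtain w where w: "det3 x y w \<noteq> 0" using det3_eq_0_all' by metis
    have d: "det3 x y z \<noteq> 0"
    proof
      assume "det3 x y z = 0"
      then obtain k l where kl: "z = k *s x + l *s y" using det3_eq_0_span[OF w] by blast
      have "mult \<mu> x (k *s x + l *s y) = l *s z" "mult \<mu> y (k *s x + l *s y) = - k *s z"
        by (simp_all add: mult_simps s z_def ac[of y x])
      then have "l *s z = 0" "k *s z = 0" using xz yz unfolding kl[symmetric] by simp_all
      moreover have "z \<noteq> 0" using xy z_def by simp
      ultimately have "l = 0" "k = 0" by (simp_all only: vector_mul_eq_0 simp_thms)
      then show False using \<open>z \<noteq> 0\<close> kl by simp
    qed
    have "Nil 0 1 (-1) 0 \<in> orbit \<mu>"
      by (rule basis_orbit[OF d]) (simp_all add: Nil_def s xz yz zx z_def[symmetric] ac[of y x])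
    then show ?thesis using Nil_closure by (rule basis_orbit_closure)
  qed
qed

text \<open>Left multiplication by the idempotent \<open>e 1\<close> is a projection on the span of
  \<open>e 2\<close> and \<open>e 3\<close>, by the relations \<open>M\<close>; its ranks 0, 1, 2
  lead to S13, S03, S12. The product of \<open>e 2\<close> and \<open>e 3\<close> turns out to be
  zero.\<close>

lemma idempotent_table:
  assumes V: "\<mu> \<in> semi_alternative" and f: "\<mu>$1$1 = e 1"
    and p: "\<mu>$1$2 + \<mu>$2$1 = e 2" "\<mu>$1$3 + \<mu>$3$1 = e 3" "\<mu>$2$2 = 0" "\<mu>$3$3 = 0" "\<mu>$3$2 = - \<mu>$2$3"
  shows "\<mu> \<in> orbit_closure S12 \<union> orbit_closure S13 \<union> orbit_closure S03"
proof -
  define a1 a2 a3 where "a1 = \<mu>$1$2$1" and "a2 = \<mu>$1$2$2" and "a3 = \<mu>$1$2$3"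
  define b1 b2 b3 where "b1 = \<mu>$1$3$1" and "b2 = \<mu>$1$3$2" and "b3 = \<mu>$1$3$3"
  define c1 c2 c3 where "c1 = \<mu>$2$3$1" and "c2 = \<mu>$2$3$2" and "c3 = \<mu>$2$3$3"
  have q: "\<mu>$2$1 = e 2 - \<mu>$1$2" "\<mu>$3$1 = e 3 - \<mu>$1$3"
    using p(1,2) by (simp_all add: algebra_simps)
  have K: "\<mu>$1$1$1 = 1" "\<mu>$1$1$2 = 0" "\<mu>$1$1$3 = 0"
    "\<mu>$1$2$1 = a1" "\<mu>$1$2$2 = a2" "\<mu>$1$2$3 = a3"
    "\<mu>$2$1$1 = - a1" "\<mu>$2$1$2 = 1 - a2" "\<mu>$2$1$3 = - a3"
    "\<mu>$1$3$1 = b1" "\<mu>$1$3$2 = b2" "\<mu>$1$3$3 = b3"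
    "\<mu>$3$1$1 = - b1" "\<mu>$3$1$2 = - b2" "\<mu>$3$1$3 = 1 - b3"
    "\<mu>$2$3$1 = c1" "\<mu>$2$3$2 = c2" "\<mu>$2$3$3 = c3"
    "\<mu>$3$2$1 = - c1" "\<mu>$3$2$2 = - c2" "\<mu>$3$2$3 = - c3"
    "\<mu>$2$2$1 = 0" "\<mu>$2$2$2 = 0" "\<mu>$2$2$3 = 0" "\<mu>$3$3$1 = 0" "\<mu>$3$3$2 = 0" "\<mu>$3$3$3 = 0"
    using f p(3-) by (simp_all add: q a1_def a2_def a3_def b1_def b2_def b3_def c1_def c2_def c3_def e_nth)
  have u: "a2 * a1 + a3 * b1 = - a1" "b2 * a1 + b3 * b1 = - b1"
    using sa_nth[OF V, of 1 1 2 1] sa_nth[OF V, of 1 1 3 1] unfolding K by algebra+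
  have M: "a2^2 + a3 * b2 = a2" "a3 * (a2 + b3 - 1) = 0" "b2 * (a2 + b3 - 1) = 0" "b3^2 + a3 * b2 = b3"
    using sa_nth[OF V, of 1 1 2 2] sa_nth[OF V, of 1 1 2 3] sa_nth[OF V, of 1 1 3 2] sa_nth[OF V, of 1 1 3 3]
    unfolding K by algebra+
  have "2 * a1 = 0" "2 * b1 = 0" using u M by algebra+
  then have ab: "a1 = 0" "b1 = 0" by simp_all
  have "3 * c1 = 0" using sa_nth[OF V, of 2 2 3 2] sa_nth[OF V, of 2 3 2 2] unfolding K ab by algebra
  then have c1: "c1 = 0" by simp
  have "c2 ^ 2 = 0" "c3 ^ 2 = 0"
    using sa_nth[OF V, of 3 2 3 2] sa_nth[OF V, of 2 2 3 3] unfolding K ab c1 by algebra+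
  then have c: "c2 = 0" "c3 = 0" by simp_all
  note K = K[unfolded ab c1 c]
  note N = F03_def table_simps K algebra_simps power2_eq_square
  have F03: ?thesis if "F03 0 0 \<in> orbit \<mu>"
    using basis_orbit_closure[OF that F03_closure] by blast
  show ?thesis
  proof (cases "a2 + b3 = 1")
    case tr: True
    then have b3: "b3 = 1 - a2" by (simp add: algebra_simps)
    show ?thesis
    proof (cases "a3 = 0")
      case False
      \<comment> \<open>The new vectors e1 e2 and e2 - e1 e2 span image and kernel of the projection
        of rank one.\<close>
      have "F03 0 0 \<in> orbit \<mu>"
        by (rule orbitI[of "vector [vector [1,0,0], vector [0,a2,1-a2], vector [0,a3,-a3]]"])
          (use M False in \<open>auto simp: N b3\<close>)
      then show ?thesis by (rule F03)
    next
      case a3: True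
      then have "a2 * (a2 - 1) = 0" using M(1) by (simp add: algebra_simps power2_eq_square)
      then consider "a2 = 1" | "a2 = 0" by auto
      then show ?thesis
      proof cases
        case 1
        have "F03 0 0 \<in> orbit \<mu>"
          by (rule orbitI[of "vector [vector [1,0,0], vector [0,1,-b2], vector [0,0,1]]"])
            (simp_all add: N b3 a3 1)
        then show ?thesis by (rule F03)
      next
        case 2
        have "F03 0 0 \<in> orbit \<mu>"
          by (rule orbitI[of "vector [vector [1,0,0], vector [0,b2,1], vector [0,1,0]]"])
            (simp_all add: N b3 a3 2)
        then show ?thesis by (rule F03)
      qed
    qed
  next
    case False
    then have ab': "a3 = 0" "b2 = 0" using M(2,3) by simp_all
    then have "a2 * (a2 - 1) = 0" "b3 * (b3 - 1) = 0"
      using M(1,4) by (simp_all add: algebra_simps power2_eq_square)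
    then consider "a2 = 0" "b3 = 0" | "a2 = 1" "b3 = 1" using False by auto
    then show ?thesis
    proof cases
      case 1
      have "opp \<mu> = F12 0"
        by (simp add: table_eqI F12_def forall_3 vector_3 K ab' 1)
      then show ?thesis using F12_closure[of 0] orbit_closure_opp(4)[of \<mu>] by simp
    next
      case 2
      have "\<mu> = F12 0"
        by (simp add: table_eqI F12_def forall_3 vector_3 K ab' 2)
      then show ?thesis using F12_closure[of 0] by simp
    qed
  qed
qed

lemma det3_coeffs_zero:
  assumes "det3 x y z \<noteq> 0" "a *s x + b *s y + c *s z = 0"
  shows "a = 0" "b = 0" "c = 0"
proof -
  obtain g where g: "invertible g" "g *v x = e 1" "g *v y = e 2" "g *v z = e 3"
    using assms(1) by (rule basis_change)
  have "g *v (a *s x + b *s y + c *s z) = 0" unfolding assms(2) by simp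
  then have "a *s e 1 + b *s e 2 + c *s e 3 = 0"
    by (simp add: matrix_vector_right_distrib vec.scale g)
  then show "a = 0" "b = 0" "c = 0" by (simp_all add: vec_eq_iff forall_3 e_nth)
qed

lemma proportional_squares:
  assumes V: "\<mu> \<in> semi_alternative" and s: "\<And>x. \<exists>k. sq \<mu> x = k *s x"
  shows "\<mu> \<in> orbit_closure S03 \<union> orbit_closure S11 \<union> orbit_closure S12 \<union> orbit_closure S13"
proof (cases "\<forall>x. sq \<mu> x = 0")
  case True
  then show ?thesis using square_zero_algebra[OF V] by blast
next
  case False
  then obtain x k where x: "sq \<mu> x = k *s x" "sq \<mu> x \<noteq> 0" using s by metis
  define f where "f = (1 / k) *s x"
  have f: "sq \<mu> f = f" "f \<noteq> 0" using x by (auto simp: f_def mult_simps)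
  \<comment> \<open>If y^2 = k y, comparing the squares of y, y + f and y - f shows that y + f has
    factor k + 1; accordingly y - k f has factor 0.\<close>
  have shift: "\<exists>k. sq \<mu> (y - k *s f) = 0 \<and>
      mult \<mu> f (y - k *s f) + mult \<mu> (y - k *s f) f = y - k *s f"
    if y: "\<And>k. y \<noteq> k *s f" for y
  proof -
    obtain w where w: "det3 f y w \<noteq> 0" using det3_eq_0_all'[OF f(2) y] by blast
    obtain k k1 k2 where k: "sq \<mu> y = k *s y" "sq \<mu> (y + f) = k1 *s (y + f)" "sq \<mu> (y - f) = k2 *s (y - f)"
      using s by metis
    define u where "u = mult \<mu> f y + mult \<mu> y f"
    have 1: "k *s y + u + f = k1 *s (y + f)"
      using k(2) by (simp add: mult_simps k f u_def algebra_simps)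
    have 2: "k *s y - u + f = k2 *s (y - f)"
      using k(3) by (simp add: mult_simps k f u_def algebra_simps)
    have "(2 - k1 + k2) *s f + (2 * k - k1 - k2) *s y + 0 *s w = (k *s y + u + f - k1 *s (y + f)) + (k *s y - u + f - k2 *s (y - f))"
      by (simp add: vec_eq_iff algebra_simps)
    also have "\<dots> = 0" using 1 2 by simp
    finally have "2 - k1 + k2 = 0" "2 * k - k1 - k2 = 0" using det3_coeffs_zero[OF w] by blast+
    then have "2 * k1 = 2 * (k + 1)" by (simp add: algebra_simps add_eq_0_iff)
    then have "k1 = k + 1" using mult_left_cancel[of 2 k1 "k + 1"] by simp
    then have u: "u = y + k *s f" using 1 by (simp add: vec_eq_iff algebra_simps)
    have a: "mult \<mu> f (y - k *s f) + mult \<mu> (y - k *s f) f = u - (2 * k) *s f"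
      by (simp add: mult_simps f u_def vec_eq_iff)
    have b: "sq \<mu> (y - k *s f) = sq \<mu> y - k *s u + (k * k) *s sq \<mu> f"
      by (simp add: mult_simps u_def vec_eq_iff algebra_simps)
    show ?thesis
      by (rule exI[of _ k]) (simp add: a b k(1) f u vec_eq_iff algebra_simps)
  qed
  obtain y0 z0 where d0: "det3 f y0 z0 \<noteq> 0"
  proof -
    obtain i where i: "f $ i \<noteq> 0" using f(2) by (auto simp: vec_eq_iff)
    have "det3 f (e 2) (e 3) = f $ 1" "det3 f (e 3) (e 1) = f $ 2" "det3 f (e 1) (e 2) = f $ 3"
      by (simp_all add: det3_def e_nth)
    then show ?thesis using i exhaust_3[of i] that by metis
  qed
  have "y0 \<noteq> k *s f" "z0 \<noteq> k *s f" for k using d0 by (auto simp: det3_def algebra_simps)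
  then obtain k l where y: "sq \<mu> (y0 - k *s f) = 0" "mult \<mu> f (y0 - k *s f) + mult \<mu> (y0 - k *s f) f = y0 - k *s f"
    and z: "sq \<mu> (z0 - l *s f) = 0" "mult \<mu> f (z0 - l *s f) + mult \<mu> (z0 - l *s f) f = z0 - l *s f"
    using shift[of y0] shift[of z0] by blast
  define y' z' where "y' = y0 - k *s f" and "z' = z0 - l *s f"
  note y = y[folded y'_def] and z = z[folded z'_def]
  have d: "det3 f y' z' \<noteq> 0"
    using d0 unfolding y'_def z'_def by (simp add: det3_def algebra_simps)
  \<comment> \<open>Comparing coefficients of f shows \<open>k2\<close> = 1, then \<open>k1\<close>
    = 0; so y' + z' has square zero and y', z' anticommute.\<close>
  obtain k1 k2 where k: "sq \<mu> (y' + z') = k1 *s (y' + z')" "sq \<mu> (f + (y' + z')) = k2 *s (f + (y' + z'))"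
    using s by metis
  have "sq \<mu> (f + (y' + z')) = sq \<mu> f + ((mult \<mu> f y' + mult \<mu> y' f) + (mult \<mu> f z' + mult \<mu> z' f)) + sq \<mu> (y' + z')"
    by (simp add: mult_simps algebra_simps)
  then have E: "k2 *s (f + (y' + z')) = f + (y' + z') + k1 *s (y' + z')"
    unfolding k y(2) z(2) f(1) .
  have "(1 - k2) *s f + (1 + k1 - k2) *s y' + (1 + k1 - k2) *s z'
      = f + (y' + z') + k1 *s (y' + z') - k2 *s (f + (y' + z'))"
    by (simp add: vec_eq_iff algebra_simps)
  also have "\<dots> = 0" unfolding E by simp
  finally have "1 - k2 = 0" "1 + k1 - k2 = 0" using det3_coeffs_zero[OF d] by blast+
  then have "k1 = 0" by simp
  then have yz: "mult \<mu> z' y' = - mult \<mu> y' z'"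
    using k(1) by (simp add: mult_simps y z add_eq_0_iff)
  obtain g where g: "invertible g" "g *v f = e 1" "g *v y' = e 2" "g *v z' = e 3"
    using d by (rule basis_change)
  note p = gl_act_nth_products[OF g(1)]
  have "gl_act g \<mu> \<in> orbit_closure S12 \<union> orbit_closure S13 \<union> orbit_closure S03"
  proof (rule idempotent_table[OF semi_alternative_gl_act[OF g(1) V]])
    show "gl_act g \<mu> $ 1 $ 1 = e 1" unfolding p[OF g(2) g(2)] f g ..
    show "gl_act g \<mu> $ 1 $ 2 + gl_act g \<mu> $ 2 $ 1 = e 2"
      unfolding p[OF g(2) g(3)] p[OF g(3) g(2)] matrix_vector_right_distrib[symmetric] y g ..
    show "gl_act g \<mu> $ 1 $ 3 + gl_act g \<mu> $ 3 $ 1 = e 3"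
      unfolding p[OF g(2) g(4)] p[OF g(4) g(2)] matrix_vector_right_distrib[symmetric] z g ..
    show "gl_act g \<mu> $ 2 $ 2 = 0" unfolding p[OF g(3) g(3)] y by simp
    show "gl_act g \<mu> $ 3 $ 3 = 0" unfolding p[OF g(4) g(4)] z by simp
    show "gl_act g \<mu> $ 3 $ 2 = - gl_act g \<mu> $ 2 $ 3"
      unfolding p[OF g(3) g(4)] p[OF g(4) g(3)] yz
      by (simp add: vec_eq_iff matrix_vector_mult_def sum_negf)
  qed
  then show ?thesis using orbit_closure_gl_act_iff[OF g(1)] by blast
qed

subsection \<open>Traces of multiplication operators\<close>

definition LM :: "alg3 \<Rightarrow> complex^3 \<Rightarrow> complex^3^3" where
  "LM \<mu> z = (\<chi> k j. mult \<mu> z (e j) $ k)"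

definition RM :: "alg3 \<Rightarrow> complex^3 \<Rightarrow> complex^3^3" where
  "RM \<mu> z = (\<chi> k j. mult \<mu> (e j) z $ k)"

lemma LM_vec: "LM \<mu> z *v x = mult \<mu> z x"
  by (simp add: LM_def vec_eq_iff matrix_vector_mult_def mult_nth sum_3 e_nth algebra_simps)

lemma RM_vec: "RM \<mu> z *v x = mult \<mu> x z"
  by (simp add: RM_def vec_eq_iff matrix_vector_mult_def mult_nth sum_3 e_nth algebra_simps)

lemma LM_gl_act: "invertible g \<Longrightarrow> LM (gl_act g \<mu>) (g *v z) = g ** LM \<mu> z ** matrix_inv g"
  by (simp add: matrix_eq LM_vec mult_gl_act matrix_inv_mult flip: matrix_vector_mul_assoc)

lemma RM_gl_act: "invertible g \<Longrightarrow> RM (gl_act g \<mu>) (g *v z) = g ** RM \<mu> z ** matrix_inv g"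
  by (simp add: matrix_eq RM_vec mult_gl_act matrix_inv_mult flip: matrix_vector_mul_assoc)

lemma trace_conjugate: "invertible (g :: complex^3^3) \<Longrightarrow> trace (g ** A ** matrix_inv g) = trace A"
  by (metis matrix_inv_both(2) matrix_mul_assoc matrix_mul_rid trace_mul_sym)

lemma trace_LM_basis:
  assumes d: "det3 b1 b2 b3 \<noteq> 0"
    and "mult \<mu> z b1 = a1 *s b1 + a2 *s b2 + a3 *s b3"
    and "mult \<mu> z b2 = c1 *s b1 + c2 *s b2 + c3 *s b3"
    and "mult \<mu> z b3 = d1 *s b1 + d2 *s b2 + d3 *s b3"
  shows "trace (LM \<mu> z) = a1 + c2 + d3"
proof -
  obtain g where g: "invertible g" "g *v b1 = e 1" "g *v b2 = e 2" "g *v b3 = e 3"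
    using d by (rule basis_change)
  have "trace (LM \<mu> z) = trace (LM (gl_act g \<mu>) (g *v z))"
    by (simp add: LM_gl_act g(1) trace_conjugate)
  also have "\<dots> = (g *v mult \<mu> z b1) $ 1 + (g *v mult \<mu> z b2) $ 2 + (g *v mult \<mu> z b3) $ 3"
    by (simp add: trace_def LM_def sum_3 g(2-)[symmetric] mult_gl_act_apply[OF g(1)])
  also have "\<dots> = a1 + c2 + d3"
    unfolding assms(2-) by (simp add: matrix_vector_right_distrib vec.scale g e_nth)
  finally show ?thesis .
qed

lemma LM_opp: "LM (opp \<mu>) z = RM \<mu> z" and RM_opp: "RM (opp \<mu>) z = LM \<mu> z"
  by (simp_all add: LM_def RM_def mult_opp)

lemma trace_RM_basis:
  assumes "det3 b1 b2 b3 \<noteq> 0"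
    and "mult \<mu> b1 z = a1 *s b1 + a2 *s b2 + a3 *s b3"
    and "mult \<mu> b2 z = c1 *s b1 + c2 *s b2 + c3 *s b3"
    and "mult \<mu> b3 z = d1 *s b1 + d2 *s b2 + d3 *s b3"
  shows "trace (RM \<mu> z) = a1 + c2 + d3"
  using trace_LM_basis[of b1 b2 b3 "opp \<mu>"] assms by (simp add: mult_opp LM_opp)

subsection \<open>The associative case\<close>

lemma associator_simps:
  "associator \<mu> (x + x') y z = associator \<mu> x y z + associator \<mu> x' y z"
  "associator \<mu> x (y + y') z = associator \<mu> x y z + associator \<mu> x y' z"
  "associator \<mu> x y (z + z') = associator \<mu> x y z + associator \<mu> x y z'"
  "associator \<mu> (c *s x) y z = c *s associator \<mu> x y z"
  "associator \<mu> x (c *s y) z = c *s associator \<mu> x y z"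
  "associator \<mu> x y (c *s z) = c *s associator \<mu> x y z"
  "associator \<mu> (- x) y z = - associator \<mu> x y z"
  "associator \<mu> x (- y) z = - associator \<mu> x y z"
  "associator \<mu> x y (- z) = - associator \<mu> x y z"
  by (simp_all add: associator_def mult_simps vec_eq_iff algebra_simps)

lemma basis_expand:
  assumes "det3 b1 b2 b3 \<noteq> 0"
  obtains c1 c2 c3 where "w = c1 *s b1 + c2 *s b2 + c3 *s b3"
proof -
  obtain g where g: "invertible g" "g *v b1 = e 1" "g *v b2 = e 2" "g *v b3 = e 3"
    using assms by (rule basis_change)
  have "g *v w = g *v ((g *v w) $ 1 *s b1 + (g *v w) $ 2 *s b2 + (g *v w) $ 3 *s b3)"
    by (simp add: matrix_vector_right_distrib vec.scale g flip: vec_expand)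
  then have "w = (g *v w) $ 1 *s b1 + (g *v w) $ 2 *s b2 + (g *v w) $ 3 *s b3"
    using matrix_inv_mult(2)[OF g(1)] by metis
  then show ?thesis by (rule that)
qed

text \<open>Linearizing (x, x, x) = 0 makes the sum of the three associators in x, x, y vanish, and
  the cyclic identity makes the three equal.\<close>

lemma alternating_associator:
  assumes V: "\<mu> \<in> semi_alternative" and n: "\<And>x. nn \<mu> x = 0"
  shows "associator \<mu> x x y = 0" "associator \<mu> x y x = 0" "associator \<mu> y x x = 0"
proof -
  have xxx: "associator \<mu> x x x = 0" for x using n[of x] by (simp add: nn_def associator_def)
  have c: "associator \<mu> x y x = associator \<mu> x x y" "associator \<mu> y x x = associator \<mu> x x y"
    using semi_alternativeD[OF V, of x x y] semi_alternativeD[OF V, of y x x] by simp_all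
  have "associator \<mu> (x + y) (x + y) (x + y) + - associator \<mu> (x + - y) (x + - y) (x + - y)
    = 2 *s (associator \<mu> x x y + associator \<mu> x y x + associator \<mu> y x x) + 2 *s associator \<mu> y y y"
    unfolding associator_simps by (simp add: vec_eq_iff)
  then have "6 *s associator \<mu> x x y = 0"
    unfolding xxx c by (simp add: vec_eq_iff)
  then show "associator \<mu> x x y = 0" by (simp add: vec_eq_iff)
  then show "associator \<mu> x y x = 0" "associator \<mu> y x x = 0" by (simp_all add: c)
qed

text \<open>The associator is alternating and, by Artin's theorem, vanishes on \<open>x\<close>, \<open>x\<^sup>2\<close>, \<open>y\<close>.\<close>

lemma associative:
  assumes V: "\<mu> \<in> semi_alternative" and n: "\<And>x. nn \<mu> x = 0" and d: "det3 x (sq \<mu> x) y \<noteq> 0"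
  shows "mult \<mu> (mult \<mu> a b) c = mult \<mu> a (mult \<mu> b c)"
proof -
  note alt = alternating_associator[OF V n]
  have skew: "associator \<mu> v u w = - associator \<mu> u v w" for u v w
    using alt(1)[of "u + v" w] by (simp add: associator_simps alt add_eq_0_iff)
  \<comment> \<open>Teichmueller's identity, valid in every algebra, for the arguments x, x, x,
    y.\<close>
  have "associator \<mu> (sq \<mu> x) x y - associator \<mu> x (sq \<mu> x) y + associator \<mu> x x (mult \<mu> x y)
    = mult \<mu> x (associator \<mu> x x y) + mult \<mu> (associator \<mu> x x x) y"
    by (simp add: associator_def mult_simps)
  then have "2 *s associator \<mu> x (sq \<mu> x) y = 0"
    unfolding alt skew[of "sq \<mu> x" x] by (simp add: mult_simps vec_eq_iff)
  then have 1: "associator \<mu> x (sq \<mu> x) y = 0" by (simp add: vec_eq_iff)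
  then have 2: "associator \<mu> (sq \<mu> x) y x = 0" "associator \<mu> y x (sq \<mu> x) = 0"
    using semi_alternativeD[OF V] by metis+
  have 3: "associator \<mu> (sq \<mu> x) x y = 0" "associator \<mu> y (sq \<mu> x) x = 0" "associator \<mu> x y (sq \<mu> x) = 0"
    using skew[of x "sq \<mu> x" y] skew[of "sq \<mu> x" y x] skew[of y x "sq \<mu> x"] 1 2 by simp_all
  obtain a1 a2 a3 b1 b2 b3 c1 c2 c3 where abc: "a = a1 *s x + a2 *s sq \<mu> x + a3 *s y"
    "b = b1 *s x + b2 *s sq \<mu> x + b3 *s y" "c = c1 *s x + c2 *s sq \<mu> x + c3 *s y"
    using basis_expand[OF d] by metis
  have "associator \<mu> a b c = 0"
    unfolding abc associator_simps alt 1 2 3 by simp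
  then show ?thesis by (simp add: associator_def)
qed

lemma det3_third:
  "det3 a b (x + y) = det3 a b x + det3 a b y" "det3 a b (x - y) = det3 a b x - det3 a b y"
  "det3 a b (k *s x) = k * det3 a b x" "det3 a b a = 0" "det3 a b b = 0" "det3 a b (- x) = - det3 a b x"
  by (simp_all add: det3_def algebra_simps)

definition cube_degenerate :: "alg3 \<Rightarrow> bool" where
  "cube_degenerate \<mu> \<longleftrightarrow> (\<forall>z. det3 z (sq \<mu> z) (mult \<mu> z (sq \<mu> z)) = 0)"

text \<open>In the following locale \<open>x\<close>, \<open>x\<^sup>2\<close>, \<open>y\<close> is a basis of an associative algebra in which the powers
  \<open>z\<close>, \<open>z\<^sup>2\<close>, \<open>z\<^sup>3\<close> of every element are dependent; \<open>p3\<close> and \<open>q3\<close> are the eigenvalues of the left and right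
  multiplication by \<open>x\<close> modulo the subalgebra generated by \<open>x\<close>.\<close>

locale assoc_basis =
  fixes \<mu> :: alg3 and x y :: "complex^3" and \<alpha> \<beta> p1 p2 p3 q1 q2 q3 :: complex
  assumes AS: "\<And>a b c. mult \<mu> (mult \<mu> a b) c = mult \<mu> a (mult \<mu> b c)"
    and deg: "cube_degenerate \<mu>"
    and D: "det3 x (sq \<mu> x) y \<noteq> 0"
    and x3: "mult \<mu> x (sq \<mu> x) = \<beta> *s x + \<alpha> *s sq \<mu> x"
    and xy: "mult \<mu> x y = p1 *s x + p2 *s sq \<mu> x + p3 *s y"
    and yx: "mult \<mu> y x = q1 *s x + q2 *s sq \<mu> x + q3 *s y"
begin

abbreviation m (infixl "\<cdot>" 70) where "a \<cdot> b \<equiv> mult \<mu> a b"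

text \<open>A coordinate on the quotient by the span of x and x^2, on which left and right
  multiplication by x act as p3 and q3.\<close>

abbreviation "\<phi> w \<equiv> det3 x (x \<cdot> x) w"

lemma \<phi>L: "\<phi> (x \<cdot> w) = p3 * \<phi> w"
proof -
  obtain a b c where w: "w = a *s x + b *s (x \<cdot> x) + c *s y" using basis_expand[OF D] by metis
  show ?thesis unfolding w by (simp add: mult_simps det3_third x3 xy)
qed

lemma \<phi>R: "\<phi> (w \<cdot> x) = q3 * \<phi> w"
proof -
  obtain a b c where w: "w = a *s x + b *s (x \<cdot> x) + c *s y" using basis_expand[OF D] by metis
  show ?thesis unfolding w by (simp add: mult_simps det3_third AS x3 yx)
qed

text \<open>The relation for x^3 read as an identity of left multiplications on the quotient. It
  holds only after multiplication by x, which adds the root 0.\<close>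

lemma p3_root: "p3 * (p3^2 - \<alpha> * p3 - \<beta>) = 0"
proof -
  have "\<phi> (x \<cdot> (x \<cdot> x) \<cdot> y) = \<phi> (x \<cdot> (x \<cdot> (x \<cdot> y)))" by (simp add: AS)
  moreover have "\<phi> (x \<cdot> (x \<cdot> x) \<cdot> y) = \<phi> (\<beta> *s (x \<cdot> y) + \<alpha> *s (x \<cdot> (x \<cdot> y)))"
    unfolding x3 by (simp add: mult_simps AS)
  ultimately have "(\<beta> * p3 + \<alpha> * (p3 * p3)) * \<phi> y = p3 * (p3 * p3) * \<phi> y"
    by (simp add: det3_third \<phi>L algebra_simps)
  then have "\<beta> * p3 + \<alpha> * (p3 * p3) = p3 * (p3 * p3)" using mult_right_cancel[OF D] by blast
  then show ?thesis by (simp add: algebra_simps power2_eq_square)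
qed

lemma q3_root: "q3 * (q3^2 - \<alpha> * q3 - \<beta>) = 0"
proof -
  have "\<phi> (y \<cdot> (x \<cdot> (x \<cdot> x))) = \<phi> (((y \<cdot> x) \<cdot> x) \<cdot> x)" by (simp add: AS)
  moreover have "\<phi> (y \<cdot> (x \<cdot> (x \<cdot> x))) = \<phi> (\<beta> *s (y \<cdot> x) + \<alpha> *s ((y \<cdot> x) \<cdot> x))"
    unfolding x3 by (simp add: mult_simps AS)
  ultimately have "(\<beta> * q3 + \<alpha> * (q3 * q3)) * \<phi> y = q3 * (q3 * q3) * \<phi> y"
    unfolding det3_third \<phi>R by (simp add: algebra_simps)
  then have "\<beta> * q3 + \<alpha> * (q3 * q3) = q3 * (q3 * q3)" using mult_right_cancel[OF D] by blast
  then show ?thesis by (simp add: algebra_simps power2_eq_square)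
qed

lemma trace_x: "trace (LM \<mu> x) = \<alpha> + p3" "trace (RM \<mu> x) = \<alpha> + q3"
proof -
  have "trace (LM \<mu> x) = 0 + \<alpha> + p3"
    by (rule trace_LM_basis[OF D, of _ _ _ 1 0 \<beta> _ 0 p1 p2]) (simp_all add: x3 xy)
  then show "trace (LM \<mu> x) = \<alpha> + p3" by simp
  have "trace (RM \<mu> x) = 0 + \<alpha> + q3"
    by (rule trace_RM_basis[OF D, of _ _ _ 1 0 \<beta> _ 0 q1 q2]) (simp_all add: x3 yx AS)
  then show "trace (RM \<mu> x) = \<alpha> + q3" by simp
qed

text \<open>Since x commutes with its powers, [x, x y] = p3 u and [x, y x] = q3 u for u = [x, y], so
  u is an eigenvector on both sides. Then (u x) u = u (x u) gives u^2 = 0.\<close>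

lemma distinct_eigenvalues:
  assumes ne: "p3 \<noteq> q3"
  shows "\<mu> \<in> orbit_closure S06 \<union> orbit_closure S09 \<union> orbit_closure S11"
proof -
  define u where "u = x \<cdot> y - y \<cdot> x"
  have xu: "x \<cdot> u = p3 *s u"
  proof -
    have "x \<cdot> u = x \<cdot> (x \<cdot> y) - (x \<cdot> y) \<cdot> x" by (simp add: u_def mult_simps AS)
    also have "\<dots> = p3 *s u"
      unfolding u_def xy by (simp add: mult_simps AS vec_eq_iff algebra_simps xy)
    finally show ?thesis .
  qed
  have ux: "u \<cdot> x = q3 *s u"
  proof -
    have "u \<cdot> x = x \<cdot> (y \<cdot> x) - (y \<cdot> x) \<cdot> x" by (simp add: u_def mult_simps AS)
    also have "\<dots> = q3 *s u"
      unfolding u_def yx by (simp add: mult_simps AS vec_eq_iff algebra_simps yx)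
    finally show ?thesis .
  qed
  have "q3 *s (u \<cdot> u) = p3 *s (u \<cdot> u)"
    using AS[of u x u] unfolding ux xu mult_simps .
  then have "(p3 - q3) *s (u \<cdot> u) = 0" by (auto simp: vec.scale_left_diff_distrib)
  then have uu: "u \<cdot> u = 0" using ne unfolding vector_mul_eq_0 by simp
  have "\<phi> u = (p3 - q3) * \<phi> y" unfolding u_def det3_third \<phi>L \<phi>R by (simp add: algebra_simps)
  then have Du: "\<phi> u \<noteq> 0" using ne D by simp
  obtain a b where ab: "a + b = \<alpha>" "a * b = - \<beta>" by (rule quadratic_roots)
  have fac: "z^2 - \<alpha> * z - \<beta> = (z - a) * (z - b)" for z
  proof -
    have "\<beta> = - (a * b)" using ab(2) by simp
    then show ?thesis by (simp add: ab(1)[symmetric] algebra_simps power2_eq_square)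
  qed
  have uxx: "u \<cdot> (x \<cdot> x) = (q3 * q3) *s u"
    unfolding AS[symmetric] ux by (simp add: mult_simps ux)
  note K = mult_simps AS x3 xu ux uxx uu K09_def K11_def vec_eq_iff algebra_simps power2_eq_square
  have 09: "K09 p3 k \<in> orbit \<mu>" if "q3 = 0" "p3 + k = \<alpha>" "p3 * k = - \<beta>" for k
  proof -
    have b: "\<beta> = - (p3 * k)" using that(3) by simp
    show ?thesis by (rule basis_orbit[OF Du]) (simp_all add: K that(1) that(2)[symmetric] b)
  qed
  have 06: "K09 q3 k \<in> orbit (opp \<mu>)" if "p3 = 0" "q3 + k = \<alpha>" "q3 * k = - \<beta>" for k
  proof -
    have b: "\<beta> = - (q3 * k)" using that(3) by simp
    show ?thesis
      by (rule basis_orbit[of x "x \<cdot> x" u]) (simp_all add: Du mult_opp K that(1) that(2)[symmetric] b)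
  qed
  have 11: "K11 p3 q3 \<in> orbit \<mu>" if "p3 + q3 = \<alpha>" "p3 * q3 = - \<beta>"
  proof -
    have b: "\<beta> = - (p3 * q3)" using that(2) by simp
    show ?thesis by (rule basis_orbit[OF Du]) (simp_all add: K that(1)[symmetric] b)
  qed
  \<comment> \<open>Two distinct values among 0, a, b: if one is 0, the table is \<open>K09\<close>
    or its opposite; if both are roots of the quadratic, it is \<open>K11\<close>.\<close>
  have "p3 = 0 \<or> p3 = a \<or> p3 = b" "q3 = 0 \<or> q3 = a \<or> q3 = b"
    using p3_root q3_root unfolding fac by auto
  then consider "q3 = 0" "p3 = a" | "q3 = 0" "p3 = b" | "p3 = 0" "q3 = a" | "p3 = 0" "q3 = b"
    | "p3 = a" "q3 = b" | "p3 = b" "q3 = a" using ne by auto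
  then show ?thesis
  proof cases
    case 1
    then show ?thesis using basis_orbit_closure[OF 09[of b] K09_closure] ab by simp
  next
    case 2
    then show ?thesis using basis_orbit_closure[OF 09[of a] K09_closure] ab by (simp add: algebra_simps)
  next
    case 3
    then show ?thesis using basis_orbit_closure[OF 06[of b] K09_closure] ab orbit_closure_opp(3)[of \<mu>] by simp
  next
    case 4
    then show ?thesis using basis_orbit_closure[OF 06[of a] K09_closure] ab orbit_closure_opp(3)[of \<mu>]
      by (simp add: algebra_simps)
  next
    case 5
    then show ?thesis using basis_orbit_closure[OF 11 K11_closure] ab by simp
  next
    case 6
    then show ?thesis using basis_orbit_closure[OF 11 K11_closure] ab by (simp add: algebra_simps)
  qed
qed

text \<open>The first-order part of \<open>cube_degenerate\<close> at x in direction y: p3 is a root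
  of the derivative of z^3 - \<alpha> z^2 - \<beta> z.\<close>

lemma double_root:
  assumes pq: "p3 = q3"
  shows "3 * p3^2 = 2 * \<alpha> * p3 + \<beta>"
proof -
  let ?u = "x \<cdot> y + y \<cdot> x"
  let ?n1 = "y \<cdot> (x \<cdot> x) + x \<cdot> ?u"
  let ?n2 = "y \<cdot> ?u + x \<cdot> (y \<cdot> y)"
  have s: "sq \<mu> (x + t *s y) = x \<cdot> x + t *s ?u + t^2 *s (y \<cdot> y)" for t
    by (simp add: mult_simps vec_eq_iff algebra_simps power2_eq_square)
  have "(x + t *s y) \<cdot> sq \<mu> (x + t *s y)
      = x \<cdot> (x \<cdot> x) + t *s ?n1 + t^2 *s ?n2 + t^3 *s (y \<cdot> (y \<cdot> y))" for t
    unfolding s by (simp add: mult_simps vec_eq_iff algebra_simps power2_eq_square power3_eq_cube)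
  then have "det3 (x + t *s y) (x \<cdot> x + t *s ?u + t^2 *s (y \<cdot> y))
      (x \<cdot> (x \<cdot> x) + t *s ?n1 + t^2 *s ?n2 + t^3 *s (y \<cdot> (y \<cdot> y))) = 0" for t
    using deg s unfolding cube_degenerate_def by metis
  from det3_derivative_zero[OF this]
  have d: "det3 y (x \<cdot> x) (x \<cdot> (x \<cdot> x)) + det3 x ?u (x \<cdot> (x \<cdot> x)) + \<phi> ?n1 = 0" .
  have 1: "det3 y (x \<cdot> x) (x \<cdot> (x \<cdot> x)) = - \<beta> * \<phi> y"
    unfolding x3 by (simp add: det3_def algebra_simps)
  have "det3 x ?u (x \<cdot> (x \<cdot> x)) = - \<alpha> * \<phi> ?u"
    unfolding x3 by (simp add: det3_def algebra_simps)
  also have "\<phi> ?u = 2 * p3 * \<phi> y" unfolding det3_third \<phi>L \<phi>R pq by (simp add: algebra_simps)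
  finally have 2: "det3 x ?u (x \<cdot> (x \<cdot> x)) = - \<alpha> * (2 * p3 * \<phi> y)" .
  have "\<phi> ?n1 = \<phi> (y \<cdot> x \<cdot> x + x \<cdot> ?u)" by (simp add: AS)
  also have "\<dots> = 3 * p3^2 * \<phi> y"
    unfolding det3_third \<phi>L \<phi>R pq by (simp add: algebra_simps power2_eq_square)
  finally have 3: "\<phi> ?n1 = 3 * p3^2 * \<phi> y" .
  have "(3 * p3^2 - (2 * \<alpha> * p3 + \<beta>)) * \<phi> y = 0"
    using d unfolding 1 2 3 by (simp add: algebra_simps)
  then show ?thesis using D by simp
qed

end

subsection \<open>Associative algebras whose left and right traces agree\<close>

context assoc_basis
begin

text \<open>Here z (z - c)^2 annihilates x, so a polynomial f in x is a unit for the powers of x;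
  replacing y by f y f makes it the unit of the algebra.\<close>

lemma unital_case:
  assumes tr: "\<And>z. trace (LM \<mu> z) = trace (RM \<mu> z)"
    and c: "p3 = c" "q3 = c" "c \<noteq> 0" and ab: "\<alpha> = 2 * c" "\<beta> = - (c^2)"
  shows "\<mu> \<in> orbit_closure S11"
proof -
  note x3 = x3[unfolded ab]
  define f where "f = (2 / c) *s x - (1 / c^2) *s (x \<cdot> x)"
  have xf: "x \<cdot> f = x" and fx: "f \<cdot> x = x"
    using c(3) by (simp_all add: f_def mult_simps AS x3 vec_eq_iff field_simps power2_eq_square)
  have ff: "f \<cdot> f = f"
  proof -
    have "f \<cdot> f = (2 / c) *s (x \<cdot> f) - (1 / c^2) *s (x \<cdot> (x \<cdot> f))"
      by (subst (1) f_def) (simp only: mult_simps AS)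
    also have "\<dots> = f" unfolding xf by (simp only: f_def)
    finally show ?thesis .
  qed
  have \<phi>f: "\<phi> (f \<cdot> w) = \<phi> w" "\<phi> (w \<cdot> f) = \<phi> w" for w
  proof -
    have "\<phi> (f \<cdot> w) = \<phi> ((2 / c) *s (x \<cdot> w) - (1 / c^2) *s (x \<cdot> (x \<cdot> w)))"
      by (simp add: f_def mult_simps AS)
    then show "\<phi> (f \<cdot> w) = \<phi> w"
      using c(3) unfolding det3_third \<phi>L c(1) by (simp add: field_simps power2_eq_square)
    have "\<phi> (w \<cdot> f) = \<phi> ((2 / c) *s (w \<cdot> x) - (1 / c^2) *s ((w \<cdot> x) \<cdot> x))"
      by (simp add: f_def mult_simps AS)
    then show "\<phi> (w \<cdot> f) = \<phi> w"
      using c(3) unfolding det3_third \<phi>R c(2) by (simp add: field_simps power2_eq_square)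
  qed
  define z where "z = f \<cdot> (y \<cdot> f)"
  have fz: "f \<cdot> z = z" and zf: "z \<cdot> f = z"
    unfolding z_def AS ff AS[of f f "y \<cdot> f", symmetric] by simp_all
  have Dz: "\<phi> z \<noteq> 0" unfolding z_def \<phi>f by (rule D)
  have c2f: "x \<cdot> x = (2 * c) *s x - c^2 *s f"
    using c(3) by (simp add: f_def vec_eq_iff field_simps power2_eq_square)
  obtain a1 a2 a3 where xz: "x \<cdot> z = a1 *s x + a2 *s (x \<cdot> x) + a3 *s z" using basis_expand[OF Dz] by metis
  obtain b1 b2 b3 where zx: "z \<cdot> x = b1 *s x + b2 *s (x \<cdot> x) + b3 *s z" using basis_expand[OF Dz] by metis
  obtain s1 s2 s3 where zz: "z \<cdot> z = s1 *s x + s2 *s (x \<cdot> x) + s3 *s z" using basis_expand[OF Dz] by metis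
  have "a3 = c" "b3 = c"
    using \<phi>L[of z] \<phi>R[of z] Dz unfolding xz zx det3_third c by simp_all
  note xz = xz[unfolded this(1)] and zx = zx[unfolded this(2)]
  have "x \<cdot> (x \<cdot> z) = (2 * c) *s (x \<cdot> z) - c^2 *s z"
    unfolding AS[of x x z, symmetric] by (subst c2f) (simp add: mult_simps fz)
  moreover have "x \<cdot> (x \<cdot> z) = a1 *s (x \<cdot> x) + a2 *s (x \<cdot> (x \<cdot> x)) + c *s (x \<cdot> z)"
    by (subst xz) (simp add: mult_simps)
  ultimately have "(- a2 * c^2 - c * a1) *s x + (a1 + c * a2) *s (x \<cdot> x) + 0 *s z = 0"
    unfolding xz x3 by (simp add: vec_eq_iff algebra_simps power2_eq_square)
  then have "a1 + c * a2 = 0" by (rule det3_coeffs_zero(2)[OF Dz])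
  then have a1: "a1 = - c * a2" by (simp add: eq_neg_iff_add_eq_0)
  have "(z \<cdot> x) \<cdot> x = (2 * c) *s (z \<cdot> x) - c^2 *s z"
    unfolding AS[of z x x] by (subst c2f) (simp add: mult_simps zf)
  moreover have "(z \<cdot> x) \<cdot> x = b1 *s (x \<cdot> x) + b2 *s (x \<cdot> (x \<cdot> x)) + c *s (z \<cdot> x)"
    by (subst zx) (simp add: mult_simps AS)
  ultimately have "(- b2 * c^2 - c * b1) *s x + (b1 + c * b2) *s (x \<cdot> x) + 0 *s z = 0"
    unfolding zx x3 by (simp add: vec_eq_iff algebra_simps power2_eq_square)
  then have "b1 + c * b2 = 0" by (rule det3_coeffs_zero(2)[OF Dz])
  then have b1: "b1 = - c * b2" by (simp add: eq_neg_iff_add_eq_0)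
  note xz = xz[unfolded a1] and zx = zx[unfolded b1]
  have zxx: "z \<cdot> (x \<cdot> x) = (- 2 * c^2 * b2) *s x + (2 * c * b2) *s (x \<cdot> x) + c^2 *s z"
    unfolding AS[symmetric] zx
    by (simp add: mult_simps zx AS x3 vec_eq_iff algebra_simps power2_eq_square)
  have xxz: "(x \<cdot> x) \<cdot> z = (- 2 * c^2 * a2) *s x + (2 * c * a2) *s (x \<cdot> x) + c^2 *s z"
    unfolding AS xz
    by (simp add: mult_simps xz AS x3 vec_eq_iff algebra_simps power2_eq_square)
  have "trace (LM \<mu> z) = - c * b2 + 2 * c * b2 + s3"
    by (rule trace_LM_basis[OF Dz zx zxx zz])
  moreover have "trace (RM \<mu> z) = - c * a2 + 2 * c * a2 + s3"
    by (rule trace_RM_basis[OF Dz xz xxz zz])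
  ultimately have "- c * b2 + 2 * c * b2 + s3 = - c * a2 + 2 * c * a2 + s3"
    using tr[of z] by (simp only:)
  then have b2: "b2 = a2" using c(3) by auto
  \<comment> \<open>By the equality of traces x z and z x are both c z + a2 (x^2 - c x); subtracting
    a multiple of the unit turns z into an eigenvector.\<close>
  define w where "w = z - (a2 * c) *s f"
  have \<phi>0: "\<phi> f = 0" unfolding f_def det3_third by simp
  have Dw: "\<phi> w \<noteq> 0" unfolding w_def det3_third \<phi>0 using Dz by simp
  have cf: "c^2 *s f = (2 * c) *s x - x \<cdot> x" using c2f by simp
  have cw: "c *s w = c *s z - (2 * c * a2) *s x + a2 *s (x \<cdot> x)"
  proof -
    have "c *s w = c *s z - a2 *s (c^2 *s f)"
      by (simp add: w_def vec_eq_iff algebra_simps power2_eq_square)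
    also have "\<dots> = c *s z - (2 * c * a2) *s x + a2 *s (x \<cdot> x)"
      unfolding cf by (simp add: vec_eq_iff algebra_simps)
    finally show ?thesis .
  qed
  have xw: "x \<cdot> w = c *s w"
    unfolding cw by (simp add: w_def mult_simps xf xz vec_eq_iff algebra_simps)
  have wx: "w \<cdot> x = c *s w"
    unfolding cw by (simp add: w_def mult_simps fx zx b2 vec_eq_iff algebra_simps)
  have wxx: "w \<cdot> (x \<cdot> x) = c^2 *s w"
    unfolding AS[symmetric] wx by (simp add: mult_simps wx vec_eq_iff power2_eq_square)
  obtain r1 k r where ww: "w \<cdot> w = r1 *s x + k *s (x \<cdot> x) + r *s w" using basis_expand[OF Dw] by metis
  have "x \<cdot> (w \<cdot> w) = c *s (w \<cdot> w)" unfolding AS[symmetric] xw by (simp add: mult_simps)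
  then have "(- (c^2) * k - c * r1) *s x + (r1 + c * k) *s (x \<cdot> x) + 0 *s w = 0"
    unfolding ww by (simp add: mult_simps x3 xw vec_eq_iff algebra_simps power2_eq_square)
  then have "r1 + c * k = 0" by (rule det3_coeffs_zero(2)[OF Dw])
  then have r1: "r1 = - c * k" by (simp add: eq_neg_iff_add_eq_0)
  note ww = ww[unfolded r1]
  \<comment> \<open>The dependence of the powers of x + t w, with t^2 and the basis determinant
    cancelled; comparing coefficients in t gives r = k = 0.\<close>
  have E: "c * r + (r^2 - c^2 * k) * t - c * r * k * t^2 = 0" if t: "t \<noteq> 0" for t
  proof -
    let ?z = "x + t *s w"
    have z1: "?z = 1 *s x + 0 *s (x \<cdot> x) + t *s w" by simp
    have z2: "sq \<mu> ?z = (- (t^2 * k * c)) *s x + (1 + t^2 * k) *s (x \<cdot> x) + (2 * c * t + t^2 * r) *s w"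
      by (simp add: mult_simps xw wx ww vec_eq_iff algebra_simps power2_eq_square)
    have z3: "?z \<cdot> sq \<mu> ?z = (- (c^2) - c * k * (3 * c * t^2 + t^3 * r)) *s x
        + (2 * c + k * (3 * c * t^2 + t^3 * r)) *s (x \<cdot> x) + (3 * c^2 * t + 3 * c * t^2 * r + t^3 * r^2) *s w"
      unfolding z2 by (simp add: mult_simps x3 xw wx wxx ww vec_eq_iff algebra_simps power2_eq_square power3_eq_cube)
    have "det3 ?z (sq \<mu> ?z) (?z \<cdot> sq \<mu> ?z) = 0" using deg unfolding cube_degenerate_def by blast
    then have "t^2 * (c * r + (r^2 - c^2 * k) * t - c * r * k * t^2) * \<phi> w = 0"
      unfolding z3 unfolding z2 unfolding z1 det3_lincomb by (simp add: algebra_simps power2_eq_square power3_eq_cube)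
    then show ?thesis using Dw t by simp
  qed
  have "c * r + (r^2 - c^2 * k) - c * r * k = 0" "c * r - (r^2 - c^2 * k) - c * r * k = 0"
    "c * r + 2 * (r^2 - c^2 * k) - 4 * (c * r * k) = 0"
    using E[of 1] E[of "-1"] E[of 2] by (simp_all add: algebra_simps)
  then have "c * r = 0" by algebra
  then have r: "r = 0" using c(3) by simp
  have "c^2 * k = 0" using E[of 1] unfolding r by simp
  then have k: "k = 0" using c(3) by simp
  have "K11 c c \<in> orbit \<mu>"
    by (rule basis_orbit[OF Dw])
      (simp_all add: K11_def mult_simps AS x3 xw wx wxx ww r k vec_eq_iff algebra_simps power2_eq_square)
  then show ?thesis using K11_closure by (rule basis_orbit_closure)
qed

text \<open>Now x^3 = \<alpha> x^2, f is the idempotent multiple of x^2, and z is the Peirce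
  component (1 - f) y (1 - f). Equal traces make x and z commute.\<close>

lemma idempotent_case:
  assumes tr: "\<And>z. trace (LM \<mu> z) = trace (RM \<mu> z)"
    and c: "p3 = 0" "q3 = 0" and ab: "\<alpha> \<noteq> 0" "\<beta> = 0"
  shows "\<mu> \<in> orbit_closure S09"
proof -
  have x3: "x \<cdot> (x \<cdot> x) = \<alpha> *s (x \<cdot> x)" using x3 ab(2) by simp
  define f where "f = (1 / \<alpha>^2) *s (x \<cdot> x)"
  have xf: "x \<cdot> f = (1 / \<alpha>) *s (x \<cdot> x)" and fx: "f \<cdot> x = (1 / \<alpha>) *s (x \<cdot> x)"
    using ab(1) by (simp_all add: f_def mult_simps AS x3 vec_eq_iff field_simps power2_eq_square)
  have xx: "x \<cdot> x = \<alpha>^2 *s f" using ab(1) by (simp add: f_def)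
  have ff: "f \<cdot> f = f"
    using ab(1) by (simp add: f_def mult_simps AS x3 vec_eq_iff field_simps power2_eq_square)
  have ffw: "f \<cdot> (f \<cdot> w) = f \<cdot> w" for w unfolding AS[symmetric] ff ..
  have \<phi>f: "\<phi> (f \<cdot> w) = 0" "\<phi> (w \<cdot> f) = 0" for w
  proof -
    have "\<phi> (f \<cdot> w) = \<phi> ((1 / \<alpha>^2) *s (x \<cdot> (x \<cdot> w)))" by (simp add: f_def mult_simps AS)
    then show "\<phi> (f \<cdot> w) = 0" unfolding det3_third \<phi>L c(1) by simp
    have "\<phi> (w \<cdot> f) = \<phi> ((1 / \<alpha>^2) *s ((w \<cdot> x) \<cdot> x))" by (simp add: f_def mult_simps AS)
    then show "\<phi> (w \<cdot> f) = 0" unfolding det3_third \<phi>R c(2) by simp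
  qed
  define z where "z = y - f \<cdot> y - y \<cdot> f + f \<cdot> (y \<cdot> f)"
  have fz: "f \<cdot> z = 0" and zf: "z \<cdot> f = 0"
    by (simp_all add: z_def mult_simps AS ff ffw)
  have Dz: "\<phi> z \<noteq> 0" unfolding z_def det3_third \<phi>f using D by simp
  have xxz: "(x \<cdot> x) \<cdot> z = 0" and zxx: "z \<cdot> (x \<cdot> x) = 0"
    unfolding xx by (simp_all add: mult_simps fz zf)
  have xxz': "x \<cdot> (x \<cdot> z) = 0" and zxx': "(z \<cdot> x) \<cdot> x = 0"
    using xxz zxx by (simp_all add: AS)
  obtain a1 a2 a3 where xz: "x \<cdot> z = a1 *s x + a2 *s (x \<cdot> x) + a3 *s z" using basis_expand[OF Dz] by metis
  obtain b1 b2 b3 where zx: "z \<cdot> x = b1 *s x + b2 *s (x \<cdot> x) + b3 *s z" using basis_expand[OF Dz] by metis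
  obtain s1 k r where zz: "z \<cdot> z = s1 *s x + k *s (x \<cdot> x) + r *s z" using basis_expand[OF Dz] by metis
  have "a3 = 0" "b3 = 0"
    using \<phi>L[of z] \<phi>R[of z] Dz unfolding xz zx det3_third c by simp_all
  note xz = xz[unfolded this(1)] and zx = zx[unfolded this(2)]
  have "0 *s x + (a1 + \<alpha> * a2) *s (x \<cdot> x) + 0 *s z = 0"
    using xxz' unfolding xz by (simp add: mult_simps x3 vec_eq_iff algebra_simps)
  then have "a1 + \<alpha> * a2 = 0" by (rule det3_coeffs_zero(2)[OF Dz])
  then have a1: "a1 = - \<alpha> * a2" by (simp add: eq_neg_iff_add_eq_0)
  have "0 *s x + (b1 + \<alpha> * b2) *s (x \<cdot> x) + 0 *s z = 0"
    using zxx' unfolding zx by (simp add: mult_simps AS x3 vec_eq_iff algebra_simps)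
  then have "b1 + \<alpha> * b2 = 0" by (rule det3_coeffs_zero(2)[OF Dz])
  then have b1: "b1 = - \<alpha> * b2" by (simp add: eq_neg_iff_add_eq_0)
  note xz = xz[unfolded a1] and zx = zx[unfolded b1]
  have "trace (LM \<mu> z) = - \<alpha> * b2 + 0 + r"
    by (rule trace_LM_basis[OF Dz zx _ zz, of 0 _ 0]) (simp add: zxx)
  moreover have "trace (RM \<mu> z) = - \<alpha> * a2 + 0 + r"
    by (rule trace_RM_basis[OF Dz xz _ zz, of 0 _ 0]) (simp add: xxz)
  ultimately have "- \<alpha> * b2 + 0 + r = - \<alpha> * a2 + 0 + r" using tr[of z] by (simp only:)
  then have b2: "b2 = a2" using ab(1) by auto
  define m where "m = a2"
  note xz = xz[folded m_def] and zx = zx[unfolded b2, folded m_def]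
  have "(x \<cdot> x) \<cdot> (z \<cdot> z) = ((x \<cdot> x) \<cdot> z) \<cdot> z" by (simp only: AS)
  also have "\<dots> = 0" unfolding xxz mult_zero_left ..
  finally have "(x \<cdot> x) \<cdot> (z \<cdot> z) = 0" .
  then have "0 *s x + (\<alpha> * (s1 + \<alpha> * k)) *s (x \<cdot> x) + 0 *s z = 0"
    unfolding zz by (simp add: mult_simps AS x3 xxz' vec_eq_iff algebra_simps)
  then have "\<alpha> * (s1 + \<alpha> * k) = 0" by (rule det3_coeffs_zero(2)[OF Dz])
  then have "s1 + \<alpha> * k = 0" using ab(1) by simp
  then have s1: "s1 = - \<alpha> * k" by (simp add: eq_neg_iff_add_eq_0)
  note zz = zz[unfolded s1]
  have "x \<cdot> (z \<cdot> z) = (x \<cdot> z) \<cdot> z" by (simp add: AS)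
  also have "(x \<cdot> z) \<cdot> z = (\<alpha> * \<alpha> * m * m) *s x + (- \<alpha> * m * m) *s (x \<cdot> x) + 0 *s z"
    by (subst xz) (simp add: mult_simps xxz xz vec_eq_iff algebra_simps)
  also have "x \<cdot> (z \<cdot> z) = (- \<alpha> * r * m) *s x + (r * m) *s (x \<cdot> x) + 0 *s z"
    unfolding zz by (simp add: mult_simps x3 xz vec_eq_iff algebra_simps)
  finally have "(- \<alpha> * r * m - \<alpha> * \<alpha> * m * m) *s x + (r * m + \<alpha> * m * m) *s (x \<cdot> x) + 0 *s z = 0"
    by (simp add: vec_eq_iff algebra_simps)
  then have "r * m + \<alpha> * m * m = 0" by (rule det3_coeffs_zero(2)[OF Dz])
  then have rm: "r * m = - (\<alpha> * m * m)" by (simp add: eq_neg_iff_add_eq_0)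
  \<comment> \<open>The essential factor of the determinant of the powers of x + t z; splitting it
    off in \<open>E\<close> uses the relation \<open>rm\<close>. The other factor is a nonzero
    polynomial, so \<open>Q\<close> vanishes identically.\<close>
  define Q where "Q t = r + 2 * \<alpha> * m + t * (\<alpha> * k - r * m) + t^2 * (k * \<alpha> * m)" for t
  have E: "Q t * (t^2 * (t * r - \<alpha>)) = 0" for t
  proof -
    let ?z = "x + t *s z"
    define A where "A = 2 * t * m + t^2 * k"
    define B where "B = t^2 * r * m - \<alpha> * m * t * A + t^3 * r * k"
    have z1: "?z = 1 *s x + 0 *s (x \<cdot> x) + t *s z" by simp
    have z2: "sq \<mu> ?z = (- \<alpha> * A) *s x + (1 + A) *s (x \<cdot> x) + (t^2 * r) *s z"
      by (simp add: A_def mult_simps xz zx zz vec_eq_iff algebra_simps power2_eq_square)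
    have z3: "?z \<cdot> sq \<mu> ?z = (- \<alpha> * B) *s x + (\<alpha> + B) *s (x \<cdot> x) + (t^3 * r^2) *s z"
      unfolding z2 B_def
      by (simp add: mult_simps x3 xz zx zxx zz vec_eq_iff algebra_simps power2_eq_square power3_eq_cube)
    have "det3 ?z (sq \<mu> ?z) (?z \<cdot> sq \<mu> ?z) = 0" using deg unfolding cube_degenerate_def by blast
    then have "((1 + A) * t^3 * r^2 - t^2 * r * (\<alpha> + B) + t * \<alpha> * (B - \<alpha> * A)) * \<phi> z = 0"
      unfolding z3 unfolding z2 unfolding z1 det3_lincomb by (simp add: algebra_simps)
    then have 0: "(1 + A) * t^3 * r^2 - t^2 * r * (\<alpha> + B) + t * \<alpha> * (B - \<alpha> * A) = 0" using Dz by simp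
    have "Q t * (t^2 * (t * r - \<alpha>)) = (1 + A) * t^3 * r^2 - t^2 * r * (\<alpha> + B) + t * \<alpha> * (B - \<alpha> * A)"
      using rm unfolding Q_def A_def B_def by algebra
    then show ?thesis using 0 by simp
  qed
  have pQ: "pfun Q" unfolding Q_def by (intro pfun_intros)
  have pg: "pfun (\<lambda>t. t^2 * (t * r - \<alpha>))" by (intro pfun_intros)
  have "\<exists>u. u^2 * (u * r - \<alpha>) \<noteq> 0"
  proof (cases "r = \<alpha>")
    case True
    then show ?thesis using ab(1) by (intro exI[of _ "-1"]) simp
  next
    case False
    then show ?thesis by (intro exI[of _ 1]) simp
  qed
  then have Q: "Q t = 0" for t using pfun_mult_eq_zero[OF pQ pg E] by blast
  have e1: "r + 2 * \<alpha> * m = 0" using Q[of 0] unfolding Q_def by simp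
  have e2: "\<alpha> * k - r * m = 0" "k * \<alpha> * m = 0"
    using Q[of 1] Q[of "-1"] e1 unfolding Q_def by (simp_all, algebra+)
  have "\<alpha> * (m * m) = 0" using e1 rm by algebra
  then have m: "m = 0" using ab(1) by simp
  have r: "r = 0" using e1 m by simp
  have k: "k = 0" using e2(1) ab(1) m by simp
  have "K09 0 \<alpha> \<in> orbit \<mu>"
    by (rule basis_orbit[OF Dz])
      (simp_all add: K09_def mult_simps AS x3 xz zx zxx zz r k m vec_eq_iff algebra_simps power2_eq_square)
  then show ?thesis using K09_closure by (rule basis_orbit_closure)
qed

lemma nilpotent_case:
  assumes tr: "\<And>z. trace (LM \<mu> z) = trace (RM \<mu> z)"
    and c: "p3 = 0" "q3 = 0" and ab: "\<alpha> = 0" "\<beta> = 0"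
  shows "\<mu> \<in> orbit_closure S11"
proof -
  have x3: "x \<cdot> (x \<cdot> x) = 0" using x3 ab by simp
  have xy: "x \<cdot> y = p1 *s x + p2 *s (x \<cdot> x) + 0 *s y" and yx: "y \<cdot> x = q1 *s x + q2 *s (x \<cdot> x) + 0 *s y"
    using xy yx c by simp_all
  obtain r1 r2 r3 where yy: "y \<cdot> y = r1 *s x + r2 *s (x \<cdot> x) + r3 *s y" using basis_expand[OF D] by metis
  have yxx: "y \<cdot> (x \<cdot> x) = 0 *s x + q1 *s (x \<cdot> x) + 0 *s y"
    unfolding AS[symmetric] yx by (simp add: mult_simps AS x3)
  have xxy: "(x \<cdot> x) \<cdot> y = 0 *s x + p1 *s (x \<cdot> x) + 0 *s y"
    unfolding AS xy by (simp add: mult_simps AS x3)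
  have "trace (LM \<mu> y) = q1 + q1 + r3" by (rule trace_LM_basis[OF D yx yxx yy])
  moreover have "trace (RM \<mu> y) = p1 + p1 + r3" by (rule trace_RM_basis[OF D xy xxy yy])
  ultimately have "2 * q1 = 2 * p1" using tr[of y] by simp
  then have q1: "q1 = p1" by simp
  note yx = yx[unfolded q1] and yxx = yxx[unfolded q1]
  have "x \<cdot> (y \<cdot> y) = (x \<cdot> y) \<cdot> y" by (simp add: AS)
  also have "(x \<cdot> y) \<cdot> y = (p1 * p1) *s x + (2 * p1 * p2) *s (x \<cdot> x) + 0 *s y"
    by (subst xy) (simp add: mult_simps xxy xy vec_eq_iff algebra_simps)
  also have "x \<cdot> (y \<cdot> y) = (r3 * p1) *s x + (r1 + r3 * p2) *s (x \<cdot> x) + 0 *s y"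
    unfolding yy by (simp add: mult_simps x3 xy vec_eq_iff algebra_simps)
  finally have "(p1 * (p1 - r3)) *s x + (2 * p1 * p2 - r1 - r3 * p2) *s (x \<cdot> x) + 0 *s y = 0"
    by (simp add: vec_eq_iff algebra_simps)
  then have e1: "p1 * (p1 - r3) = 0" "2 * p1 * p2 - r1 - r3 * p2 = 0"
    using det3_coeffs_zero[OF D] by blast+
  have "(y \<cdot> y) \<cdot> x = y \<cdot> (y \<cdot> x)" by (simp add: AS)
  also have "y \<cdot> (y \<cdot> x) = (p1 * p1) *s x + (2 * p1 * q2) *s (x \<cdot> x) + 0 *s y"
    by (subst yx) (simp add: mult_simps yxx yx vec_eq_iff algebra_simps)
  also have "(y \<cdot> y) \<cdot> x = (r3 * p1) *s x + (r1 + r3 * q2) *s (x \<cdot> x) + 0 *s y"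
    unfolding yy by (simp add: mult_simps AS x3 yx vec_eq_iff algebra_simps)
  finally have "(p1 * (p1 - r3)) *s x + (2 * p1 * q2 - r1 - r3 * q2) *s (x \<cdot> x) + 0 *s y = 0"
    by (simp add: vec_eq_iff algebra_simps)
  then have e2: "2 * p1 * q2 - r1 - r3 * q2 = 0"
    using det3_coeffs_zero[OF D] by blast
  \<comment> \<open>This makes p2 + t = 1. If p1 or r3 were nonzero, the dependence of the powers of
    t x + y would force (p2 + t)^3 = 0.\<close>
  define t where "t = 1 - p2"
  let ?z = "t *s x + y"
  have z1: "?z = t *s x + 0 *s (x \<cdot> x) + 1 *s y" by simp
  have z2: "sq \<mu> ?z = (r1 + 2 * t * p1) *s x + (r2 + t * (p2 + q2) + t^2) *s (x \<cdot> x) + r3 *s y"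
    by (simp add: mult_simps xy yx yy vec_eq_iff algebra_simps power2_eq_square)
  have z3: "?z \<cdot> sq \<mu> ?z = ((r1 + 2 * t * p1) * p1 + r3 * r1 + t * r3 * p1) *s x
      + ((r1 + 2 * t * p1) * q2 + (r2 + t * (p2 + q2) + t^2) * p1 + r3 * r2 + t * (r1 + 2 * t * p1) + t * r3 * p2) *s (x \<cdot> x)
      + (r3 * r3) *s y"
    unfolding z2 by (simp add: mult_simps x3 xy yx yxx yy vec_eq_iff algebra_simps power2_eq_square)
  have "det3 ?z (sq \<mu> ?z) (?z \<cdot> sq \<mu> ?z) = 0" using deg unfolding cube_degenerate_def by blast
  then have E: "t * ((r2 + t * (p2 + q2) + t^2) * (r3 * r3) - r3 * ((r1 + 2 * t * p1) * q2 + (r2 + t * (p2 + q2) + t^2) * p1 + r3 * r2 + t * (r1 + 2 * t * p1) + t * r3 * p2))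
      + ((r1 + 2 * t * p1) * ((r1 + 2 * t * p1) * q2 + (r2 + t * (p2 + q2) + t^2) * p1 + r3 * r2 + t * (r1 + 2 * t * p1) + t * r3 * p2)
      - (r2 + t * (p2 + q2) + t^2) * ((r1 + 2 * t * p1) * p1 + r3 * r1 + t * r3 * p1)) = 0"
    unfolding z3 unfolding z2 unfolding z1 det3_lincomb using D by simp
  have p1: "p1 = 0"
  proof (rule ccontr)
    assume p: "p1 \<noteq> 0"
    then have r3: "r3 = p1" using e1(1) by simp
    have r1: "r1 = p1 * p2" using e1(2) unfolding r3 by algebra
    have "p1 * (q2 - p2) = 0" using e2 unfolding r3 r1 by algebra
    then have q2: "q2 = p2" using p by simp
    have "p1^2 * (p2 + t)^3 = 0" using E unfolding r1 r3 q2 by algebra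
    then show False using p unfolding t_def by simp
  qed
  have r3: "r3 = 0"
  proof (rule ccontr)
    assume r3: "r3 \<noteq> 0"
    have "r1 + r3 * p2 = - (2 * p1 * p2 - r1 - r3 * p2)" unfolding p1 by simp
    then have r1: "r1 = - r3 * p2" unfolding e1(2) by (simp add: eq_neg_iff_add_eq_0)
    have "r3 * (p2 - q2) = 0" using e2 unfolding p1 r1 by (simp add: algebra_simps)
    then have q2: "q2 = p2" using r3 by simp
    have "r3^2 * (p2 + t)^3 = 0" using E unfolding p1 r1 q2
      by (simp add: algebra_simps power2_eq_square power3_eq_cube)
    then show False using r3 unfolding t_def by simp
  qed
  have r1: "r1 = 0" using e1(2) unfolding p1 r3 by simp
  have "det3 x y (x \<cdot> x) = - \<phi> y" by (simp add: det3_def algebra_simps)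
  then have "det3 x y (x \<cdot> x) \<noteq> 0" using D by simp
  then have "Nil 1 p2 q2 r2 \<in> orbit \<mu>"
    by (rule basis_orbit)
      (simp_all add: Nil_def mult_simps AS x3 xy yx yxx yy p1 r1 r3)
  then show ?thesis using Nil_closure by (rule basis_orbit_closure)
qed

text \<open>A common root of z^3 - \<alpha> z^2 - \<beta> z and its derivative is either 0, with
  \<beta> = 0, or a nonzero c with \<alpha> = 2 c and \<beta> = - c^2.\<close>

lemma equal_traces:
  assumes tr: "\<And>z. trace (LM \<mu> z) = trace (RM \<mu> z)"
  shows "\<mu> \<in> orbit_closure S09 \<union> orbit_closure S11"
proof -
  have pq: "p3 = q3" using tr[of x] trace_x by simp
  have d: "3 * p3^2 = 2 * \<alpha> * p3 + \<beta>" by (rule double_root[OF pq])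
  show ?thesis
  proof (cases "p3 = 0")
    case True
    then have b: "\<beta> = 0" using d by simp
    have q: "q3 = 0" using True pq by simp
    show ?thesis
    proof (cases "\<alpha> = 0")
      case a: True
      show ?thesis using nilpotent_case[OF tr True q a b] by (rule UnI2)
    next
      case False
      show ?thesis using idempotent_case[OF tr True q False b] by (rule UnI1)
    qed
  next
    case False
    then have "p3^2 - \<alpha> * p3 - \<beta> = 0" using p3_root by simp
    then have "p3 * (2 * p3 - \<alpha>) = 0" using d by algebra
    then have a: "\<alpha> = 2 * p3" using False by simp
    have b: "\<beta> = - (p3^2)" using d unfolding a by algebra
    show ?thesis using unital_case[OF tr refl pq[symmetric] False a b] by (rule UnI2)
  qed
qed

end

subsection \<open>The orbit closures cover the variety\<close>

lemma zero_cube_associator: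
  assumes V: "\<mu> \<in> semi_alternative" and n: "\<And>x. nn \<mu> x = 0"
  shows "\<mu> \<in> orbit_closure A07 \<union> orbit_closure S03 \<union> orbit_closure S06 \<union> orbit_closure S09
    \<union> orbit_closure S11 \<union> orbit_closure S12 \<union> orbit_closure S13"
proof (cases "cube_degenerate \<mu>")
  case False
  then show ?thesis using cyclic_orbit_closure[OF V n] unfolding cube_degenerate_def by blast
next
  case deg: True
  show ?thesis
  proof (cases "\<forall>x. \<exists>k. sq \<mu> x = k *s x")
    case True
    then show ?thesis using proportional_squares[OF V] by blast
  next
    case False
    then obtain x where x: "\<And>k. sq \<mu> x \<noteq> k *s x" by blast
    then have "x \<noteq> 0" by (auto simp: mult_simps)
    then obtain y where D: "det3 x (sq \<mu> x) y \<noteq> 0" using det3_eq_0_all'[OF _ x] by blast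
    note AS = associative[OF V n D]
    have basis: "\<exists>\<alpha> \<beta> p1 p2 p3 q1 q2 q3. assoc_basis \<mu> z w \<alpha> \<beta> p1 p2 p3 q1 q2 q3"
      if Dz: "det3 z (sq \<mu> z) w \<noteq> 0" for z w
    proof -
      have "det3 z (sq \<mu> z) (mult \<mu> z (sq \<mu> z)) = 0" using deg unfolding cube_degenerate_def by blast
      then obtain \<alpha> \<beta> where "mult \<mu> z (sq \<mu> z) = \<beta> *s z + \<alpha> *s sq \<mu> z"
        using det3_eq_0_span[OF Dz] by metis
      moreover obtain p1 p2 p3 where "mult \<mu> z w = p1 *s z + p2 *s sq \<mu> z + p3 *s w"
        using basis_expand[OF Dz] by metis
      moreover obtain q1 q2 q3 where "mult \<mu> w z = q1 *s z + q2 *s sq \<mu> z + q3 *s w"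
        using basis_expand[OF Dz] by metis
      ultimately show ?thesis using AS deg Dz unfolding assoc_basis_def by blast
    qed
    show ?thesis
    proof (cases "\<forall>z. trace (LM \<mu> z) = trace (RM \<mu> z)")
      case True
      then show ?thesis using basis[OF D] assoc_basis.equal_traces by fastforce
    next
      case False
      then obtain v where v: "trace (LM \<mu> v) \<noteq> trace (RM \<mu> v)" by blast
      \<comment> \<open>A point of the line x + t v is needed where the basis determinant
        \<open>P\<close> and the trace difference \<open>T\<close> are both nonzero.
        \<open>T\<close> is linear and nonzero at v, hence not zero on the whole line.\<close>
      define T where "T z = trace (LM \<mu> z) - trace (RM \<mu> z)" for z
      define P where "P t = det3 (x + t *s v) (sq \<mu> (x + t *s v)) y" for t
      have pT: "pfun (\<lambda>t. T (x + t *s v))"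
        unfolding T_def trace_def LM_def RM_def by (simp add: mult_simps) (intro pfun_intros)
      have pP: "pfun P"
        unfolding P_def det3_def by (simp add: mult_simps) (intro pfun_intros)
      have "\<exists>t. P t \<noteq> 0 \<and> T (x + t *s v) \<noteq> 0"
      proof (rule ccontr)
        assume "\<not> ?thesis"
        then have "T (x + t *s v) * P t = 0" for t by auto
        moreover have "P 0 \<noteq> 0" using D by (simp add: P_def)
        ultimately have z: "T (x + t *s v) = 0" for t using pfun_mult_eq_zero[OF pT pP] by blast
        have "T (x + 1 *s v) - T (x + 0 *s v) = T v"
          by (simp add: T_def trace_def LM_def RM_def mult_simps sum.distrib sum_subtractf algebra_simps)
        then show False using v z[of 1] z[of 0] by (simp add: T_def)
      qed
      then obtain t where t: "P t \<noteq> 0" "T (x + t *s v) \<noteq> 0" by blast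
      obtain \<alpha> \<beta> p1 p2 p3 q1 q2 q3 where B: "assoc_basis \<mu> (x + t *s v) y \<alpha> \<beta> p1 p2 p3 q1 q2 q3"
        using basis t(1) unfolding P_def by blast
      have "p3 \<noteq> q3" using t(2) assoc_basis.trace_x[OF B] unfolding T_def by auto
      then show ?thesis using assoc_basis.distinct_eigenvalues[OF B] by blast
    qed
  qed
qed

lemma semi_alternative_covered:
  assumes "\<mu> \<in> semi_alternative"
  shows "\<mu> \<in> orbit_closure A07 \<union> orbit_closure S03 \<union> orbit_closure S06 \<union> orbit_closure S09
    \<union> orbit_closure S11 \<union> orbit_closure S12 \<union> orbit_closure S13"
proof (cases "\<exists>x. nn \<mu> x \<noteq> 0")
  case True
  then obtain x where "nn \<mu> x \<noteq> 0" by blast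
  from nonzero_cube_associator[OF assms this] show ?thesis
    using orbit_subset_closure by blast
next
  case False
  then show ?thesis using zero_cube_associator[OF assms] by blast
qed

subsection \<open>Open orbits\<close>

lemma semi_alternativeI:
  assumes "\<forall>i j k. associator \<mu> (e i) (e j) (e k) = associator \<mu> (e j) (e k) (e i)"
  shows "\<mu> \<in> semi_alternative"
  unfolding semi_alternative_def
proof (intro CollectI allI)
  fix x y z
  have 1: "associator \<mu> x (e j) (e k) = associator \<mu> (e j) (e k) x" for x j k
    by (subst (1 2) vec_expand[of x])
      (simp only: associator_simps assms[rule_format, of 1 j k] assms[rule_format, of 2 j k]
        assms[rule_format, of 3 j k])
  have 2: "associator \<mu> x y (e k) = associator \<mu> y (e k) x" for x y k
    by (subst (1 2) vec_expand[of y])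
      (simp only: associator_simps 1[of x 1 k] 1[of x 2 k] 1[of x 3 k])
  show "associator \<mu> x y z = associator \<mu> y z x"
    by (subst (1 2) vec_expand[of z])
      (simp only: associator_simps 2[of x y 1] 2[of x y 2] 2[of x y 3])
qed

lemmas assoc_table_simps = associator_def mult_nth sum_3 vec_eq_iff forall_3 e_nth vector_3

lemma representatives_semi_alternative:
  "A07 \<in> semi_alternative" "S03 \<in> semi_alternative" "S06 \<in> semi_alternative" "S09 \<in> semi_alternative"
  "S11 \<in> semi_alternative" "S12 \<in> semi_alternative" "S13 \<in> semi_alternative"
proof -
  show "A07 \<in> semi_alternative"
    by (rule semi_alternativeI) (simp add: A07_def assoc_table_simps)
  show "S03 \<in> semi_alternative"
    by (rule semi_alternativeI) (simp add: S03_def assoc_table_simps)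
  show 09: "S09 \<in> semi_alternative"
    by (rule semi_alternativeI) (simp add: S09_def assoc_table_simps)
  show "S11 \<in> semi_alternative"
    by (rule semi_alternativeI) (simp add: S11_def assoc_table_simps)
  show 12: "S12 \<in> semi_alternative"
    by (rule semi_alternativeI) (simp add: S12_def assoc_table_simps)
  show "S06 \<in> semi_alternative" "S13 \<in> semi_alternative"
    using 09 12 opp_semi_alternative opp_S09 opp_S12 by metis+
qed

text \<open>The orbit is the union of all translates of the nonvanishing set of \<open>f\<close>,
  cut with the variety; invariance of \<open>f\<close> is not asked for.\<close>

lemma openin_orbitI:
  assumes V: "\<kappa> \<in> semi_alternative" and f: "polynomial_fun f" "f \<kappa> \<noteq> 0"
    and *: "\<And>\<mu>. \<mu> \<in> semi_alternative \<Longrightarrow> f \<mu> \<noteq> 0 \<Longrightarrow> \<mu> \<in> orbit \<kappa>"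
  shows "openin semi_alternative_variety (orbit \<kappa>)"
proof -
  define U where "U = (\<Union>g\<in>{g. invertible g}. {\<mu>. f (gl_act g \<mu>) \<noteq> 0})"
  have "openin zariski U" unfolding U_def
    by (rule openin_Union) (auto intro: openin_nonzero_fun[OF polynomial_fun_gl_act[OF f(1)]])
  moreover have "orbit \<kappa> = U \<inter> semi_alternative"
  proof (intro equalityI subsetI IntI)
    fix \<mu> assume "\<mu> \<in> orbit \<kappa>"
    then obtain g where g: "invertible g" "\<mu> = gl_act g \<kappa>" unfolding orbit_def by blast
    then show "\<mu> \<in> semi_alternative" using V semi_alternative_gl_act by blast
    show "\<mu> \<in> U" unfolding U_def
      using g f(2) gl_act_inverse(1)[OF g(1)] invertible_matrix_inv[OF g(1)] by force
  next
    fix \<mu> assume "\<mu> \<in> U \<inter> semi_alternative"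
    then obtain g where g: "invertible g" "f (gl_act g \<mu>) \<noteq> 0" "\<mu> \<in> semi_alternative"
      unfolding U_def by blast
    then have "gl_act g \<mu> \<in> orbit \<kappa>" using * semi_alternative_gl_act by blast
    then have "gl_act (matrix_inv g) (gl_act g \<mu>) \<in> orbit \<kappa>"
      by (rule orbit_gl_act[OF _ invertible_matrix_inv[OF g(1)]])
    then show "\<mu> \<in> orbit \<kappa>" by (simp add: gl_act_inverse(1)[OF g(1)])
  qed
  ultimately show ?thesis unfolding openin_subtopology by blast
qed

lemma polynomial_fun_det3:
  assumes "\<And>i. polynomial_fun (\<lambda>\<mu>. X \<mu> $ i)" "\<And>i. polynomial_fun (\<lambda>\<mu>. Y \<mu> $ i)"
    "\<And>i. polynomial_fun (\<lambda>\<mu>. Z \<mu> $ i)"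
  shows "polynomial_fun (\<lambda>\<mu>. det3 (X \<mu>) (Y \<mu>) (Z \<mu>))"
  unfolding det3_def by (intro polynomial_fun_intros assms)

lemma polynomial_fun_nn: "polynomial_fun (\<lambda>\<mu>. nn \<mu> x $ i)"
  unfolding nn_def vector_minus_component by (intro polynomial_fun_intros)

lemma det3_generic_basis:
  assumes "det3 x y z \<noteq> 0"
  obtains g where "invertible g" "g *v x = e 1" "g *v y = e 2" "g *v z = e 3"
    "\<And>u v w. det3 u v w = det3 x y z * det3 (g *v u) (g *v v) (g *v w)"
proof -
  obtain g where g: "invertible g" "g *v x = e 1" "g *v y = e 2" "g *v z = e 3"
    using assms by (rule basis_change)
  have "det g * det3 x y z = 1"
    using det3_matrix_vector[of g x y z] unfolding g by (simp add: det3_def e_nth)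
  then have "det3 u v w = det3 x y z * det3 (g *v u) (g *v v) (g *v w)" for u v w
    unfolding det3_matrix_vector by algebra
  then show ?thesis using that g by blast
qed

text \<open>The structure constants in the basis \<open>x\<close>, \<open>x\<^sup>2\<close>, \<open>n = x x\<^sup>2 - x\<^sup>2 x\<close> are quotients of polynomial functions,
  so that the members of an orbit can be singled out by the nonvanishing of polynomials.\<close>

lemma generic_basis_tables:
  assumes V: "\<mu> \<in> semi_alternative" and d: "det3 x (sq \<mu> x) (nn \<mu> x) \<noteq> 0"
  obtains \<nu> where "\<mu> \<in> orbit \<nu>"
    "(\<exists>a g. \<nu> = T09 a g) \<or> (\<exists>a g. \<nu> = T06 a g) \<or> (\<exists>t g. \<nu> = T11 t g) \<or> (\<exists>t. t \<noteq> 0 \<and> \<nu> = T03 t)"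
    "det3 x (mult \<mu> (nn \<mu> x) x) (nn \<mu> x) = det3 x (sq \<mu> x) (nn \<mu> x) * \<nu>$3$1$2"
    "det3 x (sq \<mu> x) (mult \<mu> x (nn \<mu> x)) = det3 x (sq \<mu> x) (nn \<mu> x) * \<nu>$1$3$3"
    "det3 x (sq \<mu> x) (mult \<mu> (nn \<mu> x) x) = det3 x (sq \<mu> x) (nn \<mu> x) * \<nu>$3$1$3"
    "det3 x (sq \<mu> x) (mult \<mu> x (sq \<mu> x)) = det3 x (sq \<mu> x) (nn \<mu> x) * \<nu>$1$2$3"
    "det3 x (sq \<mu> x) (mult \<mu> (sq \<mu> x) x) = det3 x (sq \<mu> x) (nn \<mu> x) * \<nu>$2$1$3"
    "det3 (mult \<mu> x (sq \<mu> x)) (sq \<mu> x) (nn \<mu> x) = det3 x (sq \<mu> x) (nn \<mu> x) * \<nu>$1$2$1"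
proof -
  obtain g where g: "invertible g" "g *v x = e 1" "g *v sq \<mu> x = e 2" "g *v nn \<mu> x = e 3"
    "\<And>u v w. det3 u v w = det3 x (sq \<mu> x) (nn \<mu> x) * det3 (g *v u) (g *v v) (g *v w)"
    using det3_generic_basis[OF d] by metis
  let ?\<nu> = "gl_act g \<mu>"
  have V': "?\<nu> \<in> semi_alternative" by (rule semi_alternative_gl_act[OF g(1) V])
  note p = gl_act_nth_products[OF g(1), of _ _ _ _ \<mu>]
  have 1: "?\<nu>$1$1 = e 2" unfolding p[OF g(2) g(2)] by (simp add: g)
  have 2: "?\<nu>$1$2 - ?\<nu>$2$1 = e 3"
    unfolding p[OF g(2) g(3)] p[OF g(3) g(2)]
    using g(4) by (simp add: nn_def matrix_vector_mult_diff_distrib)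
  have "?\<nu> \<in> orbit \<mu>" using g(1) unfolding orbit_def by blast
  then have 0: "\<mu> \<in> orbit ?\<nu>" by (rule orbit_sym)
  note q = p[OF g(2) g(3)] p[OF g(3) g(2)] p[OF g(2) g(4)] p[OF g(4) g(2)]
  show ?thesis
    by (rule that[OF 0 generic_tables[OF V' 1 2]])
      (subst g(5), simp add: g(2,3,4) q[symmetric] det3_def e_nth)+
qed

lemmas generic_poly_intros = polynomial_fun_det3 polynomial_fun_nn polynomial_fun_intros

text \<open>The coefficient of x^2 in n x is 0 in the three two-parameter families and - 2 t^2 in
  \<open>T03 t\<close>.\<close>

lemma openin_orbit_S03: "openin semi_alternative_variety (orbit S03)"
proof -
  let ?d = "\<lambda>\<mu>. det3 (e 1) (sq \<mu> (e 1)) (nn \<mu> (e 1))"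
  let ?f = "\<lambda>\<mu>. ?d \<mu> * det3 (e 1) (mult \<mu> (nn \<mu> (e 1)) (e 1)) (nn \<mu> (e 1))"
  show ?thesis
  proof (rule openin_orbitI[where f = ?f])
    show "polynomial_fun ?f" by (intro generic_poly_intros)
    show "?f S03 \<noteq> 0" by (simp add: S03_def nn_def det3_def mult_e mult_nth sum_3 e_nth vector_3)
  next
    fix \<mu> assume V: "\<mu> \<in> semi_alternative" and f: "?f \<mu> \<noteq> 0"
    then have "?d \<mu> \<noteq> 0" by simp
    then show "\<mu> \<in> orbit S03"
    proof (rule generic_basis_tables[OF V])
      fix \<nu> assume \<nu>: "\<mu> \<in> orbit \<nu>"
        "(\<exists>a g. \<nu> = T09 a g) \<or> (\<exists>a g. \<nu> = T06 a g) \<or> (\<exists>t g. \<nu> = T11 t g) \<or> (\<exists>t. t \<noteq> 0 \<and> \<nu> = T03 t)"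
        "det3 (e 1) (mult \<mu> (nn \<mu> (e 1)) (e 1)) (nn \<mu> (e 1)) = ?d \<mu> * \<nu>$3$1$2"
      have "\<nu>$3$1$2 \<noteq> 0" using f unfolding \<nu>(3) by simp
      then obtain t where "t \<noteq> 0" "\<nu> = T03 t"
        using \<nu>(2) by (auto simp: T09_def T06_def T11_def)
      then show ?thesis using \<nu>(1) orbit_trans T03_orbit by blast
    qed
  qed (rule representatives_semi_alternative)
qed

lemma openin_orbit_S11: "openin semi_alternative_variety (orbit S11)"
proof -
  \<comment> \<open>For this x the table of \<open>S11\<close> is \<open>T11 2 (3 / 2)\<close>. The
    test polynomial asks for nonzero distinct eigenvalues of x on n, which only \<open>T11\<close>
    allows.\<close>
  define x where "x = e 1 + 2 *s e 3"
  let ?d = "\<lambda>\<mu>. det3 x (sq \<mu> x) (nn \<mu> x)"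
  let ?l = "\<lambda>\<mu>. det3 x (sq \<mu> x) (mult \<mu> x (nn \<mu> x))"
  let ?r = "\<lambda>\<mu>. det3 x (sq \<mu> x) (mult \<mu> (nn \<mu> x) x)"
  let ?f = "\<lambda>\<mu>. ?d \<mu> * ?l \<mu> * ?r \<mu> * (?l \<mu> - ?r \<mu>)"
  show ?thesis
  proof (rule openin_orbitI[where f = ?f])
    show "polynomial_fun ?f" by (intro generic_poly_intros)
    show "?f S11 \<noteq> 0" by (simp add: x_def S11_def nn_def det3_def mult_nth sum_3 e_nth vector_3)
  next
    fix \<mu> assume V: "\<mu> \<in> semi_alternative" and f: "?f \<mu> \<noteq> 0"
    then have "?d \<mu> \<noteq> 0" by simp
    then show "\<mu> \<in> orbit S11"
    proof (rule generic_basis_tables[OF V])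
      fix \<nu> assume \<nu>: "\<mu> \<in> orbit \<nu>"
        "(\<exists>a g. \<nu> = T09 a g) \<or> (\<exists>a g. \<nu> = T06 a g) \<or> (\<exists>t g. \<nu> = T11 t g) \<or> (\<exists>t. t \<noteq> 0 \<and> \<nu> = T03 t)"
        "?l \<mu> = ?d \<mu> * \<nu>$1$3$3" "?r \<mu> = ?d \<mu> * \<nu>$3$1$3"
      have "\<nu>$1$3$3 \<noteq> 0" "\<nu>$3$1$3 \<noteq> 0" "\<nu>$1$3$3 \<noteq> \<nu>$3$1$3" using f unfolding \<nu>(3,4) by auto
      then obtain t g where "\<nu> = T11 t g" "t * g * (1 - g) \<noteq> 0"
        using \<nu>(2) by (auto simp: T09_def T06_def T11_def T03_def)
      then show ?thesis using \<nu>(1) orbit_trans T11_orbit by blast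
    qed
  qed (rule representatives_semi_alternative)
qed

lemma separating_polynomial_S09:
  obtains f where "polynomial_fun f" "f S09 \<noteq> 0"
    "\<And>\<mu>. \<mu> \<in> semi_alternative \<Longrightarrow> f \<mu> \<noteq> 0 \<Longrightarrow> \<mu> \<in> orbit S09"
proof -
  \<comment> \<open>For this x the table of \<open>S09\<close> is \<open>T09 2 (- 1 / 2)\<close>;
    coefficients 1 and 2 of \<open>e 3\<close> would give the excluded values g = 1/2 and g =
    0.\<close>
  define x where "x = e 1 + 3 *s e 3"
  let ?d = "\<lambda>\<mu>. det3 x (sq \<mu> x) (nn \<mu> x)"
  let ?l = "\<lambda>\<mu>. det3 x (sq \<mu> x) (mult \<mu> x (nn \<mu> x))"
  let ?r = "\<lambda>\<mu>. det3 x (sq \<mu> x) (mult \<mu> (nn \<mu> x) x)"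
  let ?g = "\<lambda>\<mu>. det3 x (sq \<mu> x) (mult \<mu> x (sq \<mu> x))"
  let ?h = "\<lambda>\<mu>. det3 x (sq \<mu> x) (mult \<mu> (sq \<mu> x) x)"
  let ?A = "\<lambda>\<mu>. det3 (mult \<mu> x (sq \<mu> x)) (sq \<mu> x) (nn \<mu> x)"
  \<comment> \<open>Nonzero \<open>?l\<close> excludes \<open>T06\<close>, nonzero
    \<open>?g + ?h\<close> excludes \<open>T03\<close>, where g = 1/2, and the last factor excludes
    \<open>T11\<close>, where A = - l3 m3.\<close>
  let ?f = "\<lambda>\<mu>. ?d \<mu> * ?l \<mu> * ?g \<mu> * ?h \<mu> * (?g \<mu> + ?h \<mu>) * (?l \<mu> * ?r \<mu> + ?d \<mu> * ?A \<mu>)"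
  show ?thesis
  proof (rule that[of ?f])
    show "polynomial_fun ?f" by (intro generic_poly_intros)
    show "?f S09 \<noteq> 0" by (simp add: x_def S09_def nn_def det3_def mult_nth sum_3 e_nth vector_3)
  next
    fix \<mu> assume V: "\<mu> \<in> semi_alternative" and f: "?f \<mu> \<noteq> 0"
    then have "?d \<mu> \<noteq> 0" by simp
    then show "\<mu> \<in> orbit S09"
    proof (rule generic_basis_tables[OF V])
      fix \<nu> assume \<nu>: "\<mu> \<in> orbit \<nu>"
        "(\<exists>a g. \<nu> = T09 a g) \<or> (\<exists>a g. \<nu> = T06 a g) \<or> (\<exists>t g. \<nu> = T11 t g) \<or> (\<exists>t. t \<noteq> 0 \<and> \<nu> = T03 t)"
        "?l \<mu> = ?d \<mu> * \<nu>$1$3$3" "?r \<mu> = ?d \<mu> * \<nu>$3$1$3" "?g \<mu> = ?d \<mu> * \<nu>$1$2$3"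
        "?h \<mu> = ?d \<mu> * \<nu>$2$1$3" "?A \<mu> = ?d \<mu> * \<nu>$1$2$1"
      have "?l \<mu> * ?r \<mu> + ?d \<mu> * ?A \<mu> = ?d \<mu> * ?d \<mu> * (\<nu>$1$3$3 * \<nu>$3$1$3 + \<nu>$1$2$1)"
        "?g \<mu> + ?h \<mu> = ?d \<mu> * (\<nu>$1$2$3 + \<nu>$2$1$3)"
        unfolding \<nu>(3-) by (simp_all add: algebra_simps)
      then have "\<nu>$1$3$3 \<noteq> 0" "\<nu>$1$2$3 \<noteq> 0" "\<nu>$2$1$3 \<noteq> 0" "\<nu>$1$2$3 + \<nu>$2$1$3 \<noteq> 0"
        "\<nu>$1$3$3 * \<nu>$3$1$3 + \<nu>$1$2$1 \<noteq> 0" using f unfolding \<nu>(3,5,6) by auto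
      then obtain a g where "\<nu> = T09 a g" "a * g * (1 - g) \<noteq> 0"
        using \<nu>(2) by (auto simp: T09_def T06_def T11_def T03_def algebra_simps power2_eq_square)
      then show ?thesis using \<nu>(1) orbit_trans T09_orbit by blast
    qed
  qed
qed

lemma openin_orbit_opp:
  assumes V: "opp \<kappa> \<in> semi_alternative" and f: "polynomial_fun f" "f \<kappa> \<noteq> 0"
    "\<And>\<mu>. \<mu> \<in> semi_alternative \<Longrightarrow> f \<mu> \<noteq> 0 \<Longrightarrow> \<mu> \<in> orbit \<kappa>"
  shows "openin semi_alternative_variety (orbit (opp \<kappa>))"
proof (rule openin_orbitI[OF V polynomial_fun_opp[OF f(1)]])
  show "f (opp (opp \<kappa>)) \<noteq> 0" using f(2) by simp
  fix \<mu> assume "\<mu> \<in> semi_alternative" "f (opp \<mu>) \<noteq> 0"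
  then have "opp \<mu> \<in> orbit \<kappa>" using f(3) opp_semi_alternative by blast
  then show "\<mu> \<in> orbit (opp \<kappa>)" using opp_orbit[of "opp \<mu>"] by simp
qed

section \<open>Traces and determinants of the multiplication operators\<close>

definition trL :: "alg3 \<Rightarrow> complex^3 \<Rightarrow> complex" where "trL \<mu> z = trace (LM \<mu> z)"
definition trR :: "alg3 \<Rightarrow> complex^3 \<Rightarrow> complex" where "trR \<mu> z = trace (RM \<mu> z)"
definition trL2 :: "alg3 \<Rightarrow> complex^3 \<Rightarrow> complex" where "trL2 \<mu> z = trace (LM \<mu> z ** LM \<mu> z)"
definition trR2 :: "alg3 \<Rightarrow> complex^3 \<Rightarrow> complex" where "trR2 \<mu> z = trace (RM \<mu> z ** RM \<mu> z)"
definition detL :: "alg3 \<Rightarrow> complex^3 \<Rightarrow> complex" where "detL \<mu> z = det (LM \<mu> z)"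
definition detR :: "alg3 \<Rightarrow> complex^3 \<Rightarrow> complex" where "detR \<mu> z = det (RM \<mu> z)"

lemma conjugate_square:
  "invertible (g :: complex^3^3) \<Longrightarrow>
    (g ** A ** matrix_inv g) ** (g ** A ** matrix_inv g) = g ** (A ** A) ** matrix_inv g"
  by (simp add: matrix_eq matrix_inv_mult flip: matrix_vector_mul_assoc)

lemma det_conjugate:
  assumes "invertible (g :: complex^3^3)"
  shows "det (g ** A ** matrix_inv g) = det A"
proof -
  have "det g * det (matrix_inv g) = 1"
    using det_mul[of g "matrix_inv g"] by (simp add: matrix_inv_both(1)[OF assms])
  then show ?thesis unfolding det_mul by algebra
qed

lemma invariants_gl_act:
  assumes "invertible g"
  shows "trL (gl_act g \<mu>) (g *v z) = trL \<mu> z" "trR (gl_act g \<mu>) (g *v z) = trR \<mu> z"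
    "trL2 (gl_act g \<mu>) (g *v z) = trL2 \<mu> z" "trR2 (gl_act g \<mu>) (g *v z) = trR2 \<mu> z"
    "detL (gl_act g \<mu>) (g *v z) = detL \<mu> z" "detR (gl_act g \<mu>) (g *v z) = detR \<mu> z"
  unfolding trL_def trR_def trL2_def trR2_def detL_def detR_def LM_gl_act[OF assms] RM_gl_act[OF assms]
    conjugate_square[OF assms] trace_conjugate[OF assms] det_conjugate[OF assms] by (rule refl)+

lemma invariants_polynomial:
  "polynomial_fun (\<lambda>\<mu>. trL \<mu> z)" "polynomial_fun (\<lambda>\<mu>. trR \<mu> z)"
  "polynomial_fun (\<lambda>\<mu>. trL2 \<mu> z)" "polynomial_fun (\<lambda>\<mu>. trR2 \<mu> z)"
  "polynomial_fun (\<lambda>\<mu>. detL \<mu> z)" "polynomial_fun (\<lambda>\<mu>. detR \<mu> z)"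
  unfolding trL_def trR_def trL2_def trR2_def detL_def detR_def trace_def LM_def RM_def
    matrix_matrix_mult_def det_3 sum_3 vec_lambda_beta
  by (intro polynomial_fun_intros)+

lemma invariant_on_orbit:
  assumes "\<And>z. F (trL \<kappa> z) (trR \<kappa> z) (trL2 \<kappa> z) (trR2 \<kappa> z) (detL \<kappa> z) (detR \<kappa> z) = (0::complex)"
    and "\<mu> \<in> orbit \<kappa>"
  shows "F (trL \<mu> z) (trR \<mu> z) (trL2 \<mu> z) (trR2 \<mu> z) (detL \<mu> z) (detR \<mu> z) = 0"
proof -
  obtain g where g: "invertible g" "\<mu> = gl_act g \<kappa>" using assms(2) unfolding orbit_def by blast
  show ?thesis
    using assms(1)[of "matrix_inv g *v z"] invariants_gl_act[OF g(1), of \<kappa> "matrix_inv g *v z"]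
    unfolding g(2) matrix_inv_mult(1)[OF g(1)] by simp
qed

text \<open>Invariance moves the element z along with the algebra, so a relation must hold at the
  representative for every z to persist at a fixed z.\<close>

lemma invariant_on_closure:
  assumes "\<And>z. F (trL \<kappa> z) (trR \<kappa> z) (trL2 \<kappa> z) (trR2 \<kappa> z) (detL \<kappa> z) (detR \<kappa> z) = (0::complex)"
    and "polynomial_fun (\<lambda>\<mu>. F (trL \<mu> z) (trR \<mu> z) (trL2 \<mu> z) (trR2 \<mu> z) (detL \<mu> z) (detR \<mu> z))"
    and "\<mu> \<in> orbit_closure \<kappa>"
  shows "F (trL \<mu> z) (trR \<mu> z) (trL2 \<mu> z) (trR2 \<mu> z) (detL \<mu> z) (detR \<mu> z) = 0"
  using closure_of_vanishing[OF assms(2) _ assms(3)] invariant_on_orbit[of F \<kappa> _ z, OF assms(1)] by blast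

lemmas invariant_defs = trL_def trR_def trL2_def trR2_def detL_def detR_def trace_def LM_def RM_def
    matrix_matrix_mult_def det_3 sum_3 vec_lambda_beta mult_nth e_nth vector_3

lemma invariants_A07:
  "trL A07 z = z$1 + z$2 + z$3" "trR A07 z = z$1 + z$2 + z$3"
  by (simp_all add: A07_def invariant_defs)

lemma invariants_S03:
  "trL S03 z = 4 * z$1" "trR S03 z = 4 * z$1" "trL2 S03 z = 8 * z$1^2" "trR2 S03 z = 8 * z$1^2"
  "detL S03 z = 0" "detR S03 z = 0"
  by (simp_all add: S03_def invariant_defs power2_eq_square)

lemma invariants_S09:
  "trL S09 z = 4 * z$1 + z$3" "trR S09 z = 2 * z$1 + z$3"
  "trL2 S09 z = 8 * z$1^2 + z$3^2" "trR2 S09 z = 4 * z$1^2 + z$3^2"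
  "detL S09 z = 4 * z$1^2 * z$3" "detR S09 z = 0"
  by (simp_all add: S09_def invariant_defs power2_eq_square algebra_simps)

lemma invariants_S11:
  "trL S11 z = 3 * z$3 + z$1" "trR S11 z = 3 * z$3 - z$1"
  "trL2 S11 z = 2 * (z$3 + z$1)^2 + (z$3 - z$1)^2" "trR2 S11 z = 2 * (z$3 - z$1)^2 + (z$3 + z$1)^2"
  "detL S11 z = (z$3 + z$1)^2 * (z$3 - z$1)" "detR S11 z = (z$3 - z$1)^2 * (z$3 + z$1)"
  by (simp_all add: S11_def invariant_defs power2_eq_square algebra_simps)

lemma invariants_S12:
  "trL S12 z = 6 * z$1" "trR S12 z = 2 * z$1" "trL2 S12 z = 12 * z$1^2" "trR2 S12 z = 4 * z$1^2"
  "detL S12 z = 8 * z$1^3" "detR S12 z = 0"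
  by (simp_all add: S12_def invariant_defs power2_eq_square power3_eq_cube algebra_simps)

lemma invariants_opp:
  "trL (opp \<mu>) z = trR \<mu> z" "trR (opp \<mu>) z = trL \<mu> z" "trL2 (opp \<mu>) z = trR2 \<mu> z"
  "trR2 (opp \<mu>) z = trL2 \<mu> z" "detL (opp \<mu>) z = detR \<mu> z" "detR (opp \<mu>) z = detL \<mu> z"
  unfolding trL_def trR_def trL2_def trR2_def detL_def detR_def LM_opp RM_opp by (rule refl)+

lemmas invariants_S06 = invariants_opp[of S09, unfolded opp_S09 invariants_S09]
lemmas invariants_S13 = invariants_opp[of S12, unfolded opp_S12 invariants_S12]

lemma separating_polynomial_S12:
  obtains f where "polynomial_fun f" "f S12 \<noteq> 0"
    "\<And>\<mu>. \<mu> \<in> semi_alternative \<Longrightarrow> f \<mu> \<noteq> 0 \<Longrightarrow> \<mu> \<in> orbit S12"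
proof -
  \<comment> \<open>The first two factors vanish on S09 and S06, the third on S11, and
    \<open>p\<close>, the determinant of left multiplication, on S03 and S13.\<close>
  define F1 :: "complex \<Rightarrow> complex \<Rightarrow> complex \<Rightarrow> complex \<Rightarrow> complex \<Rightarrow> complex \<Rightarrow> complex"
    where "F1 a b c d p q = ((a - b)^2 - (c - d)) * ((a - b)^2 + (c - d))
      * ((a - b) * (a + b) - 3 * (c - d)) * p" for a b c d p q
  let ?F = "\<lambda>\<mu>. F1 (trL \<mu> (e 1)) (trR \<mu> (e 1)) (trL2 \<mu> (e 1)) (trR2 \<mu> (e 1)) (detL \<mu> (e 1)) (detR \<mu> (e 1))"
  have p: "polynomial_fun ?F" unfolding F1_def by (intro polynomial_fun_intros invariants_polynomial)
  have z: "?F \<mu> = 0" if "\<mu> \<in> orbit_closure \<kappa>" "\<kappa> \<in> {S03, S06, S09, S11, S13}" for \<mu> \<kappa>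
    by (rule invariant_on_closure[where F = F1, OF _ p that(1)], insert that(2))
      (elim insertE, auto simp: F1_def invariants_S03 invariants_S06 invariants_S09 invariants_S11
        invariants_S13 power2_eq_square algebra_simps)
  show ?thesis
  proof (rule that[of "\<lambda>\<mu>. ?F \<mu> * nn \<mu> (e 1) $ 2"])
    show "polynomial_fun (\<lambda>\<mu>. ?F \<mu> * nn \<mu> (e 1) $ 2)"
      by (intro polynomial_fun.mult p polynomial_fun_nn)
    show "?F S12 * nn S12 (e 1) $ 2 \<noteq> 0"
      by (simp add: F1_def invariants_S12 e_nth nn_def mult_e) (simp add: S12_def mult_nth sum_3 e_nth)
    fix \<mu> assume V: "\<mu> \<in> semi_alternative" and f: "?F \<mu> * nn \<mu> (e 1) $ 2 \<noteq> 0"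
    have "?F \<mu> \<noteq> 0" using f by auto
    have "nn \<mu> (e 1) \<noteq> 0" using f by auto
    from nonzero_cube_associator[OF V this] show "\<mu> \<in> orbit S12"
      using z[of \<mu>] \<open>?F \<mu> \<noteq> 0\<close> orbit_subset_closure[of S13] by blast
  qed
qed

lemma openin_orbit_A07: "openin semi_alternative_variety (orbit A07)"
proof -
  \<comment> \<open>The discriminant of the characteristic polynomial of a matrix with trace s1,
    trace of the square s2 and determinant d. In each of the six other algebras all left or all
    right multiplications have a multiple eigenvalue.\<close>
  define disc :: "complex \<Rightarrow> complex \<Rightarrow> complex \<Rightarrow> complex" where
    "disc s1 s2 d = (let q = (s1^2 - s2) / 2 in s1^2 * q^2 - 4 * q^3 - 4 * s1^3 * d + 18 * s1 * q * d - 27 * d^2)"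
    for s1 s2 d
  define F where "F a b c d p q = disc a c p * disc b d q" for a b c d p q
  \<comment> \<open>Multiplication in \<open>A07\<close> is componentwise, so distinct nonzero
    coordinates give independent powers and nonzero discriminants.\<close>
  define x :: "complex^3" where "x = vector [1, 2, 3]"
  let ?F = "\<lambda>\<mu>. F (trL \<mu> x) (trR \<mu> x) (trL2 \<mu> x) (trR2 \<mu> x) (detL \<mu> x) (detR \<mu> x)"
  have p: "polynomial_fun ?F" unfolding F_def disc_def Let_def divide_inverse
    by (intro polynomial_fun_intros invariants_polynomial)
  have z: "?F \<mu> = 0" if "\<mu> \<in> orbit_closure \<kappa>" "\<kappa> \<in> {S03, S06, S09, S11, S12, S13}" for \<mu> \<kappa>
  proof (rule invariant_on_closure[where F = F, OF _ p that(1)])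
    fix z
    have 03: "disc (4 * a) (8 * a^2) 0 = 0" for a
      unfolding disc_def Let_def by (simp add: field_simps power2_eq_square power3_eq_cube)
    have 09: "disc (4 * a + c) (8 * a^2 + c^2) (4 * a^2 * c) = 0" for a c
      unfolding disc_def Let_def by (simp add: field_simps power2_eq_square power3_eq_cube)
    have 11: "disc (3 * c + a) (2 * (c + a)^2 + (c - a)^2) ((c + a)^2 * (c - a)) = 0" for a c
      unfolding disc_def Let_def by (simp add: field_simps power2_eq_square power3_eq_cube)
    have 12: "disc (2 * a) (4 * a^2) 0 = 0" for a
      unfolding disc_def Let_def by (simp add: field_simps power2_eq_square power3_eq_cube)
    show "F (trL \<kappa> z) (trR \<kappa> z) (trL2 \<kappa> z) (trR2 \<kappa> z) (detL \<kappa> z) (detR \<kappa> z) = 0"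
      using that(2)
      by (elim insertE) (auto simp: F_def invariants_S03 invariants_S06 invariants_S09 invariants_S11
        invariants_S12 invariants_S13 03 09 11 12)
  qed
  let ?D = "\<lambda>\<mu>. det3 x (sq \<mu> x) (mult \<mu> x (sq \<mu> x))"
  let ?f = "\<lambda>\<mu>. ?F \<mu> * ?D \<mu> * detL \<mu> x"
  show ?thesis
  proof (rule openin_orbitI[where f = ?f])
    show "polynomial_fun ?f" by (intro generic_poly_intros p invariants_polynomial)
    have "disc 6 14 6 \<noteq> 0" by (simp add: disc_def Let_def power2_eq_square power3_eq_cube)
    moreover have "trL A07 x = 6" "trR A07 x = 6" "trL2 A07 x = 14" "trR2 A07 x = 14" "detL A07 x = 6" "detR A07 x = 6"
      by (simp_all add: x_def A07_def invariant_defs)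
    moreover have "?D A07 \<noteq> 0" by (simp add: x_def A07_def det3_def mult_nth sum_3 e_nth)
    ultimately show "?f A07 \<noteq> 0" unfolding F_def by simp
  next
    fix \<mu> assume V: "\<mu> \<in> semi_alternative" and f: "?f \<mu> \<noteq> 0"
    have F0: "?F \<mu> \<noteq> 0" using f by auto
    have n: "nn \<mu> v = 0" for v
    proof (rule ccontr)
      assume "nn \<mu> v \<noteq> 0"
      from nonzero_cube_associator[OF V this] obtain \<kappa> where
        "\<kappa> \<in> {S03, S06, S09, S11, S12, S13}" "\<mu> \<in> orbit_closure \<kappa>"
        using orbit_subset_closure by blast
      then show False using z F0 by blast
    qed
    have "?D \<mu> \<noteq> 0" using f by auto
    then obtain g where g: "invertible g" "g *v x = e 1" "g *v sq \<mu> x = e 2" "g *v mult \<mu> x (sq \<mu> x) = e 3"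
      by (rule basis_change)
    let ?\<nu> = "gl_act g \<mu>"
    have V': "?\<nu> \<in> semi_alternative" by (rule semi_alternative_gl_act[OF g(1) V])
    have 1: "?\<nu>$1$1 = e 2" unfolding gl_act_nth_products[OF g(1) g(2) g(2)] by (simp add: g)
    have 2: "?\<nu>$1$2 = e 3" unfolding gl_act_nth_products[OF g(1) g(2) g(3)] by (simp add: g)
    have 3: "?\<nu>$2$1 = e 3" unfolding gl_act_nth_products[OF g(1) g(3) g(2)]
      using n[of x] g(4) by (simp add: nn_def)
    obtain a b c where abc: "?\<nu>$1$3$3 = a + b + c" "?\<nu>$1$3$2 = - (a * b + b * c + a * c)" "?\<nu>$1$3$1 = a * b * c"
      by (rule cubic_roots)
    have \<nu>: "?\<nu> = Tc (a + b + c) (- (a * b + b * c + a * c)) (a * b * c)"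
      using cyclic_table[OF V' 1 2 3] unfolding abc .
    have i: "trL \<mu> x = a + b + c" "trL2 \<mu> x = (a + b + c)^2 - 2 * (a * b + b * c + a * c)" "detL \<mu> x = a * b * c"
      unfolding invariants_gl_act[OF g(1), of \<mu> x, symmetric] g(2) \<nu>
      by (simp_all add: Tc_def invariant_defs algebra_simps power2_eq_square)
    have "disc (trL \<mu> x) (trL2 \<mu> x) (detL \<mu> x) = ((a - b) * (b - c) * (a - c))^2"
      unfolding i disc_def Let_def by (simp add: field_simps power2_eq_square power3_eq_cube)
    then have "a * b * c * (a - b) * (b - c) * (a - c) \<noteq> 0"
      using f i(3) unfolding F_def by auto
    then have "?\<nu> \<in> orbit A07" unfolding \<nu> by (rule Tc_orbit)
    moreover have "\<mu> \<in> orbit ?\<nu>" using g(1) orbit_sym unfolding orbit_def by blast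
    ultimately show "\<mu> \<in> orbit A07" using orbit_trans by blast
  qed (rule representatives_semi_alternative)
qed

definition representatives :: "alg3 list" where
  "representatives = [A07, S03, S12, S13, S09, S06, S11]"

lemma openin_orbit_representatives:
  assumes "\<kappa> \<in> set representatives"
  shows "openin semi_alternative_variety (orbit \<kappa>)"
proof -
  note R = representatives_semi_alternative
  have "openin semi_alternative_variety (orbit S09)"
    by (rule separating_polynomial_S09, rule openin_orbitI[OF R(4)])
  moreover have "openin semi_alternative_variety (orbit S06)"
    by (rule separating_polynomial_S09) (use openin_orbit_opp[of S09] R opp_S09 in metis)
  moreover have "openin semi_alternative_variety (orbit S12)"
    by (rule separating_polynomial_S12, rule openin_orbitI[OF R(6)])
  moreover have "openin semi_alternative_variety (orbit S13)"
    by (rule separating_polynomial_S12) (use openin_orbit_opp[of S12] R opp_S12 in metis)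
  ultimately show ?thesis
    using assms openin_orbit_A07 openin_orbit_S03 openin_orbit_S11 unfolding representatives_def by auto
qed

text \<open>Each representative satisfies a relation that fails for all later ones in the list.\<close>

lemma orbits_distinct:
  assumes "i < j" "j < 7"
  shows "orbit (representatives ! i) \<noteq> orbit (representatives ! j)"
proof
  assume eq: "orbit (representatives ! i) = orbit (representatives ! j)"
  have mem: "representatives ! j \<in> orbit (representatives ! i)" using eq orbit_refl by blast
  have comm: "mult \<mu> x y = mult \<mu> y x" if \<mu>: "\<mu> \<in> orbit A07" for \<mu> x y
  proof -
    obtain g where g: "\<mu> = gl_act g A07" using \<mu> unfolding orbit_def by blast
    show ?thesis unfolding g mult_gl_act by (simp add: vec_eq_iff mult_nth A07_def sum_3 e_nth
        matrix_vector_mult_def mult.commute mult.left_commute)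
  qed
  note inv = invariants_A07 invariants_S03 invariants_S12 invariants_S13 invariants_S09 invariants_S06 invariants_S11
  have I: "F (trL (representatives ! j) z) (trR (representatives ! j) z) (trL2 (representatives ! j) z) (trR2 (representatives ! j) z) = 0"
    if "\<And>z. F (trL (representatives ! i) z) (trR (representatives ! i) z) (trL2 (representatives ! i) z) (trR2 (representatives ! i) z) = (0::complex)" for F z
    using invariant_on_orbit[where F = "\<lambda>a b c d p q. F a b c d", OF that mem] .
  have "i \<in> {0,1,2,3,4,5}" using assms by auto
  then show False
  proof (elim insertE emptyE)
    assume i: "i = 0"
    have "j \<in> {1,2,3,4,5,6}" using assms i by auto
    moreover have "mult (representatives ! j) (e k) (e l) $ 2 = mult (representatives ! j) (e l) (e k) $ 2"
      "mult (representatives ! j) (e k) (e l) $ 3 = mult (representatives ! j) (e l) (e k) $ 3" for k l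
      using comm mem i by (simp_all add: representatives_def)
    from this(1)[of 1 2] this(2)[of 1 3] show False using calculation
      by (auto simp: representatives_def mult_e S03_def S12_def S13_def S09_def S06_def S11_def e_nth)
  next
    assume i: "i = 1"
    have "j \<in> {2,3,4,5,6}" using assms i by auto
    then show False using I[of "\<lambda>a b c d. a - b" "e 1"] i
      by (auto simp: representatives_def inv e_nth)
  next
    assume i: "i = 2"
    have "j \<in> {3,4,5,6}" using assms i by auto
    then show False using I[of "\<lambda>a b c d. a - 3 * b" "e 3"] I[of "\<lambda>a b c d. a - 3 * b" "e 1"] i
      by (auto simp: representatives_def inv e_nth)
  next
    assume i: "i = 3"
    have "j \<in> {4,5,6}" using assms i by auto
    then show False using I[of "\<lambda>a b c d. b - 3 * a" "e 3"] i
      by (auto simp: representatives_def inv e_nth)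
  next
    assume i: "i = 4"
    have "j \<in> {5,6}" using assms i by auto
    then show False using I[of "\<lambda>a b c d. (a - b)^2 - (c - d)" "e 1"] i
      by (auto simp: representatives_def inv e_nth power2_eq_square algebra_simps)
  next
    assume i: "i = 5"
    have "j = 6" using assms i by auto
    then show False using I[of "\<lambda>a b c d. (a - b)^2 + (c - d)" "e 1"] i
      by (auto simp: representatives_def inv e_nth power2_eq_square algebra_simps)
  qed
qed

subsection \<open>Irreducible subsets of the variety\<close>

lemma irreducible_in_closed_subtopology:
  assumes "closedin X V"
  shows "irreducible_in (subtopology X V) S \<longleftrightarrow> irreducible_in X S \<and> S \<subseteq> V"
proof -
  have V: "V \<subseteq> topspace X" using assms closedin_subset by blast
  show ?thesis
  proof
    assume S: "irreducible_in (subtopology X V) S"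
    then have sub: "S \<subseteq> V" "S \<subseteq> topspace X" unfolding irreducible_in_def by auto
    have "S \<subseteq> A \<or> S \<subseteq> B" if AB: "closedin X A" "closedin X B" "S \<subseteq> A \<union> B" for A B
    proof -
      have "closedin (subtopology X V) (A \<inter> V)" "closedin (subtopology X V) (B \<inter> V)"
        using AB closedin_subtopology by blast+
      moreover have "S \<subseteq> (A \<inter> V) \<union> (B \<inter> V)" using AB(3) sub by blast
      ultimately have "S \<subseteq> A \<inter> V \<or> S \<subseteq> B \<inter> V" using S unfolding irreducible_in_def by blast
      then show ?thesis by blast
    qed
    moreover have "S \<noteq> {}" using S unfolding irreducible_in_def by simp
    ultimately show "irreducible_in X S \<and> S \<subseteq> V" using sub unfolding irreducible_in_def by simp
  next
    assume S: "irreducible_in X S \<and> S \<subseteq> V"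
    have c: "closedin X A" if "closedin (subtopology X V) A" for A
      using that closedin_closed_subtopology[OF assms] by simp
    have "S \<subseteq> A \<or> S \<subseteq> B"
      if "closedin (subtopology X V) A" "closedin (subtopology X V) B" "S \<subseteq> A \<union> B" for A B
      using S c that unfolding irreducible_in_def by simp
    moreover have "S \<noteq> {}" "S \<subseteq> topspace (subtopology X V)"
      using S V unfolding irreducible_in_def by auto
    ultimately show "irreducible_in (subtopology X V) S" unfolding irreducible_in_def by simp
  qed
qed

lemma irreducible_in_finite_cover:
  assumes "finite K" "irreducible_in X S" "\<And>k. k \<in> K \<Longrightarrow> closedin X (C k)" "S \<subseteq> (\<Union>k\<in>K. C k)"
  shows "\<exists>k\<in>K. S \<subseteq> C k"
  using assms(1,3,4)
proof (induction K rule: finite_induct)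
  case empty
  then show ?case using assms(2) unfolding irreducible_in_def by auto
next
  case (insert k K)
  have "closedin X (\<Union>k\<in>K. C k)" using insert by (intro closedin_Union) auto
  then have "S \<subseteq> C k \<or> S \<subseteq> (\<Union>k\<in>K. C k)"
    using insert assms(2) unfolding irreducible_in_def by auto
  then show ?case using insert by auto
qed

lemma variety_covered: "semi_alternative = (\<Union>\<kappa>\<in>set representatives. orbit_closure \<kappa>)"
proof
  show "semi_alternative \<subseteq> (\<Union>\<kappa>\<in>set representatives. orbit_closure \<kappa>)"
    using semi_alternative_covered unfolding representatives_def by auto
  have "orbit \<kappa> \<subseteq> semi_alternative" if "\<kappa> \<in> set representatives" for \<kappa>
    using openin_subset[OF openin_orbit_representatives[OF that]] by simp
  then show "(\<Union>\<kappa>\<in>set representatives. orbit_closure \<kappa>) \<subseteq> semi_alternative"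
    using closure_of_minimal[OF _ closedin_semi_alternative] by blast
qed

lemma irreducible_subset_orbit_closure:
  assumes "irreducible_in semi_alternative_variety S"
  obtains \<kappa> where "\<kappa> \<in> set representatives" "S \<subseteq> orbit_closure \<kappa>"
proof -
  have "irreducible_in zariski S" "S \<subseteq> semi_alternative"
    using assms irreducible_in_closed_subtopology[OF closedin_semi_alternative] by blast+
  then have "\<exists>\<kappa>\<in>set representatives. S \<subseteq> orbit_closure \<kappa>"
    unfolding variety_covered by (intro irreducible_in_finite_cover[of _ zariski]) auto
  then show ?thesis using that by blast
qed

subsection \<open>The dimension is at least nine\<close>

text \<open>\<open>cyc L\<close> is the commutative multiplication for which \<open>e 1\<close> acts by the matrix \<open>L\<close>, with cyclic vector \<open>e 1\<close>;
  letting the nine entries of \<open>L\<close> vary one after the other gives the chain.\<close>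

definition krylov :: "complex^3^3 \<Rightarrow> complex^3^3" where
  "krylov L = (\<chi> i j. if j = 1 then e 1 $ i else if j = 2 then (L *v e 1) $ i else (L *v (L *v e 1)) $ i)"

text \<open>The coefficients of the characteristic polynomial of \<open>L\<close>, so that left
  multiplication by \<open>e 1\<close> in this table is its companion matrix.\<close>

definition charpoly_table :: "complex^3^3 \<Rightarrow> alg3" where
  "charpoly_table L = Tc (L$1$1 + L$2$2 + L$3$3)
     (- (L$1$1 * L$2$2 - L$1$2 * L$2$1 + L$1$1 * L$3$3 - L$1$3 * L$3$1 + L$2$2 * L$3$3 - L$2$3 * L$3$2)) (det L)"

definition cyc :: "complex^3^3 \<Rightarrow> alg3" where
  "cyc L = gl_act (krylov L) (charpoly_table L)"

lemma krylov_e: "krylov L *v e 1 = e 1" "krylov L *v e 2 = L *v e 1" "krylov L *v e 3 = L *v (L *v e 1)"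
  by (simp_all add: krylov_def vec_eq_iff matrix_vector_mult_def sum_3 e_nth forall_3)

lemma krylov_intertwines:
  "krylov L *v (mult (charpoly_table L) (e 1) v) = L *v (krylov L *v v)"
proof -
  have "krylov L *v (mult (charpoly_table L) (e 1) (e i)) = L *v (krylov L *v e i)" for i
  proof -
    consider "i = 1" | "i = 2" | "i = 3" using exhaust_3[of i] by blast
    then show ?thesis
    proof cases
      case 1
      have "mult (charpoly_table L) (e 1) (e 1) = e 2"
        by (simp add: mult_e charpoly_table_def Tc_def vec_eq_iff forall_3 e_nth)
      then show ?thesis by (simp add: 1 krylov_e)
    next
      case 2
      have "mult (charpoly_table L) (e 1) (e 2) = e 3"
        by (simp add: mult_e charpoly_table_def Tc_def vec_eq_iff forall_3 e_nth)
      then show ?thesis by (simp add: 2 krylov_e)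
    next
      case 3
      \<comment> \<open>This is the Cayley-Hamilton theorem for \<open>L\<close>, applied to \<open>e 1\<close>.\<close>
      show ?thesis
        by (simp add: 3 krylov_def mult_e charpoly_table_def Tc_def vec_eq_iff forall_3 e_nth
            matrix_vector_mult_def sum_3 det_3 algebra_simps)
    qed
  qed note * = this
  show ?thesis
    by (subst (1 2) vec_expand[of v]) (simp only: mult_simps matrix_vector_right_distrib vec.scale *)
qed

text \<open>The entries of \<open>L\<close> are structure constants of \<open>cyc L\<close>; fixing
  an entry is a closed condition on the algebra, which makes the chain strict.\<close>

lemma cyc_nth:
  assumes "det (krylov L) \<noteq> 0"
  shows "cyc L $ 1 $ j $ k = L $ k $ j"
proof -
  have i: "invertible (krylov L)" using assms by (simp add: invertible_det_nz)
  have "mult (cyc L) (e 1) (krylov L *v v) = L *v (krylov L *v v)" for v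
    using mult_gl_act_apply[OF i, of "charpoly_table L" "e 1" v]
    by (simp add: cyc_def krylov_e krylov_intertwines)
  from this[of "matrix_inv (krylov L) *v e j"] have "cyc L $ 1 $ j = L *v e j"
    by (simp add: matrix_inv_mult[OF i] mult_e)
  then show ?thesis by (simp add: matrix_vector_e column_def)
qed

lemma cyc_semi_alternative: "det (krylov L) \<noteq> 0 \<Longrightarrow> cyc L \<in> semi_alternative"
proof -
  assume "det (krylov L) \<noteq> 0"
  then have i: "invertible (krylov L)" by (simp add: invertible_det_nz)
  have "Tc p q r \<in> semi_alternative" for p q r
  proof -
    obtain a b c where "p = a + b + c" "q = - (a * b + b * c + a * c)" "r = a * b * c"
      by (rule cubic_roots)
    then show ?thesis using Tc_closure[of a b c] variety_covered by (auto simp: representatives_def)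
  qed
  then show ?thesis unfolding cyc_def charpoly_table_def using i semi_alternative_gl_act by blast
qed

definition entry :: "nat \<Rightarrow> 3 \<times> 3" where
  "entry k = [(1,1), (1,2), (1,3), (2,1), (2,2), (2,3), (3,1), (3,2), (3,3)] ! k"

text \<open>The base point of the chain: it sends \<open>e 1\<close> to \<open>e 2\<close> to
  \<open>e 3\<close>, so its Krylov matrix is the identity.\<close>

definition shift_matrix :: "complex^3^3" where
  "shift_matrix = vector [vector [0,0,0], vector [1,0,0], vector [0,1,0]]"

text \<open>Entries with index at least n are frozen. These conditions are affine, so a segment
  between two members leaves the family only where the Krylov determinant vanishes.\<close>

definition partial_family :: "nat \<Rightarrow> (complex^3^3) set" where
  "partial_family n = {L. det (krylov L) \<noteq> 0 \<and>
     (\<forall>k<9. n \<le> k \<longrightarrow> L $ fst (entry k) $ snd (entry k) = shift_matrix $ fst (entry k) $ snd (entry k))}"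

lemma pfun_family_charpoly:
  assumes "\<And>i j. pfun (\<lambda>u. c u $ i $ j)"
  shows "pfun (\<lambda>u. charpoly_table (c u) $ i $ j $ k)"
  unfolding charpoly_table_def
  by (rule pfun_family_Tc[rule_format]) (intro pfun_intros pfun_det assms)+

lemma irreducible_partial_family:
  "irreducible_in zariski (cyc ` partial_family n)"
proof (rule irreducible_in_rational_curves)
  have "shift_matrix \<in> partial_family n"
    by (simp add: partial_family_def shift_matrix_def krylov_def det_3 e_nth matrix_vector_mult_def sum_3)
  then show "cyc ` partial_family n \<noteq> {}" by blast
  fix s t assume "s \<in> cyc ` partial_family n" "t \<in> cyc ` partial_family n"
  then obtain K L where K: "s = cyc K" "K \<in> partial_family n" and L: "t = cyc L" "L \<in> partial_family n"
    by blast
  define c where "c u = (\<chi> i j. (1 - u) * K $ i $ j + u * L $ i $ j)" for u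
  have c01: "c 0 = K" "c 1 = L" by (simp_all add: c_def vec_eq_iff)
  have pc: "pfun (\<lambda>u. c u $ i $ j)" for i j unfolding c_def by (simp add: pfun_intros)
  have pk: "pfun (\<lambda>u. krylov (c u) $ i $ j)" for i j
    unfolding krylov_def matrix_vector_mult_def by (simp add: pfun_intros pfun_if pc)
  define d where "d u = det (krylov (c u))" for u
  define \<gamma> where "\<gamma> u = (if d u = 0 then 0 else cyc (c u))" for u
  have eq: "d u ^ 3 * \<gamma> u $ i $ j $ k = d u * (\<Sum>r\<in>UNIV. \<Sum>a\<in>UNIV. \<Sum>b\<in>UNIV. krylov (c u) $ k $ r *
        det (\<chi> r s. if s = a then e i $ r else krylov (c u) $ r $ s) *
      det (\<chi> r s. if s = b then e j $ r else krylov (c u) $ r $ s) * charpoly_table (c u) $ a $ b $ r)" for u i j k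
  proof (cases "d u = 0")
    case False
    then show ?thesis
      unfolding d_def by (subst gl_act_nth[symmetric]) (simp_all add: \<gamma>_def d_def cyc_def power3_eq_cube power2_eq_square)
  qed (simp add: \<gamma>_def)
  have pd: "pfun d" unfolding d_def by (intro pfun_det pk)
  have "pfun (\<lambda>u. d u ^ 3 * \<gamma> u $ i $ j $ k)" for i j k
    unfolding eq
    by (intro pfun_intros pfun_det pk pd pfun_family_charpoly pc) (simp_all add: pfun_if pfun_const pk)
  moreover have "pfun (\<lambda>u. d u ^ 3)" by (intro pfun_intros pd)
  moreover have "\<gamma> u \<in> cyc ` partial_family n" if "d u ^ 3 \<noteq> 0" for u
  proof -
    have "c u \<in> partial_family n"
      using that K(2) L(2) unfolding partial_family_def d_def c_def
      by (auto simp: algebra_simps)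
    then show ?thesis using that unfolding \<gamma>_def by auto
  qed
  moreover have "\<gamma> 0 = s" "\<gamma> 1 = t" "d 0 ^ 3 \<noteq> 0" "d 1 ^ 3 \<noteq> 0"
    using K L unfolding \<gamma>_def d_def c01 by (auto simp: partial_family_def)
  ultimately show "\<exists>\<gamma> q. pfun q \<and> (\<forall>i j k. pfun (\<lambda>u. q u * \<gamma> u $ i $ j $ k)) \<and>
      (\<exists>u. q u \<noteq> 0 \<and> \<gamma> u = s) \<and> (\<exists>u. q u \<noteq> 0 \<and> \<gamma> u = t) \<and> (\<forall>u. q u \<noteq> 0 \<longrightarrow> \<gamma> u \<in> cyc ` partial_family n)"
    by (intro exI[of _ \<gamma>] exI[of _ "\<lambda>u. d u ^ 3"]) blast
qed

lemma partial_family_step: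
  assumes "n < 9"
  shows "\<exists>L \<in> partial_family (Suc n). L $ fst (entry n) $ snd (entry n) \<noteq> shift_matrix $ fst (entry n) $ snd (entry n)"
proof -
  \<comment> \<open>Adding 1 keeps \<open>e 1\<close> cyclic at each of the nine positions;
    subtracting 1 would not, at (2,1) or (3,2).\<close>
  define L where "L = (\<chi> i j. shift_matrix $ i $ j + (if (i, j) = entry n then 1 else 0))"
  have inj: "entry k \<noteq> entry n" if "k < 9" "Suc n \<le> k" for k
  proof -
    have "distinct [(1,1), (1,2), (1,3), (2,1), (2,2), (2,3), (3,1), (3,2), (3,3::3) :: 3 \<times> 3]" by simp
    then show ?thesis using that assms unfolding entry_def by (subst nth_eq_iff_index_eq) auto
  qed
  have "n \<in> {0,1,2,3,4,5,6,7,8}" using assms by auto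
  then have "det (krylov L) \<noteq> 0"
    by (elim insertE emptyE)
      (simp_all add: L_def shift_matrix_def krylov_def det_3 e_nth matrix_vector_mult_def sum_3 entry_def)
  moreover have "L $ fst (entry k) $ snd (entry k) = shift_matrix $ fst (entry k) $ snd (entry k)"
    if "k < 9" "Suc n \<le> k" for k
    using inj[OF that] by (simp add: L_def)
  ultimately have "L \<in> partial_family (Suc n)" unfolding partial_family_def by blast
  moreover have "L $ fst (entry n) $ snd (entry n) \<noteq> shift_matrix $ fst (entry n) $ snd (entry n)"
    by (simp add: L_def)
  ultimately show ?thesis by blast
qed

lemma krull_dim_ge: "9 \<le> krull_dim semi_alternative_variety"
proof -
  define Z where "Z n = zariski closure_of (cyc ` partial_family n)" for n
  have "cyc ` partial_family n \<subseteq> semi_alternative" for n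
    using cyc_semi_alternative unfolding partial_family_def by auto
  then have ZV: "Z n \<subseteq> semi_alternative" for n
    unfolding Z_def by (rule closure_of_minimal[OF _ closedin_semi_alternative])
  have cl: "closedin semi_alternative_variety (Z n)" for n
    using closedin_closed_subtopology[OF closedin_semi_alternative] ZV closedin_closure_of
    unfolding Z_def by blast
  have irr: "irreducible_in semi_alternative_variety (Z n)" for n
    using irreducible_in_closed_subtopology[OF closedin_semi_alternative] ZV
      irreducible_in_closure[OF irreducible_partial_family] unfolding Z_def by blast
  have "Z n \<subset> Z (Suc n)" if n: "n < 9" for n
  proof
    have "partial_family n \<subseteq> partial_family (Suc n)" unfolding partial_family_def by auto
    then show "Z n \<subseteq> Z (Suc n)" unfolding Z_def by (intro closure_of_mono image_mono)
    obtain L where L: "L \<in> partial_family (Suc n)"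
      "L $ fst (entry n) $ snd (entry n) \<noteq> shift_matrix $ fst (entry n) $ snd (entry n)"
      using partial_family_step[OF n] by blast
    \<comment> \<open>Row k, column j of \<open>L\<close> is coordinate k of the product of
      \<open>e 1\<close> and \<open>e j\<close>, hence \<open>snd\<close> before
      \<open>fst\<close>.\<close>
    let ?f = "\<lambda>\<mu>. \<mu> $ 1 $ snd (entry n) $ fst (entry n) - shift_matrix $ fst (entry n) $ snd (entry n)"
    have f: "polynomial_fun ?f" by (intro polynomial_fun_intros)
    have "\<forall>\<nu>\<in>cyc ` partial_family n. ?f \<nu> = 0"
      using n cyc_nth unfolding partial_family_def by auto
    then have "?f \<mu> = 0" if "\<mu> \<in> Z n" for \<mu>
      using closure_of_vanishing[OF f] that unfolding Z_def by blast
    moreover have "?f (cyc L) \<noteq> 0" using L cyc_nth unfolding partial_family_def by auto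
    moreover have "cyc L \<in> Z (Suc n)"
      using L(1) closure_of_subset[of "cyc ` partial_family (Suc n)" zariski] unfolding Z_def by auto
    ultimately show "Z n \<noteq> Z (Suc n)" by blast
  qed
  then have "enat 9 \<le> krull_dim semi_alternative_variety"
    unfolding krull_dim_def using cl irr by (intro Sup_upper) blast
  then show ?thesis by (simp add: numeral_eq_enat)
qed

subsection \<open>The dimension is at most nine\<close>

text \<open>Gaussian elimination: a pivot \<open>M \<alpha>0 b\<close> removes one unknown together
  with the equation \<open>b\<close>.\<close>

lemma linear_relation:
  fixes M :: "'a \<Rightarrow> 'b \<Rightarrow> complex"
  assumes "finite B" "finite A" "card B < card A"
  shows "\<exists>a. (\<exists>\<alpha>\<in>A. a \<alpha> \<noteq> 0) \<and> (\<forall>\<beta>\<in>B. (\<Sum>\<alpha>\<in>A. a \<alpha> * M \<alpha> \<beta>) = 0)"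
  using assms
proof (induction B arbitrary: A M rule: finite_induct)
  case empty
  then have "A \<noteq> {}" by auto
  then show ?case by (intro exI[of _ "\<lambda>_. 1"]) auto
next
  case (insert b B)
  show ?case
  proof (cases "\<forall>\<alpha>\<in>A. M \<alpha> b = 0")
    case True
    then show ?thesis using insert.IH[of A M] insert.prems insert.hyps by auto
  next
    case False
    then obtain \<alpha>0 where \<alpha>0: "\<alpha>0 \<in> A" "M \<alpha>0 b \<noteq> 0" by blast
    define M' where "M' \<alpha> \<beta> = M \<alpha> \<beta> - M \<alpha> b / M \<alpha>0 b * M \<alpha>0 \<beta>" for \<alpha> \<beta>
    have "card B < card (A - {\<alpha>0})" using insert \<alpha>0 by auto
    then obtain a where a: "\<exists>\<alpha>\<in>A - {\<alpha>0}. a \<alpha> \<noteq> 0" "\<forall>\<beta>\<in>B. (\<Sum>\<alpha>\<in>A - {\<alpha>0}. a \<alpha> * M' \<alpha> \<beta>) = 0"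
      using insert.IH[of "A - {\<alpha>0}" M'] insert.prems by auto
    define s where "s = (\<Sum>\<alpha>\<in>A - {\<alpha>0}. a \<alpha> * (M \<alpha> b / M \<alpha>0 b))"
    define a' where "a' = a(\<alpha>0 := - s)"
    have "(\<Sum>\<alpha>\<in>A. a' \<alpha> * M \<alpha> \<beta>) = 0" if "\<beta> \<in> insert b B" for \<beta>
    proof -
      have "(\<Sum>\<alpha>\<in>A. a' \<alpha> * M \<alpha> \<beta>) = - s * M \<alpha>0 \<beta> + (\<Sum>\<alpha>\<in>A - {\<alpha>0}. a' \<alpha> * M \<alpha> \<beta>)"
        using \<alpha>0 insert.prems by (simp add: sum.remove[of A \<alpha>0] a'_def)
      also have "(\<Sum>\<alpha>\<in>A - {\<alpha>0}. a' \<alpha> * M \<alpha> \<beta>) = (\<Sum>\<alpha>\<in>A - {\<alpha>0}. a \<alpha> * M \<alpha> \<beta>)"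
        by (intro sum.cong) (auto simp: a'_def)
      also have "\<dots> = (\<Sum>\<alpha>\<in>A - {\<alpha>0}. a \<alpha> * M' \<alpha> \<beta>) + s * M \<alpha>0 \<beta>"
        unfolding s_def sum_distrib_right sum.distrib[symmetric]
        by (intro sum.cong) (auto simp: M'_def algebra_simps)
      also have "(\<Sum>\<alpha>\<in>A - {\<alpha>0}. a \<alpha> * M' \<alpha> \<beta>) = 0"
      proof (cases "\<beta> = b")
        case True
        then show ?thesis using \<alpha>0(2) by (simp add: M'_def)
      next
        case False
        then show ?thesis using that a(2) by auto
      qed
      finally show ?thesis by simp
    qed
    moreover have "\<exists>\<alpha>\<in>A. a' \<alpha> \<noteq> 0" using a(1) by (auto simp: a'_def)
    ultimately show ?thesis by blast
  qed
qed

section \<open>Polynomials in the nine entries of a matrix\<close>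

definition mon :: "(3 \<times> 3 \<Rightarrow> nat) \<Rightarrow> complex^3^3 \<Rightarrow> complex" where
  "mon \<beta> g = (\<Prod>x\<in>UNIV. g $ fst x $ snd x ^ \<beta> x)"

text \<open>\<open>d\<close> bounds the exponent of every entry separately, not the total degree;
  exactly (d + 1)^9 monomials are then allowed.\<close>

inductive pdeg :: "nat \<Rightarrow> (complex^3^3 \<Rightarrow> complex) \<Rightarrow> bool" for d where
  mon: "(\<And>x. \<beta> x \<le> d) \<Longrightarrow> pdeg d (\<lambda>g. c * mon \<beta> g)"
| add: "pdeg d f \<Longrightarrow> pdeg d h \<Longrightarrow> pdeg d (\<lambda>g. f g + h g)"

lemma pdeg_mono: "pdeg a f \<Longrightarrow> a \<le> b \<Longrightarrow> pdeg b f"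
proof (induction rule: pdeg.induct)
  case (mon \<beta> c)
  show ?case by (rule pdeg.mon) (rule order_trans[OF mon])
qed (simp add: pdeg.add)

lemma pdeg_mult:
  assumes "pdeg a f" "pdeg b h"
  shows "pdeg (a + b) (\<lambda>g. f g * h g)"
  using assms(1)
proof induction
  case (mon \<beta> c)
  from assms(2) show ?case
  proof induction
    case (mon \<gamma> c')
    have eq: "(\<lambda>g. c * mon \<beta> g * (c' * mon \<gamma> g)) = (\<lambda>g. (c * c') * mon (\<lambda>x. \<beta> x + \<gamma> x) g)"
      by (simp add: fun_eq_iff mon_def power_add prod.distrib)
    show ?case unfolding eq
      by (rule pdeg.mon) (rule add_mono[OF \<open>\<And>x. \<beta> x \<le> a\<close> mon])
  next
    case (add f h)
    then show ?case by (simp add: distrib_left pdeg.add)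
  qed
next
  case (add f1 f2)
  then show ?case by (simp add: distrib_right pdeg.add)
qed

lemma pdeg_const: "pdeg d (\<lambda>g. c)"
  using pdeg.mon[of "\<lambda>_. 0" d c] by (simp add: mon_def)

lemma pdeg_entry: "pdeg 1 (\<lambda>g. g $ i $ j)"
proof -
  have "mon (\<lambda>x. if x = (i, j) then 1 else 0) g = g $ i $ j" for g
    unfolding mon_def
    by (subst prod.cong[of _ _ _ "\<lambda>x. if x = (i, j) then g $ i $ j else 1"]) (auto simp: prod.delta)
  then show ?thesis using pdeg.mon[of "\<lambda>x. if x = (i, j) then 1 else 0" 1 1] by simp
qed

lemma pdeg_power: "pdeg d f \<Longrightarrow> pdeg (d * k) (\<lambda>g. f g ^ k)"
proof (induction k)
  case 0
  then show ?case by (simp add: pdeg_const)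
next
  case (Suc k)
  then show ?case using pdeg_mult[of d f "d * k" "\<lambda>g. f g ^ k"] by simp
qed

lemma pdeg_prod:
  "finite A \<Longrightarrow> (\<And>i. i \<in> A \<Longrightarrow> pdeg d (f i)) \<Longrightarrow> pdeg (card A * d) (\<lambda>g. \<Prod>i\<in>A. f i g)"
proof (induction A rule: finite_induct)
  case empty
  then show ?case by (simp add: pdeg_const)
next
  case (insert i A)
  then show ?case using pdeg_mult[of d "f i" "card A * d" "\<lambda>g. \<Prod>i\<in>A. f i g"] by simp
qed

definition bounded_exponents :: "nat \<Rightarrow> (3 \<times> 3 \<Rightarrow> nat) set" where
  "bounded_exponents d = PiE UNIV (\<lambda>_. {..d})"

lemma finite_bounded_exponents: "finite (bounded_exponents d)"
  unfolding bounded_exponents_def by (intro finite_PiE) auto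

lemma card_bounded_exponents: "card (bounded_exponents d) = (d + 1) ^ 9"
  unfolding bounded_exponents_def by (subst card_PiE) auto

lemma pdeg_coeffs:
  "pdeg d f \<Longrightarrow> \<exists>c. \<forall>g. f g = (\<Sum>\<beta>\<in>bounded_exponents d. c \<beta> * mon \<beta> g)"
proof (induction rule: pdeg.induct)
  case (mon \<beta> c)
  then have "\<beta> \<in> bounded_exponents d" by (auto simp: bounded_exponents_def PiE_def)
  then have "c * mon \<beta> g = (\<Sum>\<gamma>\<in>bounded_exponents d. (if \<gamma> = \<beta> then c else 0) * mon \<gamma> g)" for g
    by (simp add: if_distrib[of "\<lambda>x. x * _"] sum.delta finite_bounded_exponents cong: if_cong)
  then show ?case by (intro exI[of _ "\<lambda>\<gamma>. if \<gamma> = \<beta> then c else 0"]) blast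
next
  case (add f h)
  then obtain c c' where "\<And>g. f g = (\<Sum>\<beta>\<in>bounded_exponents d. c \<beta> * mon \<beta> g)"
    "\<And>g. h g = (\<Sum>\<beta>\<in>bounded_exponents d. c' \<beta> * mon \<beta> g)" by blast
  then show ?case by (intro exI[of _ "\<lambda>\<beta>. c \<beta> + c' \<beta>"]) (simp add: distrib_right sum.distrib)
qed

definition polyg :: "(complex^3^3 \<Rightarrow> complex) \<Rightarrow> bool" where
  "polyg f \<longleftrightarrow> (\<exists>d. pdeg d f)"

lemma polyg_const: "polyg (\<lambda>g. c)"
  unfolding polyg_def using pdeg_const by blast

lemma polyg_entry: "polyg (\<lambda>g. g $ i $ j)"
  unfolding polyg_def using pdeg_entry by blast

lemma polyg_mult: "polyg f \<Longrightarrow> polyg h \<Longrightarrow> polyg (\<lambda>g. f g * h g)"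
  unfolding polyg_def using pdeg_mult by blast

lemma polyg_add: "polyg f \<Longrightarrow> polyg h \<Longrightarrow> polyg (\<lambda>g. f g + h g)"
proof -
  assume "polyg f" "polyg h"
  then obtain a b where "pdeg a f" "pdeg b h" unfolding polyg_def by blast
  then have "pdeg (max a b) f" "pdeg (max a b) h" using pdeg_mono by auto
  from pdeg.add[OF this] show ?thesis unfolding polyg_def by (rule exI)
qed

lemma polyg_diff: "polyg f \<Longrightarrow> polyg h \<Longrightarrow> polyg (\<lambda>g. f g - h g)"
  using polyg_add[of f "\<lambda>g. (- 1) * h g"] polyg_mult[of "\<lambda>g. - 1" h] polyg_const by simp

lemma polyg_power: "polyg f \<Longrightarrow> polyg (\<lambda>g. f g ^ n)"
  by (induction n) (auto intro: polyg_const polyg_mult)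

lemma polyg_sum: "(\<And>i. i \<in> A \<Longrightarrow> polyg (f i)) \<Longrightarrow> polyg (\<lambda>g. \<Sum>i\<in>A. f i g)"
  by (induction A rule: infinite_finite_induct) (auto intro: polyg_const polyg_add)

lemma polyg_if: "polyg f \<Longrightarrow> polyg h \<Longrightarrow> polyg (\<lambda>g. if P then f g else h g)"
  by (cases P) simp_all

lemmas polyg_intros = polyg_const polyg_entry polyg_mult polyg_add polyg_diff polyg_power polyg_sum polyg_if

lemma polyg_det: "(\<And>i j. polyg (\<lambda>g. m g $ i $ j)) \<Longrightarrow> polyg (\<lambda>g. det (m g :: complex^3^3))"
  unfolding det_3 by (intro polyg_intros)

lemma polynomial_fun_on_orbit:
  assumes "polynomial_fun f"
  shows "\<exists>n F. polyg F \<and> (\<forall>g. det g \<noteq> 0 \<longrightarrow> det g ^ n * f (gl_act g \<kappa>) = F g)"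
  using assms
proof induction
  case (const c)
  show ?case by (intro exI[of _ 0] exI[of _ "\<lambda>g. c"]) (simp add: polyg_const)
next
  case (coord i j k)
  let ?F = "\<lambda>g. \<Sum>c\<in>UNIV. \<Sum>a\<in>UNIV. \<Sum>b\<in>UNIV. g $ k $ c * det (\<chi> r s. if s = a then e i $ r else g $ r $ s) *
      det (\<chi> r s. if s = b then e j $ r else g $ r $ s) * \<kappa> $ a $ b $ c"
  have "polyg ?F"
    by (intro polyg_intros polyg_det) (simp_all add: polyg_if polyg_const polyg_entry)
  then show ?case using gl_act_nth[of _ \<kappa> i j k] by blast
next
  case (add f h)
  then obtain m F n H where "polyg F" "polyg H"
    "\<forall>g. det g \<noteq> 0 \<longrightarrow> det g ^ m * f (gl_act g \<kappa>) = F g" "\<forall>g. det g \<noteq> 0 \<longrightarrow> det g ^ n * h (gl_act g \<kappa>) = H g"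
    by blast
  then show ?case
    by (intro exI[of _ "m + n"] exI[of _ "\<lambda>g. det g ^ n * F g + det g ^ m * H g"])
      (auto intro!: polyg_intros polyg_det simp: algebra_simps power_add)
next
  case (mult f h)
  then obtain m F n H where FH: "polyg F" "polyg H"
    "\<And>g. det g \<noteq> 0 \<Longrightarrow> det g ^ m * f (gl_act g \<kappa>) = F g" "\<And>g. det g \<noteq> 0 \<Longrightarrow> det g ^ n * h (gl_act g \<kappa>) = H g"
    by blast
  have "det g ^ (m + n) * (f (gl_act g \<kappa>) * h (gl_act g \<kappa>)) = F g * H g" if "det g \<noteq> 0" for g
    unfolding FH(3)[OF that, symmetric] FH(4)[OF that, symmetric] by (simp add: power_add)
  then show ?case using polyg_mult[OF FH(1,2)] by blast
qed

lemma polynomial_fun_prod: "(\<And>i. i \<in> A \<Longrightarrow> polynomial_fun (f i)) \<Longrightarrow> polynomial_fun (\<lambda>\<mu>. \<Prod>i\<in>A. f i \<mu>)"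
  by (induction A rule: infinite_finite_induct) (auto intro: polynomial_fun.intros)

text \<open>Functions that cut down a chain of irreducible closed sets step by step are algebraically independent.\<close>

lemma chain_independent:
  fixes a :: "(nat \<Rightarrow> nat) \<Rightarrow> complex"
  assumes "\<And>i. i \<le> n \<Longrightarrow> irreducible_in zariski (Z i)" "\<And>i. i < n \<Longrightarrow> Z i \<subseteq> Z (Suc i)"
    and "\<And>i. i < n \<Longrightarrow> polynomial_fun (f i)" "\<And>i. i < n \<Longrightarrow> \<forall>\<mu>\<in>Z i. f i \<mu> = 0"
    and "\<And>i. i < n \<Longrightarrow> \<exists>\<mu>\<in>Z (Suc i). f i \<mu> \<noteq> 0"
    and "finite E" "inj_on (\<lambda>\<alpha>. restrict \<alpha> {..<n}) E"
    and "\<forall>\<mu>\<in>Z n. (\<Sum>\<alpha>\<in>E. a \<alpha> * (\<Prod>i<n. f i \<mu> ^ \<alpha> i)) = 0"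
  shows "\<forall>\<alpha>\<in>E. a \<alpha> = 0"
  using assms
proof (induction n arbitrary: E)
  case 0
  obtain \<mu> where "\<mu> \<in> Z 0" using 0(1)[of 0] unfolding irreducible_in_def by auto
  then have s: "(\<Sum>\<alpha>\<in>E. a \<alpha>) = 0" using 0(8) by auto
  show ?case
  proof
    fix \<alpha> assume \<alpha>: "\<alpha> \<in> E"
    \<comment> \<open>On the empty index set all restrictions agree, so injectivity leaves a single
      exponent.\<close>
    have "E = {\<alpha>}" using 0(7) \<alpha> by (auto simp: inj_on_def)
    then show "a \<alpha> = 0" using s by simp
  qed
next
  case (Suc n)
  show ?case
  proof (rule ccontr)
    assume "\<not> (\<forall>\<alpha>\<in>E. a \<alpha> = 0)"
    then have "\<exists>k. \<exists>\<alpha>\<in>E. a \<alpha> \<noteq> 0 \<and> \<alpha> n = k" by blast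
    then obtain k where k: "\<exists>\<alpha>\<in>E. a \<alpha> \<noteq> 0 \<and> \<alpha> n = k" "\<And>j. j < k \<Longrightarrow> \<not> (\<exists>\<alpha>\<in>E. a \<alpha> \<noteq> 0 \<and> \<alpha> n = j)"
      using exists_least_iff[of "\<lambda>k. \<exists>\<alpha>\<in>E. a \<alpha> \<noteq> 0 \<and> \<alpha> n = k"] by blast
    define G where "G \<mu> = (\<Sum>\<alpha>\<in>E. a \<alpha> * (\<Prod>i<n. f i \<mu> ^ \<alpha> i) * f n \<mu> ^ (\<alpha> n - k))" for \<mu>
    have pG: "polynomial_fun G" unfolding G_def
      by (intro polynomial_fun_sum polynomial_fun.mult polynomial_fun.const polynomial_fun_prod polynomial_fun_power Suc.prems(3)) auto
    have "(\<Sum>\<alpha>\<in>E. a \<alpha> * (\<Prod>i<Suc n. f i \<mu> ^ \<alpha> i)) = f n \<mu> ^ k * G \<mu>" for \<mu>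
      unfolding G_def sum_distrib_left
    proof (rule sum.cong)
      fix \<alpha> assume \<alpha>: "\<alpha> \<in> E"
      show "a \<alpha> * (\<Prod>i<Suc n. f i \<mu> ^ \<alpha> i) = f n \<mu> ^ k * (a \<alpha> * (\<Prod>i<n. f i \<mu> ^ \<alpha> i) * f n \<mu> ^ (\<alpha> n - k))"
      proof (cases "a \<alpha> = 0")
        case False
        then have "k \<le> \<alpha> n" using k(2)[of "\<alpha> n"] \<alpha> by force
        then have "f n \<mu> ^ \<alpha> n = f n \<mu> ^ k * f n \<mu> ^ (\<alpha> n - k)" by (simp flip: power_add)
        then show ?thesis by simp
      qed simp
    qed simp
    then have 0: "f n \<mu> ^ k * G \<mu> = 0" if "\<mu> \<in> Z (Suc n)" for \<mu> using Suc.prems(8) that by auto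
    have "Z (Suc n) \<subseteq> {\<mu>. f n \<mu> = 0} \<union> {\<mu>. G \<mu> = 0}" using 0 by fastforce
    then have "Z (Suc n) \<subseteq> {\<mu>. f n \<mu> = 0} \<or> Z (Suc n) \<subseteq> {\<mu>. G \<mu> = 0}"
      using Suc.prems(1)[of "Suc n"] closedin_zero_fun[OF pG] closedin_zero_fun[OF Suc.prems(3)[of n]]
      unfolding irreducible_in_def by auto
    then have G0: "G \<mu> = 0" if "\<mu> \<in> Z (Suc n)" for \<mu> using Suc.prems(5)[of n] that by auto
    \<comment> \<open>On \<open>Z n\<close>, where \<open>f n\<close> is 0, only the terms of
      \<open>G\<close> with exponent exactly \<open>k\<close> survive; they form a nontrivial
      relation between the first n functions.\<close>
    define E' where "E' = {\<alpha>\<in>E. \<alpha> n = k \<and> a \<alpha> \<noteq> 0}"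
    have "(\<Sum>\<alpha>\<in>E'. a \<alpha> * (\<Prod>i<n. f i \<mu> ^ \<alpha> i)) = G \<mu>" if \<mu>: "\<mu> \<in> Z n" for \<mu>
    proof -
      have "f n \<mu> = 0" using Suc.prems(4)[of n] \<mu> by simp
      then have t: "a \<alpha> * (\<Prod>i<n. f i \<mu> ^ \<alpha> i) * f n \<mu> ^ (\<alpha> n - k) = (if \<alpha> \<in> E' then a \<alpha> * (\<Prod>i<n. f i \<mu> ^ \<alpha> i) else 0)"
        if "\<alpha> \<in> E" for \<alpha>
      proof (cases "a \<alpha> = 0")
        case False
        then have "k \<le> \<alpha> n" using k(2)[of "\<alpha> n"] that by force
        then show ?thesis using \<open>f n \<mu> = 0\<close> that False by (auto simp: E'_def)
      qed (simp add: E'_def)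
      have "G \<mu> = (\<Sum>\<alpha>\<in>E. if \<alpha> \<in> E' then a \<alpha> * (\<Prod>i<n. f i \<mu> ^ \<alpha> i) else 0)"
        unfolding G_def by (rule sum.cong) (use t in auto)
      also have "\<dots> = (\<Sum>\<alpha>\<in>E \<inter> E'. a \<alpha> * (\<Prod>i<n. f i \<mu> ^ \<alpha> i))"
        by (rule sum.inter_restrict[OF Suc.prems(6), symmetric])
      also have "E \<inter> E' = E'" by (auto simp: E'_def)
      finally show ?thesis by simp
    qed
    then have z: "\<forall>\<mu>\<in>Z n. (\<Sum>\<alpha>\<in>E'. a \<alpha> * (\<Prod>i<n. f i \<mu> ^ \<alpha> i)) = 0"
      using G0 Suc.prems(2)[of n] by auto
    have "inj_on (\<lambda>\<alpha>. restrict \<alpha> {..<n}) E'"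
    proof (rule inj_onI)
      fix \<alpha> \<beta> assume ab: "\<alpha> \<in> E'" "\<beta> \<in> E'" "restrict \<alpha> {..<n} = restrict \<beta> {..<n}"
      then have "\<alpha> i = \<beta> i" if "i < n" for i using that by (metis lessThan_iff restrict_apply)
      moreover have "\<alpha> n = \<beta> n" using ab by (simp add: E'_def)
      ultimately have "restrict \<alpha> {..<Suc n} = restrict \<beta> {..<Suc n}"
        by (auto simp: restrict_def less_Suc_eq)
      then show "\<alpha> = \<beta>"
        by (rule inj_onD[OF Suc.prems(7)]) (use ab in \<open>simp_all add: E'_def\<close>)
    qed
    then have "\<forall>\<alpha>\<in>E'. a \<alpha> = 0"
    proof (rule Suc.IH[rotated 6])
      show "finite E'" using Suc.prems(6) by (simp add: E'_def)
      show "\<forall>\<mu>\<in>Z n. (\<Sum>\<alpha>\<in>E'. a \<alpha> * (\<Prod>i<n. f i \<mu> ^ \<alpha> i)) = 0" by (rule z)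
    qed (use Suc.prems(1-5) in simp_all)
    then show False using k(1) by (auto simp: E'_def)
  qed
qed

lemma chain_length_le:
  assumes Z: "\<And>i. i \<le> n \<Longrightarrow> closedin zariski (Z i) \<and> irreducible_in zariski (Z i)"
    and strict: "\<And>i. i < n \<Longrightarrow> Z i \<subset> Z (Suc i)" and top: "Z n \<subseteq> orbit_closure \<kappa>"
  shows "n \<le> 9"
proof -
  have "\<exists>f. polynomial_fun f \<and> (\<forall>\<mu>\<in>Z i. f \<mu> = 0) \<and> (\<exists>\<mu>\<in>Z (Suc i). f \<mu> \<noteq> 0)" if i: "i < n" for i
  proof -
    obtain \<mu> where "\<mu> \<in> Z (Suc i)" "\<mu> \<notin> Z i" using strict[OF i] by blast
    then show ?thesis using closedin_mem_iff[of "Z i" \<mu>] Z[of i] i by auto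
  qed
  then obtain f where f: "\<And>i. i < n \<Longrightarrow> polynomial_fun (f i) \<and> (\<forall>\<mu>\<in>Z i. f i \<mu> = 0) \<and> (\<exists>\<mu>\<in>Z (Suc i). f i \<mu> \<noteq> 0)"
    by metis
  have "\<exists>m F. polyg F \<and> (\<forall>g. det g \<noteq> 0 \<longrightarrow> det g ^ m * f i (gl_act g \<kappa>) = F g)" if "i < n" for i
    using polynomial_fun_on_orbit f that by blast
  then obtain m F where F: "\<And>i. i < n \<Longrightarrow> polyg (F i) \<and> (\<forall>g. det g \<noteq> 0 \<longrightarrow> det g ^ m i * f i (gl_act g \<kappa>) = F i g)"
    by metis
  \<comment> \<open>A common exponent: one power of the determinant clears the denominators of all
    \<open>f i\<close>.\<close>
  define s where "s = (\<Sum>i<n. m i)"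
  define H where "H i g = det g ^ (s - m i) * F i g" for i g
  have H: "det g ^ s * f i (gl_act g \<kappa>) = H i g" if "i < n" "det g \<noteq> 0" for i g
  proof -
    have "m i \<le> s" unfolding s_def using that(1) by (intro member_le_sum) auto
    then have "det g ^ s = det g ^ (s - m i) * det g ^ m i" by (simp flip: power_add)
    then show ?thesis using F that unfolding H_def by simp
  qed
  have pdet: "polyg (\<lambda>g. det g ^ k)" for k by (intro polyg_power polyg_det polyg_entry)
  have "\<exists>d. pdeg d (H i)" if "i < n" for i
    using polyg_mult[OF pdet, of "F i" "s - m i"] F that unfolding H_def polyg_def by blast
  then obtain d where d: "\<And>i. i < n \<Longrightarrow> pdeg (d i) (H i)" by metis
  obtain d' where d': "pdeg d' (\<lambda>g. det g ^ s)" using pdet unfolding polyg_def by blast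
  define D where "D = d' + (\<Sum>i<n. d i)"
  have "d i \<le> D" if "i < n" for i
    using that member_le_sum[of i "{..<n}" d] unfolding D_def by simp
  then have DH: "pdeg D (H i)" if "i < n" for i using d that pdeg_mono by blast
  have Ddet: "pdeg D (\<lambda>g. det g ^ s)" using d' pdeg_mono unfolding D_def by (metis le_add1)
  \<comment> \<open>There are N^n monomials with exponents below N. Pulled back, they lie in a space
    with (n D N + 1)^9 coefficients; if these were fewer, a linear relation on the orbit would
    contradict independence.\<close>
  have bound: "N ^ n \<le> (n * D * N + 1) ^ 9" for N
  proof (rule ccontr)
    assume less: "\<not> ?thesis"
    define E where "E = PiE {..<n} (\<lambda>_. {..<N})"
    have finE: "finite E" unfolding E_def by (intro finite_PiE) auto
    have cardE: "card E = N ^ n" unfolding E_def by (subst card_PiE) auto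
    \<comment> \<open>The power of the determinant complements the exponent, so all monomials
      acquire the same factor and a relation between them passes back to the orbit.\<close>
    define G where "G \<alpha> g = (\<Prod>i<n. H i g ^ \<alpha> i * (det g ^ s) ^ (N - \<alpha> i))" for \<alpha> g
    have "pdeg (n * D * N) (G \<alpha>)" if "\<alpha> \<in> E" for \<alpha>
    proof -
      have pf: "pdeg (D * N) (\<lambda>g. H i g ^ \<alpha> i * (det g ^ s) ^ (N - \<alpha> i))" if "i \<in> {..<n}" for i
      proof -
        have "\<alpha> i < N" using \<open>\<alpha> \<in> E\<close> that unfolding E_def by auto
        then have "D * \<alpha> i + D * (N - \<alpha> i) = D * N" by (simp flip: distrib_left)
        then show ?thesis
          using pdeg_mult[OF pdeg_power[OF DH, of i "\<alpha> i"] pdeg_power[OF Ddet, of "N - \<alpha> i"]] that by simp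
      qed
      have "pdeg (card {..<n} * (D * N)) (\<lambda>g. \<Prod>i\<in>{..<n}. H i g ^ \<alpha> i * (det g ^ s) ^ (N - \<alpha> i))"
        by (rule pdeg_prod) (simp, rule pf)
      then show ?thesis unfolding G_def by (simp add: mult.assoc)
    qed
    then have "\<forall>\<alpha>\<in>E. \<exists>c. \<forall>g. G \<alpha> g = (\<Sum>\<beta>\<in>bounded_exponents (n * D * N). c \<beta> * mon \<beta> g)"
      using pdeg_coeffs by blast
    then obtain M where M: "\<And>\<alpha> g. \<alpha> \<in> E \<Longrightarrow> G \<alpha> g = (\<Sum>\<beta>\<in>bounded_exponents (n * D * N). M \<alpha> \<beta> * mon \<beta> g)"
      by metis
    have "card (bounded_exponents (n * D * N)) < card E"
      using less unfolding card_bounded_exponents cardE by simp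
    then obtain a where a: "\<exists>\<alpha>\<in>E. a \<alpha> \<noteq> 0" "\<forall>\<beta>\<in>bounded_exponents (n * D * N). (\<Sum>\<alpha>\<in>E. a \<alpha> * M \<alpha> \<beta>) = 0"
      using linear_relation[OF finite_bounded_exponents finE, of "n * D * N" M] by blast
    have aG: "(\<Sum>\<alpha>\<in>E. a \<alpha> * G \<alpha> g) = 0" for g
    proof -
      have "(\<Sum>\<alpha>\<in>E. a \<alpha> * G \<alpha> g) = (\<Sum>\<alpha>\<in>E. \<Sum>\<beta>\<in>bounded_exponents (n * D * N). a \<alpha> * M \<alpha> \<beta> * mon \<beta> g)"
        by (intro sum.cong) (simp_all add: M sum_distrib_left mult.assoc)
      also have "\<dots> = (\<Sum>\<beta>\<in>bounded_exponents (n * D * N). (\<Sum>\<alpha>\<in>E. a \<alpha> * M \<alpha> \<beta>) * mon \<beta> g)"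
        by (subst sum.swap) (simp add: sum_distrib_right)
      also have "\<dots> = 0" using a(2) by simp
      finally show ?thesis .
    qed
    define R where "R \<mu> = (\<Sum>\<alpha>\<in>E. a \<alpha> * (\<Prod>i<n. f i \<mu> ^ \<alpha> i))" for \<mu>
    have pR: "polynomial_fun R" unfolding R_def
      by (intro polynomial_fun_sum polynomial_fun.mult polynomial_fun.const polynomial_fun_prod polynomial_fun_power) (use f in auto)
    have "R \<nu> = 0" if \<nu>: "\<nu> \<in> orbit \<kappa>" for \<nu>
    proof -
      obtain g where g: "\<nu> = gl_act g \<kappa>" "det g \<noteq> 0" using \<nu> unfolding orbit_def invertible_det_nz by blast
      have "G \<alpha> g = (det g ^ s) ^ (n * N) * (\<Prod>i<n. f i \<nu> ^ \<alpha> i)" if "\<alpha> \<in> E" for \<alpha>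
      proof -
        have "G \<alpha> g = (\<Prod>i<n. (det g ^ s) ^ N * f i \<nu> ^ \<alpha> i)"
          unfolding G_def
        proof (rule prod.cong)
          fix i assume i: "i \<in> {..<n}"
          have "\<alpha> i \<in> {..<N}" using PiE_mem[OF \<open>\<alpha> \<in> E\<close>[unfolded E_def] i] .
          then have "\<alpha> i \<le> N" by simp
          then have p: "(det g ^ s) ^ N = (det g ^ s) ^ \<alpha> i * (det g ^ s) ^ (N - \<alpha> i)" by (simp flip: power_add)
          have "H i g = det g ^ s * f i \<nu>" using H[of i g] i g by simp
          then show "H i g ^ \<alpha> i * (det g ^ s) ^ (N - \<alpha> i) = (det g ^ s) ^ N * f i \<nu> ^ \<alpha> i"
            unfolding p by (simp add: power_mult_distrib)
        qed simp
        then show ?thesis by (simp add: prod.distrib power_mult mult.commute[of n N])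
      qed
      then have "(det g ^ s) ^ (n * N) * R \<nu> = 0"
        using aG[of g] unfolding R_def sum_distrib_left by (simp add: mult.left_commute)
      then show ?thesis using g(2) by simp
    qed
    then have "\<forall>\<mu>\<in>Z n. R \<mu> = 0" using closure_of_vanishing[OF pR] top by blast
    moreover have "inj_on (\<lambda>\<alpha>. restrict \<alpha> {..<n}) E"
      by (rule inj_onI) (auto simp: E_def)
    ultimately have "\<forall>\<alpha>\<in>E. a \<alpha> = 0"
      using chain_independent[of n Z f E a] Z strict f finE unfolding R_def by blast
    then show False using a(1) by blast
  qed
  show ?thesis
  proof (rule ccontr)
    assume "\<not> ?thesis"
    then have n: "10 \<le> n" by simp
    \<comment> \<open>Chosen so that (n D N + 1)^9 is at most (n D + 1)^9 N^9, which is less than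
      N^10.\<close>
    define N where "N = (n * D + 1) ^ 9 + 1"
    have N: "1 \<le> N" by (simp add: N_def)
    have "N ^ 10 \<le> N ^ n" using n N by (intro power_increasing) auto
    also have "\<dots> \<le> (n * D * N + 1) ^ 9" by (rule bound)
    also have "\<dots> \<le> ((n * D + 1) * N) ^ 9" using N by (intro power_mono) (auto simp: algebra_simps)
    also have "\<dots> = (n * D + 1) ^ 9 * N ^ 9" by (rule power_mult_distrib)
    also have "\<dots> < N * N ^ 9" using N unfolding N_def by (intro mult_strict_right_mono) auto
    also have "\<dots> = N ^ 10" by (simp add: power_numeral_reduce)
    finally show False by simp
  qed
qed

lemma krull_dim_le: "krull_dim semi_alternative_variety \<le> 9"
  unfolding krull_dim_def
proof (rule Sup_least, clarify)
  fix n and Z :: "nat \<Rightarrow> alg3 set"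
  assume Z: "\<forall>i\<le>n. closedin semi_alternative_variety (Z i) \<and> irreducible_in semi_alternative_variety (Z i)"
    and s: "\<forall>i<n. Z i \<subset> Z (Suc i)"
  obtain \<kappa> where "Z n \<subseteq> orbit_closure \<kappa>"
    using irreducible_subset_orbit_closure Z by blast
  then have "n \<le> 9"
    using Z s closedin_closed_subtopology[OF closedin_semi_alternative]
      irreducible_in_closed_subtopology[OF closedin_semi_alternative]
    by (intro chain_length_le[of n Z \<kappa>]) auto
  then have "enat n \<le> enat 9" by simp
  then show "enat n \<le> 9" by (simp add: numeral_eq_enat)
qed

subsection \<open>Components and rigid algebras\<close>

text \<open>The orbit of \<kappa> is a neighbourhood of \<kappa> in the variety, and \<kappa> is a
  limit of the other orbit; hence the two orbits meet and coincide.\<close>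

lemma orbit_closures_inclusion:
  assumes "\<kappa> \<in> set representatives" "\<kappa>' \<in> set representatives" "orbit_closure \<kappa> \<subseteq> orbit_closure \<kappa>'"
  shows "\<kappa> = \<kappa>'"
proof -
  obtain U where U: "openin zariski U" "orbit \<kappa> = U \<inter> semi_alternative"
    using openin_orbit_representatives[OF assms(1)] unfolding openin_subtopology by blast
  have "\<kappa> \<in> orbit_closure \<kappa>'" "\<kappa> \<in> U" using assms(3) orbit_refl orbit_subset_closure U(2) by blast+
  then obtain \<mu> where \<mu>: "\<mu> \<in> orbit \<kappa>'" "\<mu> \<in> U" using U(1) unfolding in_closure_of by blast
  have "\<mu> \<in> semi_alternative" using \<mu>(1) orbit_subset_closure variety_covered assms(2) by blast
  then have "\<mu> \<in> orbit \<kappa>" using \<mu>(2) U(2) by blast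
  then have eq: "orbit \<kappa> = orbit \<kappa>'" using \<mu>(1) orbit_eq by metis
  have len: "length representatives = 7" by (simp add: representatives_def)
  obtain i j where ij: "i < 7" "j < 7" "\<kappa> = representatives ! i" "\<kappa>' = representatives ! j"
    using assms(1,2) unfolding in_set_conv_nth len by blast
  then have "i = j" using eq orbits_distinct[of i j] orbits_distinct[of j i] by (metis linorder_neqE_nat)
  then show ?thesis using ij by simp
qed

lemma orbit_closure_component:
  assumes "\<kappa> \<in> set representatives"
  shows "irreducible_in semi_alternative_variety (orbit_closure \<kappa>)"
  using irreducible_in_closed_subtopology[OF closedin_semi_alternative] variety_covered assms
    irreducible_in_closure[OF irreducible_in_orbit] by blast

lemma irreducible_components_variety:
  "irreducible_components semi_alternative_variety = orbit_closure ` set representatives"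
proof (intro equalityI subsetI)
  fix S assume "S \<in> irreducible_components semi_alternative_variety"
  then have S: "irreducible_in semi_alternative_variety S"
    "\<And>T. irreducible_in semi_alternative_variety T \<Longrightarrow> S \<subseteq> T \<Longrightarrow> T = S"
    unfolding irreducible_components_def by auto
  obtain \<kappa> where "\<kappa> \<in> set representatives" "S \<subseteq> orbit_closure \<kappa>"
    using irreducible_subset_orbit_closure[OF S(1)] by blast
  then show "S \<in> orbit_closure ` set representatives"
    using S(2) orbit_closure_component by blast
next
  fix S assume "S \<in> orbit_closure ` set representatives"
  then obtain \<kappa> where \<kappa>: "\<kappa> \<in> set representatives" "S = orbit_closure \<kappa>" by blast
  have "T = S" if T: "irreducible_in semi_alternative_variety T" "S \<subseteq> T" for T
  proof -
    obtain \<kappa>' where "\<kappa>' \<in> set representatives" "T \<subseteq> orbit_closure \<kappa>'"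
      using irreducible_subset_orbit_closure[OF T(1)] by blast
    then show ?thesis using orbit_closures_inclusion[OF \<kappa>(1), of \<kappa>'] T(2) \<kappa>(2) by blast
  qed
  then show "S \<in> irreducible_components semi_alternative_variety"
    using orbit_closure_component[OF \<kappa>(1)] \<kappa>(2) unfolding irreducible_components_def by blast
qed

lemma card_representatives: "card (set representatives) = 7"
proof -
  have "distinct representatives"
    unfolding distinct_conv_nth
  proof (intro allI impI)
    fix i j assume "i < length representatives" "j < length representatives" "i \<noteq> j"
    then show "representatives ! i \<noteq> representatives ! j"
      using orbits_distinct[of i j] orbits_distinct[of j i]
      by (cases "i < j") (auto simp: representatives_def)
  qed
  then show ?thesis by (simp add: distinct_card) (simp add: representatives_def)
qed

text \<open>An open orbit is a neighbourhood of its point within some component and therefore meets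
  the dense orbit of that component.\<close>

lemma rigid_algebras_variety:
  "rigid_algebras semi_alternative = (\<Union>\<kappa>\<in>set representatives. orbit \<kappa>)"
proof (intro equalityI subsetI)
  fix \<mu> assume "\<mu> \<in> rigid_algebras semi_alternative"
  then have \<mu>: "\<mu> \<in> semi_alternative" "openin semi_alternative_variety (orbit \<mu>)"
    unfolding rigid_algebras_def by auto
  obtain \<kappa> where \<kappa>: "\<kappa> \<in> set representatives" "\<mu> \<in> orbit_closure \<kappa>"
    using \<mu>(1) variety_covered by blast
  obtain U where U: "openin zariski U" "orbit \<mu> = U \<inter> semi_alternative"
    using \<mu>(2) unfolding openin_subtopology by blast
  have "\<mu> \<in> U" using U(2) orbit_refl by blast
  then obtain \<nu> where \<nu>: "\<nu> \<in> orbit \<kappa>" "\<nu> \<in> U" using U(1) \<kappa>(2) unfolding in_closure_of by blast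
  have "\<nu> \<in> semi_alternative" using \<nu>(1) orbit_subset_closure variety_covered \<kappa>(1) by blast
  then have "\<nu> \<in> orbit \<mu>" using \<nu>(2) U(2) by blast
  then have "\<mu> \<in> orbit \<kappa>" using \<nu>(1) orbit_sym orbit_trans by blast
  then show "\<mu> \<in> (\<Union>\<kappa>\<in>set representatives. orbit \<kappa>)" using \<kappa>(1) by blast
next
  fix \<mu> assume "\<mu> \<in> (\<Union>\<kappa>\<in>set representatives. orbit \<kappa>)"
  then obtain \<kappa> where \<kappa>: "\<kappa> \<in> set representatives" "\<mu> \<in> orbit \<kappa>" by blast
  then have "\<mu> \<in> semi_alternative" using orbit_subset_closure variety_covered by blast
  then show "\<mu> \<in> rigid_algebras semi_alternative"
    using openin_orbit_representatives[OF \<kappa>(1)] orbit_eq[OF \<kappa>(2)] unfolding rigid_algebras_def by simp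
qed

lemma alg_iso_iff: "(\<mu>, \<nu>) \<in> alg_iso \<longleftrightarrow> \<nu> \<in> orbit \<mu>"
  unfolding alg_iso_def orbit_def
  using gl_act_eqI mult_gl_act_apply by auto

lemma card_rigid_classes: "card (rigid_algebras semi_alternative // alg_iso) = 7"
proof -
  have cls: "alg_iso `` {\<mu>} = orbit \<mu>" for \<mu> using alg_iso_iff by auto
  have "rigid_algebras semi_alternative // alg_iso = orbit ` set representatives"
    unfolding quotient_def rigid_algebras_variety cls
  proof (intro equalityI subsetI)
    fix X assume "X \<in> (\<Union>\<mu>\<in>(\<Union>\<kappa>\<in>set representatives. orbit \<kappa>). {orbit \<mu>})"
    then obtain \<kappa> \<mu> where "\<kappa> \<in> set representatives" "\<mu> \<in> orbit \<kappa>" "X = orbit \<mu>" by blast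
    then show "X \<in> orbit ` set representatives" using orbit_eq by auto
  next
    fix X assume "X \<in> orbit ` set representatives"
    then show "X \<in> (\<Union>\<mu>\<in>(\<Union>\<kappa>\<in>set representatives. orbit \<kappa>). {orbit \<mu>})" using orbit_refl by blast
  qed
  moreover have "inj_on orbit (set representatives)"
    by (rule inj_onI) (metis order_refl orbit_closures_inclusion)
  ultimately show ?thesis by (simp add: card_image card_representatives)
qed

theorem theoremG2:
  shows "krull_dim semi_alternative_variety = 9 \<and>
    irreducible_components semi_alternative_variety =
      {zariski closure_of orbit A07, zariski closure_of orbit S03, zariski closure_of orbit S06,
       zariski closure_of orbit S09, zariski closure_of orbit S11, zariski closure_of orbit S12,
       zariski closure_of orbit S13} \<and>
    card (irreducible_components semi_alternative_variety) = 7 \<and>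
    card (rigid_algebras semi_alternative // alg_iso) = 7"
proof (intro conjI)
  show "krull_dim semi_alternative_variety = 9"
    using krull_dim_le krull_dim_ge by (rule antisym)
  show "irreducible_components semi_alternative_variety =
      {zariski closure_of orbit A07, zariski closure_of orbit S03, zariski closure_of orbit S06,
       zariski closure_of orbit S09, zariski closure_of orbit S11, zariski closure_of orbit S12,
       zariski closure_of orbit S13}"
    unfolding irreducible_components_variety representatives_def by auto
  have "inj_on orbit_closure (set representatives)"
    by (rule inj_onI) (metis order_refl orbit_closures_inclusion)
  then show "card (irreducible_components semi_alternative_variety) = 7"
    unfolding irreducible_components_variety by (simp add: card_image card_representatives)
  show "card (rigid_algebras semi_alternative // alg_iso) = 7" by (rule card_rigid_classes)
qed

end
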